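(* Let MCPI (Multiple Change Point Identification) be the algorithm, with inputs $\delta\in(0,1)$ and $N$, described in the context. MCPI is an Exact-$(N,\delta)$ policy and an Any-$(N,\delta)$ policy. Moreover, for any $v\in V_{K,m}$ where $m\ge N$, writing $\pi$ for MCPI and $\tau_\delta$ for its stopping time, the expected sample complexity of MCPI satisfies $$\limsup_{\delta\to0}\frac{\mathbb E_{\pi,v}[\tau_\delta]}{\log(1/\delta)}\ \le\ 8\sigma^2\left(\sum_{i=1}^N\frac1{\Delta_{(i)}^2}\right),$$ where $\Delta_{(1)}\ge\dots\ge\Delta_{(m)}$ are the change magnitudes of $v$ in decreasing order.
   Context: Setting. There are $K$ arms $[K]=\{1,\dots,K\}$. An environment $v$ is given by mean rewards $(\mu_{v,i})_{i=1}^K$; the reward distribution of arm $i$ is $\mathcal N(\mu_{v,i},\sigma^2)$, where the noise variance is known and taken to be $\sigma^2=1$ (the symbol $\sigma^2$ is kept in formulas). In each round $t=1,2,\dots$ the learner plays $a_t\in[K]$ and observes $y_t=\mu_{v,a_t}+\epsilon_t$ with $\epsilon_t$ i.i.d. $\mathcal N(0,\sigma^2)$. Environments and change points. The set of change points of $v$ is $\underline x^*_v=\{j\in[K-1]:\mu_{v,j}\neq\mu_{v,j+1}\}$. For each $m$, $V_{K,m}$ is the class of environments with $K$ arms and exactly $m$ change points, written $x^*_{v,1}<\dots<x^*_{v,m}$, where every environment in the class has its change points separated by at least one action: $x^*_{v,i}+1<x^*_{v,i+1}$ for all $i\in\{1,\dots,m-1\}$. The magnitudes are $\Delta_{v,j}=|\mu_{v,x^*_{v,j}}-\mu_{v,x^*_{v,j}+1}|$.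 Policies. A policy $\pi$ consists of a sampling rule (choosing the action in each round given the actions and rewards observed so far), a stopping rule defining a stopping time $\tau$, and a recommendation rule returning an estimate $\hat{\underline x}_\tau$ after stopping. $\mathbb P_{\pi,v}$ and $\mathbb E_{\pi,v}$ are the probability and expectation induced by the interaction of $\pi$ with $v$. An Exact-$(N,\delta)$ policy is one such that for every $v\in V_{K,N}$: $\mathbb P_{\pi,v}(\hat{\underline x}_\tau=\underline x^*_v)>1-\delta$ and $\mathbb P_{\pi,v}(\tau<\infty)=1$. An Any-$(N,\delta)$ policy is one returning an estimate $\hat{\underline x}_\tau$ of size $N$ such that for every $m\ge N$ and every $v\in V_{K,m}$: $\mathbb P_{\pi,v}(\hat{\underline x}_\tau\subseteq\underline x^*_v)>1-\delta$ and $\mathbb P_{\pi,v}(\tau<\infty)=1$. Quantities used by MCPI. $T_i(t)$ is the number of times arm $i$ has been played up to round $t$ and $\hat\mu_i(t)$ is the empirical mean of the rewards obtained from arm $i$ up to round $t$. For $S\subseteq[K-1]$, $\hat x_t(S)=\arg\max_{a\in S}|\hat\mu_a(t)-\hat\mu_{a+1}(t)|$. The threshold is $\beta(t,\delta)=\log(t\gamma(K-1)/\delta)+8\log\log(t\gamma(K-1)/\delta)$ with $\gamma=2e^39^6/\log(3)$. For the current estimate $\hat x_t$, $$Z(t)=\frac{T_{\hat x_t}(t)\,T_{\hat x_t+1}(t)}{2\big(T_{\hat x_t}(t)+T_{\hat x_t+1}(t)\big)}\,|\hat\mu_{\hat x_t}(t)-\hat\mu_{\hat x_t+1}(t)|^2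 .$$ Also $r(t)=\sqrt{\dfrac{4\log(t)+2\log(2\log(t))+1/2}{(t^{1/4}-K)_+}}$. MCPI. Input $\delta\in(0,1)$ and the number $N$ of changes to look for. Initialize $S\leftarrow[K-1]$ and $\hat{\underline x}_\tau\leftarrow\emptyset$, and play each action once. Then run $N$ phases. In each phase, while $Z(t)<\beta(t,\delta/N)$, do the following in each round: (i) update the empirical means; (ii) if there exist $i,j\in[K-1]$ with $|\hat\mu_i(t)-\hat\mu_{i+1}(t)|>|\hat\mu_j(t)-\hat\mu_{j+1}(t)|+r(t)$, set $\hat x_t=\hat x_t(S)$, otherwise keep the previous estimate, $\hat x_t=\hat x_{t-1}$; (iii) if $\min_{i\in[K]}T_i(t)<\sqrt t$, play $a_t=\arg\min_{i\in[K]}T_i(t)$ (forced exploration), otherwise play $a_t=\arg\min_{i\in\{\hat x_t,\hat x_t+1\}}T_i(t)$ (tracking). When the while loop ends, set $\hat{\underline x}_\tau\leftarrow\hat{\underline x}_\tau\cup\{\hat x_t\}$ and $S\leftarrow S\setminus\{\hat x_t\}$, and go to the next phase. After $N$ phases stop (this defines $\tau_\delta$) and return $\hat{\underline x}_\tau$.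
   Formalization: In step (ii) the previous estimate is kept only if it is still in S; at the first estimation and at the start of each later phase it is recomputed as the arg max over S before Z is tested, since otherwise the removed point would be returned again. Also 1 ≤ N ≤ K−1 is assumed. *)

theory Defs
  imports "HOL-Probability.Probability"
begin

section \<open>Environments and change points\<close>

text \<open>The common standard deviation \<open>\<sigma>\<close> of the reward distributions is known and equal to 1.\<close>

definition noise_sd :: real where
  "noise_sd = 1"

text \<open>An environment with \<open>K\<close> arms is a vector of means; only its values at the arms
  \<open>1, \<dots>, K\<close> are ever used.\<close>

type_synonym env = "nat \<Rightarrow> real"

definition change_points :: "nat \<Rightarrow> env \<Rightarrow> nat set" where
  "change_points K v = {j \<in> {1..K - 1}. v j \<noteq> v (j + 1)}"

text \<open>The \<open>i\<close>-th change point from the left, for \<open>1 \<le> i \<le> m\<close>, and its magnitude.\<close>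

definition change_point :: "nat \<Rightarrow> env \<Rightarrow> nat \<Rightarrow> nat" where
  "change_point K v i = sorted_list_of_set (change_points K v) ! (i - 1)"

definition magnitude :: "nat \<Rightarrow> env \<Rightarrow> nat \<Rightarrow> real" where
  "magnitude K v j = \<bar>v (change_point K v j) - v (change_point K v j + 1)\<bar>"

text \<open>\<open>\<Delta>\<^sub>(\<^sub>i\<^sub>)\<close>: the \<open>i\<close>-th largest magnitude, counted with multiplicity, for \<open>1 \<le> i \<le> m\<close>.\<close>

definition ordered_magnitude :: "nat \<Rightarrow> env \<Rightarrow> nat \<Rightarrow> real" where
  "ordered_magnitude K v i =
     rev (sort (map (magnitude K v) [1..<card (change_points K v) + 1])) ! (i - 1)"

definition env_class :: "nat \<Rightarrow> nat \<Rightarrow> env set" where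
  "env_class K m = {v. card (change_points K v) = m \<and>
     (\<forall>i\<in>{1..<m}. change_point K v i + 1 < change_point K v (i + 1))}"

section \<open>Policies and their interaction with an environment\<close>

text \<open>A history lists the (action, reward) pairs of the rounds played so far, most recent first.\<close>

type_synonym history = "(nat \<times> real) list"

record policy =
  sampling :: "history \<Rightarrow> nat"
  stopping :: "history \<Rightarrow> bool"
  recommendation :: "history \<Rightarrow> nat set"

definition history_space :: "nat \<Rightarrow> nat \<Rightarrow> (nat \<Rightarrow> nat \<times> real) measure" where
  "history_space K t = (\<Pi>\<^sub>M s\<in>{..<t}. count_space {1..K} \<Otimes>\<^sub>M borel)"

text \<open>The target spaces also express that the actions lie in \<open>[K]\<close> and that the estimates are
  subsets of \<open>[K - 1]\<close>.\<close>

definition is_policy :: "nat \<Rightarrow> policy \<Rightarrow> bool" where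
  "is_policy K \<pi> \<longleftrightarrow> (\<forall>t.
     (\<lambda>x. sampling \<pi> (map x [0..<t])) \<in> history_space K t \<rightarrow>\<^sub>M count_space {1..K} \<and>
     (\<lambda>x. stopping \<pi> (map x [0..<t])) \<in> history_space K t \<rightarrow>\<^sub>M count_space UNIV \<and>
     (\<lambda>x. recommendation \<pi> (map x [0..<t])) \<in> history_space K t \<rightarrow>\<^sub>M count_space (Pow {1..K - 1}))"

text \<open>The interaction is realised on the space of i.i.d. Gaussian noise sequences;
  \<open>\<omega> t\<close> is the noise of round \<open>t + 1\<close>.\<close>

definition noise :: "(nat \<Rightarrow> real) measure" where
  "noise = (\<Pi>\<^sub>M t\<in>UNIV. density lborel (\<lambda>x. ennreal (normal_density 0 noise_sd x)))"

primrec hist :: "policy \<Rightarrow> env \<Rightarrow> (nat \<Rightarrow> real) \<Rightarrow> nat \<Rightarrow> history" where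
  "hist \<pi> v \<omega> 0 = []"
| "hist \<pi> v \<omega> (Suc t) =
     (let h = hist \<pi> v \<omega> t; a = sampling \<pi> h in (a, v a + \<omega> t) # h)"

text \<open>The infimum of the empty set is \<open>\<infinity>\<close>.\<close>

definition stop_time :: "policy \<Rightarrow> env \<Rightarrow> (nat \<Rightarrow> real) \<Rightarrow> enat" where
  "stop_time \<pi> v \<omega> = Inf {enat t | t. stopping \<pi> (hist \<pi> v \<omega> t)}"

text \<open>The returned estimate, meaningful only when the stopping time is finite.\<close>

definition estimate :: "policy \<Rightarrow> env \<Rightarrow> (nat \<Rightarrow> real) \<Rightarrow> nat set" where
  "estimate \<pi> v \<omega> = recommendation \<pi> (hist \<pi> v \<omega> (the_enat (stop_time \<pi> v \<omega>)))"

definition expected_stop_time :: "policy \<Rightarrow> env \<Rightarrow> ennreal" where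
  "expected_stop_time \<pi> v = (\<integral>\<^sup>+ \<omega>. ennreal_of_enat (stop_time \<pi> v \<omega>) \<partial>noise)"

definition exact_policy :: "nat \<Rightarrow> nat \<Rightarrow> real \<Rightarrow> policy \<Rightarrow> bool" where
  "exact_policy K N \<delta> \<pi> \<longleftrightarrow> is_policy K \<pi> \<and>
     (\<forall>v\<in>env_class K N.
        \<P>(\<omega> in noise. stop_time \<pi> v \<omega> < \<infinity> \<and> estimate \<pi> v \<omega> = change_points K v) > 1 - \<delta> \<and>
        \<P>(\<omega> in noise. stop_time \<pi> v \<omega> < \<infinity>) = 1)"

definition any_policy :: "nat \<Rightarrow> nat \<Rightarrow> real \<Rightarrow> policy \<Rightarrow> bool" where
  "any_policy K N \<delta> \<pi> \<longleftrightarrow> is_policy K \<pi> \<and>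
     (\<forall>v \<omega>. stop_time \<pi> v \<omega> < \<infinity> \<longrightarrow> card (estimate \<pi> v \<omega>) = N) \<and>
     (\<forall>m\<ge>N. \<forall>v\<in>env_class K m.
        \<P>(\<omega> in noise. stop_time \<pi> v \<omega> < \<infinity> \<and> estimate \<pi> v \<omega> \<subseteq> change_points K v) > 1 - \<delta> \<and>
        \<P>(\<omega> in noise. stop_time \<pi> v \<omega> < \<infinity>) = 1)"

section \<open>The algorithm\<close>

definition plays :: "history \<Rightarrow> nat \<Rightarrow> nat" where
  "plays h i = length (filter (\<lambda>p. fst p = i) h)"

definition emp_mean :: "history \<Rightarrow> nat \<Rightarrow> real" where
  "emp_mean h i = (\<Sum>p\<leftarrow>filter (\<lambda>p. fst p = i) h. snd p) / real (plays h i)"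

definition gap :: "history \<Rightarrow> nat \<Rightarrow> real" where
  "gap h i = \<bar>emp_mean h i - emp_mean h (i + 1)\<bar>"

definition gamma_const :: real where
  "gamma_const = 2 * exp 3 * 9 ^ 6 / ln 3"

definition threshold :: "nat \<Rightarrow> nat \<Rightarrow> real \<Rightarrow> real" where
  "threshold K t \<delta> =
     ln (real t * gamma_const * (real K - 1) / \<delta>)
     + 8 * ln (ln (real t * gamma_const * (real K - 1) / \<delta>))"

definition Z_stat :: "history \<Rightarrow> nat \<Rightarrow> real" where
  "Z_stat h x = real (plays h x) * real (plays h (x + 1))
     / (2 * (real (plays h x) + real (plays h (x + 1)))) * (gap h x)\<^sup>2"

text \<open>A vanishing denominator, that is \<open>t\<^sup>1\<^sup>/\<^sup>4 \<le> K\<close>, gives the value \<open>\<infinity>\<close>.\<close>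

definition radius :: "nat \<Rightarrow> nat \<Rightarrow> ereal" where
  "radius K t =
     (let d = max 0 (root 4 (real t) - real K) in
      if d = 0 then \<infinity>
      else ereal (sqrt ((4 * ln (real t) + 2 * ln (2 * ln (real t)) + 1 / 2) / d)))"

text \<open>Step (ii), where \<open>F\<close> holds the change points found in the completed phases (so that the
  candidate set is \<open>S = [K - 1] - F\<close>) and \<open>x\<close> is the previous estimate. The previous estimate
  can only be kept if it is still a candidate: at the first estimation and at the start of each
  later phase the estimate is computed afresh. Ties in the arg max, as in the arg min below,
  are broken by an unspecified choice.\<close>

definition new_estimate :: "nat \<Rightarrow> history \<Rightarrow> nat set \<Rightarrow> nat \<Rightarrow> nat" where
  "new_estimate K h F x =
     (let S = {1..K - 1} - F in
      if x \<notin> S \<or> (\<exists>i\<in>{1..K - 1}. \<exists>j\<in>{1..K - 1}.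
                     ereal (gap h i) > ereal (gap h j) + radius K (length h))
      then arg_max_on (gap h) S
      else x)"

text \<open>A state \<open>(k, F, x)\<close> consists of the number \<open>k\<close> of phases still to be completed, the set \<open>F\<close>
  returned so far, and the current estimate \<open>x\<close>. After each round, every phase whose while loop
  ends at that time is closed, possibly several at once.\<close>

primrec close_phases ::
  "nat \<Rightarrow> nat \<Rightarrow> real \<Rightarrow> history \<Rightarrow> nat \<Rightarrow> nat set \<Rightarrow> nat \<Rightarrow> nat \<times> nat set \<times> nat" where
  "close_phases K N \<delta> h 0 F x = (0, F, x)"
| "close_phases K N \<delta> h (Suc k) F x =
     (let y = new_estimate K h F x in
      if Z_stat h y < threshold K (length h) (\<delta> / real N) then (Suc k, F, y)
      else close_phases K N \<delta> h k (insert y F) y)"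

text \<open>The value 0, which is not a candidate, stands for the missing estimate before every arm
  has been played.\<close>

primrec mcpi_state :: "nat \<Rightarrow> nat \<Rightarrow> real \<Rightarrow> history \<Rightarrow> nat \<times> nat set \<times> nat" where
  "mcpi_state K N \<delta> [] = (N, {}, 0)"
| "mcpi_state K N \<delta> (p # h) =
     (if length (p # h) < K then (N, {}, 0)
      else case mcpi_state K N \<delta> h of (k, F, x) \<Rightarrow> close_phases K N \<delta> (p # h) k F x)"

text \<open>After the initialisation (round \<open>t \<le> K\<close> plays arm \<open>t\<close>), the action of round \<open>t + 1\<close> is
  computed from the statistics of the first \<open>t\<close> rounds.\<close>

definition mcpi_sampling :: "nat \<Rightarrow> nat \<Rightarrow> real \<Rightarrow> history \<Rightarrow> nat" where
  "mcpi_sampling K N \<delta> h =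
     (if length h < K then length h + 1
      else if real (MIN i\<in>{1..K}. plays h i) < sqrt (real (length h))
      then arg_min_on (plays h) {1..K}
      else case mcpi_state K N \<delta> h of (k, F, x) \<Rightarrow> arg_min_on (plays h) {x, x + 1})"

definition mcpi :: "nat \<Rightarrow> nat \<Rightarrow> real \<Rightarrow> policy" where
  "mcpi K N \<delta> =
     \<lparr>sampling = mcpi_sampling K N \<delta>,
      stopping = (\<lambda>h. fst (mcpi_state K N \<delta> h) = 0),
      recommendation = (\<lambda>h. fst (snd (mcpi_state K N \<delta> h)))\<rparr>"

end

theory Submission
  imports Defs "HOL-Real_Asymp.Real_Asymp"
begin

text \<open>
  For a pair of arms the product of two Gaussian mixtures of the exponential martingales of their
  noise sums is a supermartingale, so Ville's inequality bounds \<open>Z\<close> uniformly in time at every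
  position that is not a change point; this gives correctness. Forced exploration makes all
  empirical means accurate from a round of order \<open>\<surd>t\<close> on, up to an event of summable probability.
  From then on only pairs among the largest changes are tracked, and a pair of magnitude \<open>\<Delta>\<close> is left
  once both its arms have about \<open>4 ln (1 / \<delta>) / \<Delta>\<^sup>2\<close> plays.

  The delicate point is a tie at the \<open>N\<close>-th largest magnitude \<open>D\<close>, where the estimate may
  switch between more pairs than will be returned. If two tied pairs that have not been found both
  receive a linear number of plays \<open>M\<close>, then one of them keeps its empirical gap above
  \<open>D - C / \<surd>M\<close> all the way from \<open>\<surd>t\<close> to \<open>M\<close> plays. A random walk achieves this only
  with small probability, because at each geometric scale it has a fixed chance of dropping low. So
  at most one pair is tracked in vain, and only the pairs of the \<open>N\<close> largest changes
  contribute to the leading term.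
\<close>
section \<open>The noise and the interaction\<close>

text \<open>The bound on two tied pairs holds only up to a fixed probability
  \<open>\<epsilon>'\<close>, and a constant cannot be summed over the rounds. So there are two tail
  bounds. \<open>tail_rough\<close> has a summable error but applies only beyond a large multiple
  \<open>B\<close> of \<open>ln (1 / \<delta>)\<close>; \<open>tail_fine\<close> applies beyond the
  sharp multiple with an extra error \<open>\<epsilon>'\<close>, which is thus paid for about
  \<open>B * ln (1 / \<delta>)\<close> rounds only and is chosen small compared with
  \<open>1 / B\<close>.

  Separation of the change points is used twice. It makes the arm pairs of distinct changes
  disjoint, so that a tracked arm reveals the tracked pair. For \<open>K > 2\<close> it also yields
  a position without a change, and comparison with it makes the test in step (ii) succeed at every
  late round, so the estimate is a current maximiser and never a stale one.

  The factor 8 in the bound counts both arms of a pair; the 4 per arm is the inverse of the weight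
  \<open>n * n / (2 * (n + n)) = n / 4\<close> of the squared gap in \<open>Z\<close>.\<close>

abbreviation std_normal :: "real measure" where
  "std_normal \<equiv> density lborel (\<lambda>x. ennreal (normal_density 0 1 x))"

lemma prob_space_std_normal: "prob_space std_normal"
  by (rule prob_space_normal_density) simp

lemma noise_eq: "noise = (\<Pi>\<^sub>M t\<in>UNIV. std_normal)"
  by (simp add: noise_def noise_sd_def)

lemma prob_space_noise: "prob_space noise"
  unfolding noise_eq by (intro prob_space_PiM prob_space_std_normal)

interpretation std_normal: prob_space std_normal
  by (rule prob_space_std_normal)

interpretation noise: prob_space noise
  by (rule prob_space_noise)

lemma space_noise [simp]: "space noise = UNIV"
  by (simp add: noise_eq space_PiM)

lemma measurable_noise_component [measurable]: "(\<lambda>\<omega>. \<omega> t) \<in> borel_measurable noise"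
proof -
  have "(\<lambda>\<omega>. \<omega> t) \<in> noise \<rightarrow>\<^sub>M std_normal"
    unfolding noise_eq by (rule measurable_component_singleton) simp
  then show ?thesis
    by (simp cong: measurable_cong_sets)
qed

lemma measurable_noise_update [measurable]:
  "(\<lambda>p. (snd p)(t := fst p)) \<in> std_normal \<Otimes>\<^sub>M noise \<rightarrow>\<^sub>M noise"
proof -
  have "(\<lambda>p. (snd p)(t := fst p)) \<in> std_normal \<Otimes>\<^sub>M noise \<rightarrow>\<^sub>M (\<Pi>\<^sub>M t\<in>UNIV. std_normal)"
  proof (rule measurable_PiM_single')
    fix i :: nat
    show "(\<lambda>p. ((snd p)(t := fst p)) i) \<in> std_normal \<Otimes>\<^sub>M noise \<rightarrow>\<^sub>M std_normal"
      by (cases "i = t") (auto cong: measurable_cong_sets)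
  qed auto
  then show ?thesis by (simp add: noise_eq)
qed

text \<open>Replaces conditional expectation given the past: the history up to round
  \<open>t\<close> ignores coordinate \<open>t\<close>, so the inner integral averages over the next
  reward alone. Resampling one coordinate preserves the product measure.\<close>

lemma nn_integral_noise_resample:
  assumes [measurable]: "f \<in> borel_measurable noise"
  shows "(\<integral>\<^sup>+\<omega>. f \<omega> \<partial>noise) = (\<integral>\<^sup>+\<omega>. (\<integral>\<^sup>+z. f (fun_upd \<omega> t z) \<partial>std_normal) \<partial>noise)"
proof -
  interpret pair_sigma_finite std_normal noise ..
  have *: "distr (std_normal \<Otimes>\<^sub>M noise) noise (\<lambda>(x, X). X(t := x)) = noise"
    using distr_pair_PiM_eq_PiM[of UNIV "\<lambda>_::nat. std_normal" t] prob_space_std_normal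
    by (simp add: noise_eq)
  have [measurable]: "(\<lambda>(x, X). X(t := x)) \<in> std_normal \<Otimes>\<^sub>M noise \<rightarrow>\<^sub>M noise"
    using measurable_noise_update[of t] by (simp add: split_beta')
  have "(\<integral>\<^sup>+\<omega>. f \<omega> \<partial>noise) = (\<integral>\<^sup>+\<omega>. f \<omega> \<partial>distr (std_normal \<Otimes>\<^sub>M noise) noise (\<lambda>(x, X). X(t := x)))"
    by (simp add: *)
  also have "\<dots> = (\<integral>\<^sup>+p. f ((snd p)(t := fst p)) \<partial>(std_normal \<Otimes>\<^sub>M noise))"
    by (subst nn_integral_distr) (auto simp: split_beta')
  also have "\<dots> = (\<integral>\<^sup>+\<omega>. (\<integral>\<^sup>+z. f (fun_upd \<omega> t z) \<partial>std_normal) \<partial>noise)"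
    by (subst nn_integral_snd[symmetric]) (auto simp: split_beta')
  finally show ?thesis .
qed

lemma length_hist [simp]: "length (hist \<pi> v \<omega> t) = t"
  by (induction t) (auto simp: Let_def)

lemma hist_cong: "(\<And>s. s < t \<Longrightarrow> \<omega> s = \<omega>' s) \<Longrightarrow> hist \<pi> v \<omega> t = hist \<pi> v \<omega>' t"
  by (induction t) (auto simp: Let_def)

lemma hist_update [simp]: "s \<le> t \<Longrightarrow> hist \<pi> v (fun_upd \<omega> t z) s = hist \<pi> v \<omega> s"
  by (rule hist_cong) auto

lemma hist_Suc: "hist \<pi> v \<omega> (Suc t) =
    (sampling \<pi> (hist \<pi> v \<omega> t), v (sampling \<pi> (hist \<pi> v \<omega> t)) + \<omega> t) # hist \<pi> v \<omega> t"
  by (simp add: Let_def)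

text \<open>Brings the history into the shape of a point of \<open>history_space\<close>, the form
  in which \<open>is_policy\<close> asserts measurability.\<close>

lemma hist_map: "hist \<pi> v \<omega> t = map (\<lambda>s\<in>{..<t}. hist \<pi> v \<omega> t ! s) [0..<t]"
  by (rule nth_equalityI) auto

declare hist.simps(2) [simp del]

lemma sets_noiseI: "Measurable.pred noise P \<Longrightarrow> {\<omega>. P \<omega>} \<in> sets noise"
  by (simp add: pred_def)

locale bandit =
  fixes K :: nat and \<pi> :: policy and v :: env
  assumes policy: "is_policy K \<pi>"
begin

abbreviation H :: "(nat \<Rightarrow> real) \<Rightarrow> nat \<Rightarrow> history" where
  "H \<equiv> hist \<pi> v"

lemma of_hist_eq: "(\<lambda>\<omega>. f (H \<omega> t)) = (\<lambda>\<omega>. f (map (\<lambda>s\<in>{..<t}. H \<omega> t ! s) [0..<t]))"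
  by (intro ext arg_cong[where f = f] hist_map)

lemma measurable_history: "(\<lambda>\<omega>. \<lambda>s\<in>{..<t}. H \<omega> t ! s) \<in> noise \<rightarrow>\<^sub>M history_space K t"
proof (induction t)
  case 0
  then show ?case by (auto simp: history_space_def measurable_restrict)
next
  case (Suc t)
  have samp: "(\<lambda>\<omega>. sampling \<pi> (H \<omega> t)) \<in> noise \<rightarrow>\<^sub>M count_space {1..K}"
    by (subst of_hist_eq, rule measurable_compose[OF Suc])
       (use policy in \<open>auto simp: is_policy_def\<close>)
  show ?case
    unfolding history_space_def
  proof (rule measurable_restrict)
    fix s assume s: "s \<in> {..<Suc t}"
    show "(\<lambda>\<omega>. H \<omega> (Suc t) ! s) \<in> noise \<rightarrow>\<^sub>M count_space {1..K} \<Otimes>\<^sub>M borel"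
    proof (cases s)
      case 0
      have "(\<lambda>\<omega>. v (sampling \<pi> (H \<omega> t))) \<in> borel_measurable noise"
        by (rule measurable_compose[OF samp]) simp
      then show ?thesis
        using samp by (simp add: 0 hist_Suc)
    next
      case (Suc s')
      have "(\<lambda>\<omega>. (\<lambda>s\<in>{..<t}. H \<omega> t ! s) s') \<in> noise \<rightarrow>\<^sub>M count_space {1..K} \<Otimes>\<^sub>M borel"
        using s Suc by (intro measurable_compose[OF Suc.IH[unfolded history_space_def] measurable_component_singleton]) auto
      then show ?thesis using s by (simp add: Suc hist_Suc)
    qed
  qed
qed

lemma measurable_of_hist:
  assumes "(\<lambda>x. f (map x [0..<t])) \<in> history_space K t \<rightarrow>\<^sub>M N"
  shows "(\<lambda>\<omega>. f (H \<omega> t)) \<in> noise \<rightarrow>\<^sub>M N"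
  by (subst of_hist_eq, rule measurable_compose[OF measurable_history assms])

lemma measurable_sampling: "(\<lambda>\<omega>. sampling \<pi> (H \<omega> t)) \<in> noise \<rightarrow>\<^sub>M count_space {1..K}"
  using policy by (intro measurable_of_hist) (auto simp: is_policy_def)

lemma measurable_sampling' [measurable]: "(\<lambda>\<omega>. sampling \<pi> (H \<omega> t)) \<in> noise \<rightarrow>\<^sub>M count_space UNIV"
  by (rule measurable_compose[OF measurable_sampling measurable_count_space])

lemma measurable_stopping [measurable]: "Measurable.pred noise (\<lambda>\<omega>. stopping \<pi> (H \<omega> t))"
  using policy by (intro measurable_of_hist) (auto simp: is_policy_def)

lemma measurable_recommendation:
  "(\<lambda>\<omega>. recommendation \<pi> (H \<omega> t)) \<in> noise \<rightarrow>\<^sub>M count_space (Pow {1..K - 1})"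
  using policy by (intro measurable_of_hist) (auto simp: is_policy_def)

lemma measurable_recommendation' [measurable]:
  "(\<lambda>\<omega>. recommendation \<pi> (H \<omega> t)) \<in> noise \<rightarrow>\<^sub>M count_space UNIV"
  by (rule measurable_compose[OF measurable_recommendation measurable_count_space])

lemma sampling_range: "sampling \<pi> (H \<omega> t) \<in> {1..K}"
  using measurable_space[OF measurable_sampling, of \<omega> t] by simp

text \<open>Ville's maximal inequality: the process that is frozen at 1 once the potential has
  reached 1 is a supermartingale.\<close>

lemma ville_finite:
  fixes \<Phi> :: "history \<Rightarrow> ennreal"
  assumes meas [measurable]: "\<And>t. (\<lambda>\<omega>. \<Phi> (H \<omega> t)) \<in> borel_measurable noise"
  assumes super: "\<And>\<omega> t a. a = sampling \<pi> (H \<omega> t) \<Longrightarrow>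
      (\<integral>\<^sup>+z. \<Phi> ((a, v a + z) # H \<omega> t) \<partial>std_normal) \<le> \<Phi> (H \<omega> t)"
  shows "emeasure noise {\<omega>. \<exists>s\<le>t. 1 \<le> \<Phi> (H \<omega> s)} \<le> \<Phi> []"
proof -
  define X where "X t \<omega> = (if \<exists>s\<le>t. 1 \<le> \<Phi> (H \<omega> s) then 1 else \<Phi> (H \<omega> t))" for t \<omega>
  have [measurable]: "X t \<in> borel_measurable noise" for t
    unfolding X_def by measurable
  have X0: "(\<integral>\<^sup>+\<omega>. X t \<omega> \<partial>noise) \<le> \<Phi> []" for t
  proof (induction t)
    case 0
    have "(\<integral>\<^sup>+\<omega>. X 0 \<omega> \<partial>noise) \<le> (\<integral>\<^sup>+\<omega>. \<Phi> [] \<partial>noise)"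
      by (intro nn_integral_mono) (auto simp: X_def)
    then show ?case by (simp add: noise.emeasure_space_1 [simplified])
  next
    case (Suc t)
    have "(\<integral>\<^sup>+z. X (Suc t) (fun_upd \<omega> t z) \<partial>std_normal) \<le> X t \<omega>" for \<omega>
    proof (cases "\<exists>s\<le>t. 1 \<le> \<Phi> (H \<omega> s)")
      case True
      then have "X (Suc t) (fun_upd \<omega> t z) = 1" for z
        unfolding X_def by (smt (verit) hist_update le_SucI)
      moreover have "X t \<omega> = 1" using True by (simp add: X_def)
      ultimately show ?thesis using std_normal.emeasure_space_1 by simp
    next
      case False
      let ?a = "sampling \<pi> (H \<omega> t)"
      have "X (Suc t) (fun_upd \<omega> t z) \<le> \<Phi> ((?a, v ?a + z) # H \<omega> t)" for z
      proof -
        have "\<Phi> (H (fun_upd \<omega> t z) (Suc t)) = \<Phi> ((?a, v ?a + z) # H \<omega> t)"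
          by (simp add: hist_Suc)
        moreover have "\<not> 1 \<le> \<Phi> (H (fun_upd \<omega> t z) s)" if "s \<le> t" for s
          using False that by auto
        ultimately show ?thesis
          unfolding X_def by (auto simp: le_Suc_eq)
      qed
      then have "(\<integral>\<^sup>+z. X (Suc t) (fun_upd \<omega> t z) \<partial>std_normal)
          \<le> (\<integral>\<^sup>+z. \<Phi> ((?a, v ?a + z) # H \<omega> t) \<partial>std_normal)"
        by (intro nn_integral_mono) auto
      also have "\<dots> \<le> \<Phi> (H \<omega> t)" by (rule super) simp
      also have "\<dots> = X t \<omega>" using False by (auto simp: X_def)
      finally show ?thesis .
    qed
    then have "(\<integral>\<^sup>+\<omega>. X (Suc t) \<omega> \<partial>noise) \<le> (\<integral>\<^sup>+\<omega>. X t \<omega> \<partial>noise)"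
      by (subst nn_integral_noise_resample[where t = t]) (auto intro!: nn_integral_mono)
    then show ?case using Suc by simp
  qed
  have "emeasure noise {\<omega>. \<exists>s\<le>t. 1 \<le> \<Phi> (H \<omega> s)} =
      (\<integral>\<^sup>+\<omega>. indicator {\<omega>. \<exists>s\<le>t. 1 \<le> \<Phi> (H \<omega> s)} \<omega> \<partial>noise)"
    by (rule nn_integral_indicator[symmetric], rule sets_noiseI) measurable
  also have "\<dots> \<le> (\<integral>\<^sup>+\<omega>. X t \<omega> \<partial>noise)"
    by (intro nn_integral_mono) (auto simp: X_def indicator_def)
  finally show ?thesis using X0 by (rule order_trans)
qed

lemma ville:
  fixes \<Phi> :: "history \<Rightarrow> ennreal"
  assumes meas [measurable]: "\<And>t. (\<lambda>\<omega>. \<Phi> (H \<omega> t)) \<in> borel_measurable noise"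
  assumes super: "\<And>\<omega> t a. a = sampling \<pi> (H \<omega> t) \<Longrightarrow>
      (\<integral>\<^sup>+z. \<Phi> ((a, v a + z) # H \<omega> t) \<partial>std_normal) \<le> \<Phi> (H \<omega> t)"
  shows "emeasure noise {\<omega>. \<exists>s. 1 \<le> \<Phi> (H \<omega> s)} \<le> \<Phi> []"
proof -
  have "{\<omega>. \<exists>s. 1 \<le> \<Phi> (H \<omega> s)} = (\<Union>t. {\<omega>. \<exists>s\<le>t. 1 \<le> \<Phi> (H \<omega> s)})"
    by auto
  also have "emeasure noise \<dots> = (SUP t. emeasure noise {\<omega>. \<exists>s\<le>t. 1 \<le> \<Phi> (H \<omega> s)})"
  proof (rule SUP_emeasure_incseq[symmetric])
    have "{\<omega>. \<exists>s\<le>t. 1 \<le> \<Phi> (H \<omega> s)} \<in> sets noise" for t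
      by (rule sets_noiseI) measurable
    then show "range (\<lambda>t. {\<omega>. \<exists>s\<le>t. 1 \<le> \<Phi> (H \<omega> s)}) \<subseteq> sets noise" by auto
    show "incseq (\<lambda>t. {\<omega>. \<exists>s\<le>t. 1 \<le> \<Phi> (H \<omega> s)})"
      by (auto simp: incseq_def) (meson order_trans)
  qed
  also have "\<dots> \<le> \<Phi> []"
    using ville_finite[OF assms] by (intro SUP_least) auto
  finally show ?thesis .
qed

end

section \<open>Self-normalised concentration\<close>

text \<open>Change of measure: the integrand is \<open>c\<close> times the likelihood ratio of a
  Gaussian to the standard one. The exponential formulas that follow reduce to completing a
  square.\<close>

lemma nn_integral_std_normal:
  assumes [measurable]: "f \<in> borel_measurable borel" and "\<And>z. f z = normal_density \<mu> \<sigma> z * c / normal_density 0 1 z"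
    and "0 < \<sigma>" "0 \<le> c"
  shows "(\<integral>\<^sup>+z. ennreal (f z) \<partial>std_normal) = ennreal c"
proof -
  have nd: "normal_density 0 1 z > 0" for z :: real by (simp add: normal_density_pos)
  have "(\<integral>\<^sup>+z. ennreal (f z) \<partial>std_normal) = (\<integral>\<^sup>+z. ennreal (normal_density 0 1 z) * ennreal (f z) \<partial>lborel)"
    by (subst nn_integral_density) auto
  also have "\<dots> = (\<integral>\<^sup>+z. ennreal c * ennreal (normal_density \<mu> \<sigma> z) \<partial>lborel)"
    using nd assms by (intro nn_integral_cong) (simp add: less_imp_neq[symmetric] flip: ennreal_mult' ennreal_mult'')
  also have "\<dots> = ennreal c * emeasure (density lborel (normal_density \<mu> \<sigma>)) UNIV"
    by (subst nn_integral_cmult) (auto simp: emeasure_density)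
  also have "\<dots> = ennreal c"
    using prob_space.emeasure_space_1[OF prob_space_normal_density[OF \<open>0 < \<sigma>\<close>, of \<mu>]] by simp
  finally show ?thesis .
qed

lemma nn_integral_std_normal_exp:
  "(\<integral>\<^sup>+z. ennreal (exp (\<theta> * z)) \<partial>std_normal) = ennreal (exp (\<theta>\<^sup>2 / 2))"
proof (rule nn_integral_std_normal[where \<mu> = \<theta> and \<sigma> = 1])
  fix z :: real
  have "\<theta> * z + - z\<^sup>2 / 2 = - (z - \<theta>)\<^sup>2 / 2 + \<theta>\<^sup>2 / 2"
    by (simp add: power2_eq_square field_simps)
  then have "exp (\<theta> * z) * exp (- z\<^sup>2 / 2) = exp (- (z - \<theta>)\<^sup>2 / 2) * exp (\<theta>\<^sup>2 / 2)"
    by (simp only: exp_add[symmetric])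
  then show "exp (\<theta> * z) = normal_density \<theta> 1 z * exp (\<theta>\<^sup>2 / 2) / normal_density 0 1 z"
    by (simp add: normal_density_def field_simps)
qed auto

text \<open>One-step martingale identity of the mixture: the mean of
  \<open>exp (S\<^sup>2 / (2 * \<tau>)) / sqrt \<tau>\<close> is unchanged when
  \<open>\<tau>\<close> grows by 1 and \<open>S\<close> by a standard normal variable.\<close>

lemma nn_integral_std_normal_exp_square:
  fixes \<tau> S :: real
  assumes "0 < \<tau>"
  shows "(\<integral>\<^sup>+z. ennreal (exp ((S + z)\<^sup>2 / (2 * (\<tau> + 1)))) \<partial>std_normal) =
    ennreal (sqrt ((\<tau> + 1) / \<tau>) * exp (S\<^sup>2 / (2 * \<tau>)))"
proof (rule nn_integral_std_normal[where \<mu> = "S / \<tau>" and \<sigma> = "sqrt ((\<tau> + 1) / \<tau>)"])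
  fix z :: real
  have "(S + z)\<^sup>2 / (2 * (\<tau> + 1)) + - z\<^sup>2 / 2 = - (z - S / \<tau>)\<^sup>2 / (2 * ((\<tau> + 1) / \<tau>)) + S\<^sup>2 / (2 * \<tau>)"
  proof -
    have "\<tau> + 1 \<noteq> 0" "\<tau> \<noteq> 0" using assms by auto
    then show ?thesis by (simp add: power2_eq_square divide_simps) algebra
  qed
  then have "exp ((S + z)\<^sup>2 / (2 * (\<tau> + 1))) * exp (- z\<^sup>2 / 2) =
      exp (- (z - S / \<tau>)\<^sup>2 / (2 * ((\<tau> + 1) / \<tau>))) * exp (S\<^sup>2 / (2 * \<tau>))"
    by (simp only: exp_add[symmetric])
  moreover define \<sigma> where "\<sigma> = sqrt ((\<tau> + 1) / \<tau>)"
  have \<sigma>: "0 < \<sigma>" "\<sigma>\<^sup>2 = (\<tau> + 1) / \<tau>" using assms by (auto simp: \<sigma>_def)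
  have "normal_density (S / \<tau>) \<sigma> z * \<sigma> = exp (- (z - S / \<tau>)\<^sup>2 / (2 * \<sigma>\<^sup>2)) / sqrt (2 * pi)"
    using \<sigma>(1) by (simp add: normal_density_def real_sqrt_mult)
  then have "normal_density (S / \<tau>) \<sigma> z * (\<sigma> * exp (S\<^sup>2 / (2 * \<tau>))) / normal_density 0 1 z =
      exp (- (z - S / \<tau>)\<^sup>2 / (2 * \<sigma>\<^sup>2)) * exp (S\<^sup>2 / (2 * \<tau>)) / exp (- z\<^sup>2 / 2)"
    by (simp add: mult.assoc[symmetric]) (simp add: normal_density_def)
  moreover have "exp ((S + z)\<^sup>2 / (2 * (\<tau> + 1))) =
      exp (- (z - S / \<tau>)\<^sup>2 / (2 * \<sigma>\<^sup>2)) * exp (S\<^sup>2 / (2 * \<tau>)) / exp (- z\<^sup>2 / 2)"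
    using calculation(1) unfolding \<sigma>(2) by (simp add: eq_divide_eq)
  ultimately show "exp ((S + z)\<^sup>2 / (2 * (\<tau> + 1))) =
      normal_density (S / \<tau>) (sqrt ((\<tau> + 1) / \<tau>)) z * (sqrt ((\<tau> + 1) / \<tau>) * exp (S\<^sup>2 / (2 * \<tau>)))
        / normal_density 0 1 z"
    unfolding \<sigma>_def[symmetric] by simp
qed (use assms in auto)

definition noise_sum :: "env \<Rightarrow> history \<Rightarrow> nat \<Rightarrow> real" where
  "noise_sum v h i = (\<Sum>p\<leftarrow>filter (\<lambda>p. fst p = i) h. snd p - v i)"

lemma plays_Nil [simp]: "plays [] i = 0"
  by (simp add: plays_def)

lemma plays_Cons: "plays (p # h) i = plays h i + (if fst p = i then 1 else 0)"
  by (simp add: plays_def)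

lemma noise_sum_Nil [simp]: "noise_sum v [] i = 0"
  by (simp add: noise_sum_def)

lemma noise_sum_Cons: "noise_sum v (p # h) i = noise_sum v h i + (if fst p = i then snd p - v i else 0)"
  by (simp add: noise_sum_def)

lemma emp_mean_eq:
  assumes "0 < plays h i"
  shows "emp_mean h i = v i + noise_sum v h i / real (plays h i)"
proof -
  have "(\<Sum>p\<leftarrow>xs. snd p) = real (length xs) * c + (\<Sum>p\<leftarrow>xs. snd p - c)" for xs :: history and c
    by (induction xs) (auto simp: algebra_simps)
  then have "(\<Sum>p\<leftarrow>filter (\<lambda>p. fst p = i) h. snd p) = real (plays h i) * v i + noise_sum v h i"
    by (simp add: plays_def noise_sum_def)
  then show ?thesis using assms by (simp add: emp_mean_def field_simps)
qed

lemma plays_sum: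
  assumes "finite A" "\<And>p. p \<in> set h \<Longrightarrow> fst p \<in> A"
  shows "(\<Sum>i\<in>A. plays h i) = length h"
  using assms(2)
  by (induction h) (use assms(1) in \<open>auto simp: plays_Cons sum.distrib\<close>)

text \<open>Logarithm of the product over \<open>i\<close> in \<open>I\<close> of the exponential
  martingales \<open>exp (\<theta> * S - \<theta>\<^sup>2 * T / 2)\<close>, each averaged over a
  centred Gaussian \<open>\<theta>\<close> of variance \<open>1 / \<rho>\<close>.\<close>

definition log_mix :: "env \<Rightarrow> real \<Rightarrow> nat set \<Rightarrow> history \<Rightarrow> real" where
  "log_mix v \<rho> I h = (\<Sum>i\<in>I. (noise_sum v h i)\<^sup>2 / (2 * (\<rho> + real (plays h i)))
      - ln ((\<rho> + real (plays h i)) / \<rho>) / 2)"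

context bandit
begin

lemma measurable_plays [measurable]: "(\<lambda>\<omega>. plays (H \<omega> t) i) \<in> noise \<rightarrow>\<^sub>M count_space UNIV"
  by (induction t) (simp_all add: hist_Suc plays_Cons)

lemma measurable_noise_sum [measurable]: "(\<lambda>\<omega>. noise_sum v (H \<omega> t) i) \<in> borel_measurable noise"
proof (induction t)
  case (Suc t)
  have "(\<lambda>\<omega>. v (sampling \<pi> (H \<omega> t))) \<in> borel_measurable noise"
    by (rule measurable_compose[OF measurable_sampling]) simp
  with Suc show ?case by (simp add: hist_Suc noise_sum_Cons)
qed simp

lemma measurable_log_mix [measurable]: "(\<lambda>\<omega>. log_mix v \<rho> I (H \<omega> t)) \<in> borel_measurable noise"
  unfolding log_mix_def by measurable

text \<open>At each round only the factor of the played arm changes, and its conditional mean is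
  preserved. Hence the product stays a martingale however the arms are chosen.\<close>

lemma log_mix_step:
  assumes "finite I" "0 < \<rho>"
  shows "(\<integral>\<^sup>+z. ennreal (exp (log_mix v \<rho> I ((a, v a + z) # h))) \<partial>std_normal) =
    ennreal (exp (log_mix v \<rho> I h))"
proof (cases "a \<in> I")
  case False
  then have "log_mix v \<rho> I ((a, v a + z) # h) = log_mix v \<rho> I h" for z
    unfolding log_mix_def by (intro sum.cong) (auto simp: noise_sum_Cons plays_Cons)
  then show ?thesis using std_normal.emeasure_space_1 by simp
next
  case True
  define \<tau> where "\<tau> = \<rho> + real (plays h a)"
  define r where "r = log_mix v \<rho> (I - {a}) h"
  have \<tau>: "0 < \<tau>" using assms by (simp add: \<tau>_def add_pos_nonneg)
  have split: "log_mix v \<rho> I h' = (noise_sum v h' a)\<^sup>2 / (2 * (\<rho> + real (plays h' a)))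
      - ln ((\<rho> + real (plays h' a)) / \<rho>) / 2 + log_mix v \<rho> (I - {a}) h'" for h'
    unfolding log_mix_def using assms True by (subst sum.remove[of I a]) auto
  have rest: "log_mix v \<rho> (I - {a}) ((a, v a + z) # h) = r" for z
    unfolding r_def log_mix_def by (intro sum.cong) (auto simp: noise_sum_Cons plays_Cons)
  have "exp (log_mix v \<rho> I ((a, v a + z) # h)) =
      exp (r - ln ((\<tau> + 1) / \<rho>) / 2) * exp ((noise_sum v h a + z)\<^sup>2 / (2 * (\<tau> + 1)))" for z
    by (simp only: split rest) (simp add: noise_sum_Cons plays_Cons \<tau>_def add_ac flip: exp_add)
  then have "(\<integral>\<^sup>+z. ennreal (exp (log_mix v \<rho> I ((a, v a + z) # h))) \<partial>std_normal) =
      ennreal (exp (r - ln ((\<tau> + 1) / \<rho>) / 2)) *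
      (\<integral>\<^sup>+z. ennreal (exp ((noise_sum v h a + z)\<^sup>2 / (2 * (\<tau> + 1)))) \<partial>std_normal)"
    by (simp add: ennreal_mult' nn_integral_cmult)
  also have "\<dots> = ennreal (exp (r - ln ((\<tau> + 1) / \<rho>) / 2) *
      (sqrt ((\<tau> + 1) / \<tau>) * exp ((noise_sum v h a)\<^sup>2 / (2 * \<tau>))))"
    by (simp only: nn_integral_std_normal_exp_square[OF \<tau>]) (simp add: ennreal_mult')
  also have "sqrt ((\<tau> + 1) / \<tau>) = exp (ln ((\<tau> + 1) / \<tau>) / 2)"
  proof -
    have "0 < (\<tau> + 1) / \<tau>" using \<tau> by simp
    then show ?thesis by (simp only: ln_sqrt[symmetric] exp_ln real_sqrt_gt_zero)
  qed
  also have "exp (r - ln ((\<tau> + 1) / \<rho>) / 2) * (exp (ln ((\<tau> + 1) / \<tau>) / 2) * exp ((noise_sum v h a)\<^sup>2 / (2 * \<tau>))) =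
      exp (log_mix v \<rho> I h)"
  proof -
    have "ln ((\<tau> + 1) / \<rho>) = ln (\<tau> + 1) - ln \<rho>" "ln ((\<tau> + 1) / \<tau>) = ln (\<tau> + 1) - ln \<tau>" "ln (\<tau> / \<rho>) = ln \<tau> - ln \<rho>"
      using \<tau> assms by (auto simp: ln_div)
    then have "r - ln ((\<tau> + 1) / \<rho>) / 2 + (ln ((\<tau> + 1) / \<tau>) / 2 + (noise_sum v h a)\<^sup>2 / (2 * \<tau>)) = log_mix v \<rho> I h"
      unfolding split[of h] r_def \<tau>_def[symmetric] by (simp add: field_simps)
    then show ?thesis by (simp only: exp_add[symmetric])
  qed
  finally show ?thesis .
qed

text \<open>Ville's inequality for \<open>\<alpha>\<close> times the mixture, which starts at
  \<open>\<alpha>\<close> because every summand of \<open>log_mix\<close> vanishes on the empty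
  history.\<close>

lemma prob_log_mix:
  assumes "finite I" "0 < \<rho>" "0 < \<alpha>"
  shows "measure noise {\<omega>. \<exists>t. ln (1 / \<alpha>) \<le> log_mix v \<rho> I (H \<omega> t)} \<le> \<alpha>"
proof -
  define \<Phi> where "\<Phi> h = ennreal \<alpha> * ennreal (exp (log_mix v \<rho> I h))" for h
  have "emeasure noise {\<omega>. \<exists>s. 1 \<le> \<Phi> (H \<omega> s)} \<le> \<Phi> []"
  proof (rule ville)
    show "(\<lambda>\<omega>. \<Phi> (H \<omega> t)) \<in> borel_measurable noise" for t
      unfolding \<Phi>_def by measurable
    show "(\<integral>\<^sup>+z. \<Phi> ((a, v a + z) # H \<omega> t) \<partial>std_normal) \<le> \<Phi> (H \<omega> t)" for a \<omega> t
    proof -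
      have [measurable]: "(\<lambda>z. log_mix v \<rho> I ((a, v a + z) # H \<omega> t)) \<in> borel_measurable borel"
        unfolding log_mix_def
      proof (rule borel_measurable_sum)
        fix i
        show "(\<lambda>z. (noise_sum v ((a, v a + z) # H \<omega> t) i)\<^sup>2 / (2 * (\<rho> + real (plays ((a, v a + z) # H \<omega> t) i)))
            - ln ((\<rho> + real (plays ((a, v a + z) # H \<omega> t) i)) / \<rho>) / 2) \<in> borel_measurable borel"
          by (cases "a = i") (simp_all add: noise_sum_Cons plays_Cons)
      qed
      show ?thesis
        unfolding \<Phi>_def by (subst nn_integral_cmult) (auto simp: log_mix_step assms)
    qed
  qed
  also have "\<Phi> [] = ennreal \<alpha>" using assms by (simp add: \<Phi>_def log_mix_def)
  also have "{\<omega>. \<exists>s. 1 \<le> \<Phi> (H \<omega> s)} = {\<omega>. \<exists>t. ln (1 / \<alpha>) \<le> log_mix v \<rho> I (H \<omega> t)}"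
  proof -
    have "1 \<le> \<Phi> h \<longleftrightarrow> ln (1 / \<alpha>) \<le> log_mix v \<rho> I h" for h
    proof -
      have "1 \<le> \<Phi> h \<longleftrightarrow> 1 \<le> \<alpha> * exp (log_mix v \<rho> I h)"
        using assms by (simp add: \<Phi>_def flip: ennreal_mult' ennreal_1)
      also have "\<dots> \<longleftrightarrow> 1 / \<alpha> \<le> exp (log_mix v \<rho> I h)"
        using assms by (simp add: field_simps)
      also have "\<dots> \<longleftrightarrow> ln (1 / \<alpha>) \<le> log_mix v \<rho> I h"
        using assms by (metis divide_pos_pos exp_le_cancel_iff exp_ln zero_less_one)
      finally show ?thesis .
    qed
    then show ?thesis by simp
  qed
  finally show ?thesis
    using assms by (simp add: noise.emeasure_eq_measure)
qed

end

section \<open>The algorithm as a policy\<close>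

lemma arg_max_on_mem:
  fixes f :: "nat \<Rightarrow> real"
  assumes "finite S" "S \<noteq> {}"
  shows "arg_max_on f S \<in> S" "\<And>a. a \<in> S \<Longrightarrow> f a \<le> f (arg_max_on f S)"
proof -
  have "Max (f ` S) \<in> f ` S" using assms by (intro Max_in) auto
  then obtain m where "m \<in> S" "f m = Max (f ` S)" by auto
  then have "is_arg_max f (\<lambda>x. x \<in> S) m"
    using assms by (auto simp: is_arg_max_def not_less)
  then have "is_arg_max f (\<lambda>x. x \<in> S) (arg_max_on f S)"
    unfolding arg_max_on_def arg_max_def by (rule someI)
  then show "arg_max_on f S \<in> S" "\<And>a. a \<in> S \<Longrightarrow> f a \<le> f (arg_max_on f S)"
    by (auto simp: is_arg_max_def not_less)
qed

lemma new_estimate_mem: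
  assumes "F \<subseteq> {1..K - 1}" "card F < K - 1"
  shows "new_estimate K h F x \<in> {1..K - 1} - F"
proof -
  have "{1..K - 1} - F \<noteq> {}"
    using assms card_mono[of F "{1..K - 1}"] finite_subset[OF assms(1)] by auto
  then have "arg_max_on (gap h) ({1..K - 1} - F) \<in> {1..K - 1} - F"
    by (intro arg_max_on_mem) auto
  then show ?thesis by (auto simp: new_estimate_def Let_def)
qed

text \<open>\<open>card F + k = N < K\<close> keeps the candidate set nonempty. The clauses used
  later: an estimate still open was produced by \<open>new_estimate\<close> for the final set
  \<open>F'\<close> and is below the threshold, and every position added here crossed the threshold
  at this very history.\<close>

lemma close_phases_inv:
  assumes "close_phases K N \<delta> h k F x = (k', F', x')" "F \<subseteq> {1..K - 1}" "card F + k = N" "N < K"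
  shows "k' \<le> k \<and> F \<subseteq> F' \<and> F' \<subseteq> {1..K - 1} \<and> card F' + k' = N \<and>
    (0 < k \<longrightarrow> x' \<in> {1..K - 1}) \<and> (k = 0 \<longrightarrow> x' = x) \<and>
    (0 < k' \<longrightarrow> x' \<notin> F' \<and> Z_stat h x' < threshold K (length h) (\<delta> / N) \<and> (\<exists>y. x' = new_estimate K h F' y)) \<and>
    (\<forall>y\<in>F' - F. threshold K (length h) (\<delta> / N) \<le> Z_stat h y)"
  using assms
proof (induction k arbitrary: F x)
  case 0
  then show ?case by auto
next
  case (Suc k)
  define y where "y = new_estimate K h F x"
  have y: "y \<in> {1..K - 1} - F"
    unfolding y_def using Suc.prems by (intro new_estimate_mem) auto
  show ?case
  proof (cases "Z_stat h y < threshold K (length h) (\<delta> / N)")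
    case True
    then have "k' = Suc k" "F' = F" "x' = y"
      using Suc.prems(1) by (auto simp: Let_def y_def)
    then show ?thesis using Suc.prems y True by (auto simp: y_def)
  next
    case False
    then have eq: "close_phases K N \<delta> h k (insert y F) y = (k', F', x')"
      using Suc.prems(1) by (auto simp: Let_def y_def)
    have fin: "finite F" using Suc.prems by (auto intro: finite_subset)
    have "card (insert y F) + k = N" "insert y F \<subseteq> {1..K - 1}"
      using Suc.prems y fin by auto
    from Suc.IH[OF eq this(2,1) \<open>N < K\<close>] show ?thesis using y False by auto
  qed
qed

locale mcpi_policy =
  fixes K N :: nat and \<delta> :: real
  assumes N_pos: "1 \<le> N" and N_less: "N < K"
begin

abbreviation state :: "history \<Rightarrow> nat \<times> nat set \<times> nat" where
  "state \<equiv> mcpi_state K N \<delta>"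

abbreviation \<beta> :: "nat \<Rightarrow> real" where
  "\<beta> t \<equiv> threshold K t (\<delta> / real N)"

lemma state_inv:
  assumes "state h = (k, F, x)"
  shows "k \<le> N \<and> F \<subseteq> {1..K - 1} \<and> card F + k = N \<and> x \<le> K - 1 \<and>
    (K \<le> length h \<longrightarrow> x \<in> {1..K - 1}) \<and>
    (K \<le> length h \<and> 0 < k \<longrightarrow> x \<notin> F \<and> Z_stat h x < \<beta> (length h) \<and> (\<exists>y. x = new_estimate K h F y))"
  using assms
proof (induction h arbitrary: k F x)
  case Nil
  then show ?case using N_less by auto
next
  case (Cons p h)
  obtain k0 F0 x0 where eq: "state h = (k0, F0, x0)" by (cases "state h")
  note IH = Cons.IH[OF eq]
  show ?case
  proof (cases "length (p # h) < K")
    case True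
    then show ?thesis using Cons.prems N_less by auto
  next
    case False
    then have "close_phases K N \<delta> (p # h) k0 F0 x0 = (k, F, x)"
      using Cons.prems eq by simp
    from close_phases_inv[OF this _ _ N_less] IH
    have *: "k \<le> k0 \<and> F0 \<subseteq> F \<and> F \<subseteq> {1..K - 1} \<and> card F + k = N \<and>
      (0 < k0 \<longrightarrow> x \<in> {1..K - 1}) \<and> (k0 = 0 \<longrightarrow> x = x0) \<and>
      (0 < k \<longrightarrow> x \<notin> F \<and> Z_stat (p # h) x < \<beta> (length (p # h)) \<and> (\<exists>y. x = new_estimate K (p # h) F y))"
      by blast
    have "x \<in> {1..K - 1}"
    proof (cases "K \<le> length h")
      case True
      then show ?thesis using * IH by (cases "k0 = 0") auto
    next
      case F: False
      \<comment> \<open>The first round after initialisation: the preceding state is still the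
        initial one, so a phase is open and the estimate is recomputed, replacing the placeholder
        0.\<close>
      then have "k0 = N" using eq by (cases h) auto
      then show ?thesis using * N_pos by auto
    qed
    then show ?thesis using * IH by auto
  qed
qed

lemma state_Cons:
  assumes "state h = (k0, F0, x0)" "state (p # h) = (k, F, x)"
  shows "k \<le> k0 \<and> F0 \<subseteq> F \<and> (\<forall>y\<in>F - F0. \<beta> (length (p # h)) \<le> Z_stat (p # h) y)"
proof (cases "length (p # h) < K")
  case True
  then have "k0 = N" "F0 = {}" "k = N" "F = {}" using assms by (cases h; auto)+
  then show ?thesis by simp
next
  case False
  then have "close_phases K N \<delta> (p # h) k0 F0 x0 = (k, F, x)"
    using assms by simp
  from close_phases_inv[OF this _ _ N_less] state_inv[OF assms(1)] show ?thesis by blast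
qed

end

section \<open>Measurability of the sampling, stopping and recommendation rules\<close>

lemma measurable_count_space_shrink:
  assumes "f \<in> M \<rightarrow>\<^sub>M count_space UNIV" "\<And>x. x \<in> space M \<Longrightarrow> f x \<in> A"
  shows "f \<in> M \<rightarrow>\<^sub>M count_space A"
  using assms by (auto simp: measurable_def)

text \<open>The chosen element is a function of the random set of admissible elements, which takes
  finitely many values. So any fixed rule for breaking ties is measurable.\<close>

lemma measurable_some_mem:
  assumes "finite S" "\<And>a. a \<in> S \<Longrightarrow> Measurable.pred M (P a)"
  shows "(\<lambda>x. SOME a. a \<in> S \<and> P a x) \<in> M \<rightarrow>\<^sub>M count_space UNIV"
proof -
  have "(\<lambda>x. {a \<in> S. P a x}) \<in> M \<rightarrow>\<^sub>M count_space (Pow S)"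
  proof (subst measurable_count_space_eq2)
    show "finite (Pow S)" using assms by simp
    have "{x \<in> space M. {a \<in> S. P a x} = A} \<in> sets M" if "A \<in> Pow S" for A
    proof -
      have "{a \<in> S. P a x} = A \<longleftrightarrow> (\<forall>a\<in>S. P a x \<longleftrightarrow> a \<in> A)" for x
        using that by auto
      moreover have "Measurable.pred M (\<lambda>x. \<forall>a\<in>S. P a x \<longleftrightarrow> a \<in> A)"
        using assms by (intro pred_intros_finite pred_intros_logic) auto
      ultimately show ?thesis by (simp add: pred_def)
    qed
    moreover have "(\<lambda>x. {a \<in> S. P a x}) -` {A} \<inter> space M = {x \<in> space M. {a \<in> S. P a x} = A}" for A
      by auto
    ultimately show "(\<lambda>x. {a \<in> S. P a x}) \<in> space M \<rightarrow> Pow S \<and>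
        (\<forall>A\<in>Pow S. (\<lambda>x. {a \<in> S. P a x}) -` {A} \<inter> space M \<in> sets M)"
      by auto
  qed
  from measurable_compose[OF this measurable_count_space, of "\<lambda>A. SOME a. a \<in> A"]
  show ?thesis by simp
qed

lemma measurable_arg_max_on:
  fixes f :: "'a \<Rightarrow> 'b \<Rightarrow> real"
  assumes "finite S" and [measurable]: "\<And>a. (\<lambda>x. f x a) \<in> borel_measurable M"
  shows "(\<lambda>x. arg_max_on (f x) S) \<in> M \<rightarrow>\<^sub>M count_space UNIV"
  unfolding arg_max_on_def arg_max_def is_arg_max_def
proof (rule measurable_some_mem[OF assms(1)])
  fix a
  have "(\<lambda>x. \<not> (\<exists>y. y \<in> S \<and> f x a < f x y)) = (\<lambda>x. \<not> (\<exists>y\<in>S. f x a < f x y))" by auto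
  also have "Measurable.pred M \<dots>"
    using assms(1) by (intro pred_intros_logic pred_intros_finite) auto
  finally show "Measurable.pred M (\<lambda>x. \<not> (\<exists>y. y \<in> S \<and> f x a < f x y))" .
qed

lemma measurable_arg_min_on:
  fixes f :: "'a \<Rightarrow> 'b \<Rightarrow> nat"
  assumes "finite S" and f: "\<And>a. (\<lambda>x. f x a) \<in> M \<rightarrow>\<^sub>M count_space UNIV"
  shows "(\<lambda>x. arg_min_on (f x) S) \<in> M \<rightarrow>\<^sub>M count_space UNIV"
  unfolding arg_min_on_def arg_min_def is_arg_min_def
proof (rule measurable_some_mem[OF assms(1)])
  fix a
  have [measurable]: "(\<lambda>x. real (f x b)) \<in> borel_measurable M" for b
    by (rule measurable_compose[OF f]) simp
  have "(\<lambda>x. \<not> (\<exists>y. y \<in> S \<and> f x y < f x a)) = (\<lambda>x. \<not> (\<exists>y\<in>S. real (f x y) < real (f x a)))" by auto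
  also have "Measurable.pred M \<dots>"
    by (intro pred_intros_logic pred_intros_finite assms(1) borel_measurable_pred_less) measurable
  finally show "Measurable.pred M (\<lambda>x. \<not> (\<exists>y. y \<in> S \<and> f x y < f x a))" .
qed

lemma arg_min_on_mem:
  fixes f :: "nat \<Rightarrow> nat"
  assumes "finite S" "S \<noteq> {}"
  shows "arg_min_on f S \<in> S" "\<And>a. a \<in> S \<Longrightarrow> f (arg_min_on f S) \<le> f a"
  using arg_min_if_finite[OF assms, of f] by (auto simp: not_less)

context
  fixes K t :: nat
begin

lemma measurable_round:
  assumes "s < t"
  shows "(\<lambda>x. fst (x s)) \<in> history_space K t \<rightarrow>\<^sub>M count_space UNIV"
    and "(\<lambda>x. snd (x s)) \<in> borel_measurable (history_space K t)"
proof -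
  have "(\<lambda>x. x s) \<in> history_space K t \<rightarrow>\<^sub>M count_space {1..K} \<Otimes>\<^sub>M borel"
    unfolding history_space_def using assms by (intro measurable_component_singleton) auto
  from measurable_compose[OF this measurable_fst] measurable_compose[OF this measurable_snd]
  show "(\<lambda>x. fst (x s)) \<in> history_space K t \<rightarrow>\<^sub>M count_space UNIV"
    and "(\<lambda>x. snd (x s)) \<in> borel_measurable (history_space K t)"
    by (auto intro: measurable_compose[OF _ measurable_count_space])
qed

text \<open>General lists \<open>ts\<close> of rounds, since the recursions over histories pass to
  suffixes of \<open>[0..<t]\<close> while the underlying space stays fixed.\<close>

lemma measurable_plays_map:
  assumes "set ts \<subseteq> {..<t}"
  shows "(\<lambda>x. plays (map x ts) i) \<in> history_space K t \<rightarrow>\<^sub>M count_space UNIV"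
  using assms
proof (induction ts)
  case (Cons s ts)
  note [measurable] = measurable_round[of s] Cons.IH
  from Cons have [simp]: "s < t" "set ts \<subseteq> {..<t}" by auto
  show ?case unfolding list.map plays_Cons by measurable
qed simp

lemma measurable_emp_mean_map:
  assumes "set ts \<subseteq> {..<t}"
  shows "(\<lambda>x. emp_mean (map x ts) i) \<in> borel_measurable (history_space K t)"
proof -
  have "(\<lambda>x. \<Sum>p\<leftarrow>filter (\<lambda>p. fst p = i) (map x ts). snd p) \<in> borel_measurable (history_space K t)"
    using assms
  proof (induction ts)
    case (Cons s ts)
    from Cons have [simp]: "s < t" "set ts \<subseteq> {..<t}" by auto
    have "(\<Sum>p\<leftarrow>filter (\<lambda>p. fst p = i) (map x (s # ts)). snd p) =
        (if fst (x s) = i then snd (x s) else 0) + (\<Sum>p\<leftarrow>filter (\<lambda>p. fst p = i) (map x ts). snd p)"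
      for x :: "nat \<Rightarrow> nat \<times> real" by simp
    moreover note [measurable] = measurable_round[of s] Cons.IH
    ultimately show ?case by (simp del: filter.simps list.map)
  qed simp
  moreover note [measurable] = measurable_plays_map[OF assms]
  ultimately show ?thesis unfolding emp_mean_def by measurable
qed

lemma measurable_new_estimate_map:
  assumes "set ts \<subseteq> {..<t}"
  shows "(\<lambda>x. new_estimate K (map x ts) F y) \<in> history_space K t \<rightarrow>\<^sub>M count_space UNIV"
proof -
  note [measurable] = measurable_emp_mean_map[OF assms]
  have [measurable]: "(\<lambda>x. gap (map x ts) i) \<in> borel_measurable (history_space K t)" for i
    unfolding gap_def by measurable
  have [measurable]: "(\<lambda>x. arg_max_on (gap (map x ts)) ({1..K - 1} - F)) \<in>
      history_space K t \<rightarrow>\<^sub>M count_space UNIV"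
    by (intro measurable_arg_max_on) auto
  have [measurable]: "Measurable.pred (history_space K t) (\<lambda>x. \<exists>i\<in>{1..K - 1}. \<exists>j\<in>{1..K - 1}.
      ereal (gap (map x ts) j) + radius K (length ts) < ereal (gap (map x ts) i))"
    by (intro pred_intros_finite) auto
  show ?thesis unfolding new_estimate_def Let_def length_map
    by (cases "y \<in> {1..K - 1} - F") (simp_all del: One_nat_def)
qed

lemma measurable_close_phases_map:
  assumes "set ts \<subseteq> {..<t}" "F \<subseteq> {1..K - 1}" "card F + k = N" "N < K"
  shows "(\<lambda>x. close_phases K N \<delta> (map x ts) k F y) \<in> history_space K t \<rightarrow>\<^sub>M count_space UNIV"
  using assms(2,3)
proof (induction k arbitrary: F y)
  case (Suc k)
  let ?y = "\<lambda>x. new_estimate K (map x ts) F y"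
  note [measurable] = measurable_plays_map[OF assms(1)] measurable_emp_mean_map[OF assms(1)]
  have fin: "finite F" using Suc.prems by (auto intro: finite_subset)
  have y: "?y \<in> history_space K t \<rightarrow>\<^sub>M count_space ({1..K - 1} - F)"
    using Suc.prems \<open>N < K\<close>
    by (intro measurable_count_space_shrink[OF measurable_new_estimate_map[OF assms(1)]] new_estimate_mem) auto
  \<comment> \<open>The recursive call receives a random position. It has finitely many values, so
    it suffices to treat each of them as a constant, for which the induction hypothesis
    applies.\<close>
  have "(\<lambda>x. (\<lambda>y x. if Z_stat (map x ts) y < threshold K (length (map x ts)) (\<delta> / real N) then (Suc k, F, y)
      else close_phases K N \<delta> (map x ts) k (insert y F) y) (?y x) x) \<in> history_space K t \<rightarrow>\<^sub>M count_space UNIV"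
  proof (rule measurable_compose_countable'[OF _ y])
    fix y assume y: "y \<in> {1..K - 1} - F"
    have [measurable]: "(\<lambda>x. close_phases K N \<delta> (map x ts) k (insert y F) y) \<in> history_space K t \<rightarrow>\<^sub>M count_space UNIV"
      using y Suc.prems fin by (intro Suc.IH) auto
    show "(\<lambda>x. if Z_stat (map x ts) y < threshold K (length (map x ts)) (\<delta> / real N) then (Suc k, F, y)
      else close_phases K N \<delta> (map x ts) k (insert y F) y) \<in> history_space K t \<rightarrow>\<^sub>M count_space UNIV"
      unfolding Z_stat_def gap_def length_map by measurable
  qed auto
  then show ?case by (simp add: Let_def)
qed simp

end

context mcpi_policy
begin

definition states :: "(nat \<times> nat set \<times> nat) set" where
  "states = {(k, F, x). k \<le> N \<and> F \<subseteq> {1..K - 1} \<and> card F + k = N \<and> x \<le> K - 1}"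

lemma state_mem: "state h \<in> states"
  using state_inv[of h] by (cases "state h") (auto simp: states_def)

lemma countable_states: "countable states"
proof (rule countable_finite, rule finite_subset)
  show "states \<subseteq> {..N} \<times> Pow {1..K - 1} \<times> {..K - 1}" by (auto simp: states_def)
qed auto

lemma measurable_state_map:
  assumes "set ts \<subseteq> {..<t}"
  shows "(\<lambda>x. state (map x ts)) \<in> history_space K t \<rightarrow>\<^sub>M count_space states"
  using assms
proof (induction ts)
  case Nil
  then show ?case using state_mem[of "[]"] by simp
next
  case (Cons s ts)
  show ?case
  proof (cases "length (s # ts) < K")
    case True
    then show ?thesis using state_mem[of "map x (s # ts)" for x] by (auto intro!: measurable_const)
  next
    case False
    have "(\<lambda>x. (\<lambda>(k, F, y) x. close_phases K N \<delta> (map x (s # ts)) k F y) (state (map x ts)) x) \<in>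
        history_space K t \<rightarrow>\<^sub>M count_space UNIV"
    proof (rule measurable_compose_countable'[OF _ Cons.IH countable_states])
      show "set ts \<subseteq> {..<t}" using Cons.prems by auto
      show "(\<lambda>x. (\<lambda>(k, F, y) x. close_phases K N \<delta> (map x (s # ts)) k F y) q x) \<in>
          history_space K t \<rightarrow>\<^sub>M count_space UNIV" if "q \<in> states" for q
      proof -
        obtain k F y where [simp]: "q = (k, F, y)" by (cases q)
        show ?thesis
          unfolding \<open>q = _\<close> prod.case using that Cons.prems N_less
          by (intro measurable_close_phases_map) (auto simp: states_def)
      qed
    qed
    moreover have "state (map x (s # ts)) = (\<lambda>(k, F, y) x. close_phases K N \<delta> (map x (s # ts)) k F y) (state (map x ts)) x" for x
      using False by (auto split: prod.split)
    ultimately have "(\<lambda>x. state (map x (s # ts))) \<in> history_space K t \<rightarrow>\<^sub>M count_space UNIV"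
      by (simp only:)
    then show ?thesis using state_mem by (rule measurable_count_space_shrink)
  qed
qed

lemma sampling_mem: "mcpi_sampling K N \<delta> h \<in> {1..K}"
proof (cases "length h < K")
  case False
  obtain k F x where eq: "state h = (k, F, x)" by (cases "state h")
  have "x \<in> {1..K - 1}" using state_inv[OF eq] False by auto
  then have "{x, x + 1} \<subseteq> {1..K}" using N_less by auto
  moreover have "arg_min_on (plays h) {x, x + 1} \<in> {x, x + 1}" by (rule arg_min_on_mem) auto
  ultimately have "arg_min_on (plays h) {x, x + 1} \<in> {1..K}" by blast
  moreover have "arg_min_on (plays h) {1..K} \<in> {1..K}" using N_less by (intro arg_min_on_mem) auto
  ultimately show ?thesis using False by (simp add: mcpi_sampling_def eq)
qed (simp add: mcpi_sampling_def)

lemma is_policy_mcpi: "is_policy K (mcpi K N \<delta>)"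
  unfolding is_policy_def
proof (intro allI conjI)
  fix t
  let ?M = "history_space K t"
  let ?h = "\<lambda>x::nat \<Rightarrow> nat \<times> real. map x [0..<t]"
  have st: "(\<lambda>x. state (?h x)) \<in> ?M \<rightarrow>\<^sub>M count_space states"
    by (rule measurable_state_map) auto
  show "(\<lambda>x. stopping (mcpi K N \<delta>) (?h x)) \<in> ?M \<rightarrow>\<^sub>M count_space UNIV"
    unfolding mcpi_def policy.simps by (rule measurable_compose[OF st measurable_count_space])
  have "fst (snd (state h)) \<in> Pow {1..K - 1}" for h
    using state_inv[of h] by (cases "state h") auto
  then show "(\<lambda>x. recommendation (mcpi K N \<delta>) (?h x)) \<in> ?M \<rightarrow>\<^sub>M count_space (Pow {1..K - 1})"
    unfolding mcpi_def policy.simps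
    by (rule measurable_count_space_shrink[OF measurable_compose[OF st measurable_count_space]])
  have pl [measurable]: "(\<lambda>x. plays (?h x) i) \<in> ?M \<rightarrow>\<^sub>M count_space UNIV" for i
    by (rule measurable_plays_map) auto
  have am [measurable]: "(\<lambda>x. arg_min_on (plays (?h x)) S) \<in> ?M \<rightarrow>\<^sub>M count_space UNIV" if "finite S" for S
    by (rule measurable_arg_min_on) (use that in auto)
  have cm: "(\<lambda>x. case state (?h x) of (k, F, y) \<Rightarrow> arg_min_on (plays (?h x)) {y, y + 1}) \<in> ?M \<rightarrow>\<^sub>M count_space UNIV"
    using measurable_compose_countable'[OF _ st countable_states,
        of "\<lambda>(k, F, y) x. arg_min_on (plays (?h x)) {y, y + 1}" "count_space UNIV"]
    by (simp add: split_beta')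
  have ex: "real (MIN i\<in>{1..K}. plays (?h x) i) < sqrt (real (length (?h x))) \<longleftrightarrow>
      (\<exists>i\<in>{1..K}. real (plays (?h x) i) < sqrt (real t))" for x
  proof -
    let ?A = "plays (?h x) ` {1..K}"
    have "Min ?A \<in> ?A" using N_less by (intro Min_in) auto
    moreover have "Min ?A \<le> plays (?h x) i" if "i \<in> {1..K}" for i using that by auto
    ultimately show ?thesis
      by (smt (verit, best) diff_zero image_iff length_map length_upt of_nat_mono)
  qed
  have pm: "Measurable.pred ?M (\<lambda>x. \<exists>i\<in>{1..K}. real (plays (?h x) i) < sqrt (real t))"
    by (intro pred_intros_finite) auto
  have "(\<lambda>x. mcpi_sampling K N \<delta> (?h x)) \<in> ?M \<rightarrow>\<^sub>M count_space UNIV"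
    unfolding mcpi_sampling_def ex
    by (intro measurable_If am cm) (use pm in \<open>simp_all add: pred_def\<close>)
  then show "(\<lambda>x. sampling (mcpi K N \<delta>) (?h x)) \<in> ?M \<rightarrow>\<^sub>M count_space {1..K}"
    unfolding mcpi_def policy.simps using sampling_mem by (rule measurable_count_space_shrink)
qed

end

section \<open>Correctness\<close>

lemma stop_time_eq_enat:
  "stop_time \<pi> v \<omega> = enat n \<longleftrightarrow> stopping \<pi> (hist \<pi> v \<omega> n) \<and> (\<forall>m<n. \<not> stopping \<pi> (hist \<pi> v \<omega> m))"
proof -
  let ?A = "{enat t | t. stopping \<pi> (hist \<pi> v \<omega> t)}"
  show ?thesis
  proof
    assume eq: "stop_time \<pi> v \<omega> = enat n"
    have "?A \<noteq> {}"
    proof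
      assume "?A = {}"
      then have "Inf ?A = \<infinity>" by (subst Inf_enat_def) simp
      with eq show False by (simp add: stop_time_def)
    qed
    then have "Inf ?A \<in> ?A" unfolding Inf_enat_def by (simp only: if_False) (meson LeastI ex_in_conv)
    moreover have "\<not> stopping \<pi> (hist \<pi> v \<omega> m)" if "m < n" for m
    proof
      assume "stopping \<pi> (hist \<pi> v \<omega> m)"
      then have "Inf ?A \<le> enat m" by (intro Inf_lower) auto
      with eq that show False by (simp add: stop_time_def)
    qed
    ultimately show "stopping \<pi> (hist \<pi> v \<omega> n) \<and> (\<forall>m<n. \<not> stopping \<pi> (hist \<pi> v \<omega> m))"
      using eq by (auto simp: stop_time_def)
  next
    assume *: "stopping \<pi> (hist \<pi> v \<omega> n) \<and> (\<forall>m<n. \<not> stopping \<pi> (hist \<pi> v \<omega> m))"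
    show "stop_time \<pi> v \<omega> = enat n"
      unfolding stop_time_def
    proof (rule antisym)
      show "Inf ?A \<le> enat n" using * by (intro Inf_lower) auto
      show "enat n \<le> Inf ?A" using * by (intro Inf_greatest) (auto simp: not_less[symmetric])
    qed
  qed
qed

lemma stop_time_finite: "stop_time \<pi> v \<omega> < \<infinity> \<longleftrightarrow> (\<exists>n. stopping \<pi> (hist \<pi> v \<omega> n))"
proof
  assume "stop_time \<pi> v \<omega> < \<infinity>"
  then obtain n where "stop_time \<pi> v \<omega> = enat n" by (cases "stop_time \<pi> v \<omega>") auto
  then show "\<exists>n. stopping \<pi> (hist \<pi> v \<omega> n)" by (auto simp: stop_time_eq_enat)
next
  assume "\<exists>n. stopping \<pi> (hist \<pi> v \<omega> n)"
  then obtain n where "stopping \<pi> (hist \<pi> v \<omega> n)" by blast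
  then have "stop_time \<pi> v \<omega> \<le> enat n"
    unfolding stop_time_def by (intro Inf_lower) auto
  then show "stop_time \<pi> v \<omega> < \<infinity>" by (auto simp: less_eq_enat_def split: enat.splits)
qed

lemma stop_time_greater: "enat t < stop_time \<pi> v \<omega> \<longleftrightarrow> (\<forall>s\<le>t. \<not> stopping \<pi> (hist \<pi> v \<omega> s))"
proof (cases "stop_time \<pi> v \<omega>")
  case (enat n)
  then show ?thesis using stop_time_eq_enat[of \<pi> v \<omega> n] by (auto simp: not_le[symmetric])
next
  case infinity
  then show ?thesis using stop_time_finite[of \<pi> v \<omega>] by auto
qed

context bandit
begin

lemma measurable_stop_finite [measurable]: "Measurable.pred noise (\<lambda>\<omega>. stop_time \<pi> v \<omega> < \<infinity>)"
  unfolding stop_time_finite by measurable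

text \<open>Decomposes over the value of the random stopping time, which turns the event into a
  countable union and so gives its measurability.\<close>

lemma estimate_iff:
  "stop_time \<pi> v \<omega> < \<infinity> \<and> P (estimate \<pi> v \<omega>) \<longleftrightarrow>
    (\<exists>n. (stopping \<pi> (H \<omega> n) \<and> (\<forall>m<n. \<not> stopping \<pi> (H \<omega> m))) \<and> P (recommendation \<pi> (H \<omega> n)))"
proof (cases "stop_time \<pi> v \<omega>")
  case (enat n)
  then show ?thesis
    by (simp add: estimate_def flip: stop_time_eq_enat)
qed (simp flip: stop_time_eq_enat)

lemma measurable_estimate:
  "Measurable.pred noise (\<lambda>\<omega>. stop_time \<pi> v \<omega> < \<infinity> \<and> P (estimate \<pi> v \<omega>))"
proof -
  have [measurable]: "Measurable.pred noise (\<lambda>\<omega>. P (recommendation \<pi> (H \<omega> n)))" for n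
    by (rule measurable_compose[OF measurable_recommendation']) simp
  show ?thesis unfolding estimate_iff by measurable
qed

lemma sum_plays: "(\<Sum>i\<in>{1..K}. plays (H \<omega> t) i) = t"
proof -
  have "fst p \<in> {1..K}" if "p \<in> set (H \<omega> t)" for p
    using that by (induction t) (use sampling_range in \<open>auto simp: hist_Suc\<close>)
  then show ?thesis using plays_sum[of "{1..K}" "H \<omega> t"] by simp
qed

end

section \<open>Comparison of the threshold with the mixture boundary\<close>

lemma gamma_const_ge: "exp 15 \<le> gamma_const"
proof -
  have "exp (2::real) = exp 1 * exp 1" by (simp flip: exp_add)
  also have "\<dots> \<le> 3 * 3" by (intro mult_mono exp_le) auto
  finally have "exp (2::real) ^ 6 \<le> 9 ^ 6" by (intro power_mono) auto
  then have "exp 3 * exp 12 \<le> exp 3 * (9::real) ^ 6"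
    by (intro mult_left_mono) (simp_all flip: exp_of_nat_mult)
  then have "exp 15 \<le> exp 3 * (9::real) ^ 6" by (simp flip: exp_add)
  also have "\<dots> \<le> gamma_const"
  proof -
    have "0 < ln (3::real)" "ln (3::real) \<le> 2" using ln_le_minus_one[of "3::real"] by auto
    then show ?thesis by (simp add: gamma_const_def field_simps)
  qed
  finally show ?thesis .
qed

lemma threshold_arg:
  fixes \<delta> :: real
  assumes "1 \<le> N" "1 < K" "0 < \<delta>" "1 \<le> t"
  shows "ln (real t * gamma_const * (real K - 1) / (\<delta> / real N)) =
    ln (real t) + ln gamma_const + ln (real N) + ln ((real K - 1) / \<delta>)"
proof -
  have "0 < gamma_const" using gamma_const_ge by (meson exp_gt_zero less_le_trans)
  moreover have "real t * gamma_const * (real K - 1) / (\<delta> / real N) = real t * gamma_const * real N * ((real K - 1) / \<delta>)"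
    by simp
  ultimately show ?thesis using assms by (simp only:) (subst ln_mult; simp add: ln_mult)+
qed

text \<open>The prior variance \<open>J\<close> is of the order of the threshold, so that replacing \<open>T\<close> by
  \<open>1 / J + T\<close> costs only a constant.\<close>

lemma mixture_threshold:
  fixes y A t T1 T2 S1 S2 :: real
  defines "J \<equiv> real (nat \<lceil>y\<rceil>)"
  assumes y: "14 + ln t + A \<le> y" and A: "0 \<le> A" and t: "1 \<le> t"
    and T: "1 \<le> T1" "1 \<le> T2" "T1 + T2 \<le> t"
    and Z: "y + 8 * ln y \<le> S1\<^sup>2 / (2 * T1) + S2\<^sup>2 / (2 * T2)"
  shows "A + ln (J * (J + 1)) \<le>
    (S1\<^sup>2 / (2 * (1 / J + T1)) - ln ((1 / J + T1) / (1 / J)) / 2) +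
    (S2\<^sup>2 / (2 * (1 / J + T2)) - ln ((1 / J + T2) / (1 / J)) / 2)"
proof -
  have "0 \<le> ln t" using t by simp
  then have y14: "14 \<le> y" using y A by simp
  have J: "y \<le> J" "J < y + 1" unfolding J_def using y14 by linarith+
  then have J14: "14 \<le> J" using y14 by simp
  have lny: "0 \<le> ln y" "ln y \<le> y" using y14 ln_le_minus_one[of y] by auto
  define r where "r = 1 / J"
  have r: "0 < r" "r \<le> 1" using J14 by (auto simp: r_def)
  have damp: "(1 - r) * (S\<^sup>2 / (2 * T)) \<le> S\<^sup>2 / (2 * (r + T))" if "1 \<le> T" for S T :: real
  proof -
    have "r * 1 \<le> r * T" "0 \<le> r * r" using r that by (intro mult_left_mono) auto
    then have "(1 - r) * (r + T) \<le> T" unfolding left_diff_distrib distrib_left by linarith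
    then have "(1 - r) * (r + T) * S\<^sup>2 \<le> T * S\<^sup>2" by (rule mult_right_mono) simp
    then show ?thesis using r that by (simp add: field_simps)
  qed
  have "(1 - r) * (y + 8 * ln y) \<le> (1 - r) * (S1\<^sup>2 / (2 * T1) + S2\<^sup>2 / (2 * T2))"
    using Z r by (intro mult_left_mono) auto
  also have "\<dots> \<le> S1\<^sup>2 / (2 * (r + T1)) + S2\<^sup>2 / (2 * (r + T2))"
    using damp[OF T(1), of S1] damp[OF T(2), of S2] by (simp add: distrib_left)
  finally have X: "(1 - r) * (y + 8 * ln y) \<le> S1\<^sup>2 / (2 * (r + T1)) + S2\<^sup>2 / (2 * (r + T2))" .
  \<comment> \<open>The price of damping by \<open>1 - 1 / J\<close>: both \<open>y\<close> and
    \<open>ln y\<close> are at most \<open>J\<close>.\<close>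
  have "r * (y + 8 * ln y) \<le> 9"
  proof -
    have "y + 8 * ln y \<le> 9 * J" using lny J by simp
    then show ?thesis using J14 by (simp add: r_def field_simps)
  qed
  then have X': "y + 8 * ln y - 9 \<le> S1\<^sup>2 / (2 * (r + T1)) + S2\<^sup>2 / (2 * (r + T2))"
    using X by (simp add: algebra_simps)
  have frac: "(r + T) / r = 1 + J * T" for T using J14 by (simp add: r_def field_simps)
  have "ln (1 + J * T1) + ln (1 + J * T2) = ln ((1 + J * T1) * (1 + J * T2))"
  proof -
    have "0 < 1 + J * T1" "0 < 1 + J * T2" using J14 T by (auto intro!: add_pos_nonneg)
    then show ?thesis by (subst ln_mult) auto
  qed
  also have "\<dots> \<le> ln ((J * t)\<^sup>2)"
  proof -
    have "(1 + J * T1) * (1 + J * T2) \<le> (1 + J * (T1 + T2) / 2)\<^sup>2"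
    proof -
      have "(1 + J * (T1 + T2) / 2)\<^sup>2 - (1 + J * T1) * (1 + J * T2) = (J * T1 - J * T2)\<^sup>2 / 4"
        by (simp add: power2_eq_square field_simps)
      then show ?thesis by (smt (verit) zero_le_power2 divide_nonneg_nonneg)
    qed
    also have "\<dots> \<le> (J * t)\<^sup>2"
    proof (rule power_mono)
      have "14 * 1 \<le> J * t" using J14 t by (intro mult_mono) auto
      then have "2 \<le> J * t" by simp
      moreover have "J * (T1 + T2) \<le> J * t" using J14 T by (intro mult_left_mono) auto
      ultimately show "1 + J * (T1 + T2) / 2 \<le> J * t" by simp
      show "0 \<le> 1 + J * (T1 + T2) / 2" using J14 T by simp
    qed
    finally show ?thesis using J14 t T by (intro ln_mono) (auto intro!: mult_pos_pos add_pos_nonneg)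
  qed
  also have "\<dots> = 2 * (ln J + ln t)"
    using J14 t by (simp add: ln_realpow ln_mult)
  finally have L: "ln (1 + J * T1) / 2 + ln (1 + J * T2) / 2 \<le> ln J + ln t" by simp
  \<comment> \<open>So each of the three logarithms, two of \<open>J\<close> and one of
    \<open>J + 1\<close>, costs at most \<open>2 * ln y\<close>; together they fit into the
    \<open>8 * ln y\<close> of the threshold.\<close>
  have "J + 1 \<le> y\<^sup>2"
  proof -
    have "y + 2 \<le> 14 * y" using y14 by simp
    also have "\<dots> \<le> y * y" using y14 by (intro mult_right_mono) auto
    finally show ?thesis using J by (simp add: power2_eq_square)
  qed
  moreover have "ln (y\<^sup>2) = 2 * ln y" using y14 by (simp add: ln_realpow)
  ultimately have "ln (J + 1) \<le> 2 * ln y"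
    using J14 ln_mono[of "J + 1" "y\<^sup>2"] by simp
  moreover have "ln J \<le> ln (J + 1)" using J14 by simp
  moreover have "ln (J * (J + 1)) = ln J + ln (J + 1)" using J14 by (simp add: ln_mult)
  ultimately have "A + ln (J * (J + 1)) + (ln J + ln t) \<le> y + 8 * ln y - 9"
    using y lny by linarith
  then show ?thesis
    using X' L unfolding r_def[symmetric] frac by linarith
qed

text \<open>For equal means the two self-normalised squares split into the contrast of the arms,
  which is \<open>Z\<close>, and the pooled term \<open>(s + t)\<^sup>2 / (2 * (m + n))\<close>,
  which is nonnegative.\<close>

lemma Z_stat_le:
  fixes v :: env
  assumes "v a = v (a + 1)" "0 < plays h a" "0 < plays h (a + 1)"
  shows "Z_stat h a \<le> (noise_sum v h a)\<^sup>2 / (2 * plays h a) + (noise_sum v h (a + 1))\<^sup>2 / (2 * plays h (a + 1))"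
proof -
  define m n where "m = real (plays h a)" and "n = real (plays h (a + 1))"
  define s t where "s = noise_sum v h a" and "t = noise_sum v h (a + 1)"
  have mn: "0 < m" "0 < n" using assms by (auto simp: m_def n_def)
  have "(gap h a)\<^sup>2 = (s / m - t / n)\<^sup>2"
    using assms emp_mean_eq[of h a v] emp_mean_eq[of h "a + 1" v]
    by (simp add: gap_def m_def n_def s_def t_def)
  then have "Z_stat h a = m * n / (2 * (m + n)) * (s / m - t / n)\<^sup>2"
    by (simp add: Z_stat_def m_def n_def)
  also have "\<dots> \<le> s\<^sup>2 / (2 * m) + t\<^sup>2 / (2 * n)"
  proof -
    have "s\<^sup>2 / (2 * m) + t\<^sup>2 / (2 * n) - m * n / (2 * (m + n)) * (s / m - t / n)\<^sup>2 = (s + t)\<^sup>2 / (2 * (m + n))"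
    proof -
      have "m + n \<noteq> 0" "m \<noteq> 0" "n \<noteq> 0" using mn by auto
      then show ?thesis by (simp add: power2_eq_square divide_simps) algebra
    qed
    moreover have "0 \<le> (s + t)\<^sup>2 / (2 * (m + n))" using mn by simp
    ultimately show ?thesis by linarith
  qed
  finally show ?thesis by (simp add: m_def n_def s_def t_def)
qed

locale mcpi_env = mcpi_policy +
  fixes v :: env
  assumes \<delta>: "0 < \<delta>" "\<delta> < 1"

sublocale mcpi_env \<subseteq> bandit K "mcpi K N \<delta>" v
  by unfold_locales (rule is_policy_mcpi)

context mcpi_env
begin

lemma stopping_iff: "stopping (mcpi K N \<delta>) h \<longleftrightarrow> fst (state h) = 0"
  by (simp add: mcpi_def)

lemma recommendation_eq: "recommendation (mcpi K N \<delta>) h = fst (snd (state h))"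
  by (simp add: mcpi_def)

lemma found_threshold:
  assumes "state (H \<omega> t) = (k, F, x)" "y \<in> F"
  shows "\<exists>s\<in>{1..t}. \<beta> s \<le> Z_stat (H \<omega> s) y"
  using assms
proof (induction t arbitrary: k F x)
  case (Suc t)
  obtain k0 F0 x0 where eq: "state (H \<omega> t) = (k0, F0, x0)" by (cases "state (H \<omega> t)")
  from Suc.prems(1) have "state ((sampling (mcpi K N \<delta>) (H \<omega> t), v (sampling (mcpi K N \<delta>) (H \<omega> t)) + \<omega> t) # H \<omega> t) = (k, F, x)"
    by (simp only: hist_Suc)
  note * = state_Cons[OF eq this, folded hist_Suc]
  show ?case
  proof (cases "y \<in> F0")
    case True
    then show ?thesis using Suc.IH[OF eq True] by auto
  next
    case False
    then show ?thesis using * Suc.prems by (intro bexI[of _ "Suc t"]) auto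
  qed
qed auto

text \<open>Share of the error probability given to the mixture of index \<open>j\<close>. The
  telescoping form has a sum of \<open>\<delta> / (2 * (K - 1))\<close>, so the union over all
  positions costs \<open>\<delta> / 2\<close> and leaves room for the strict inequality in the
  policy definitions.\<close>

definition \<alpha> :: "nat \<Rightarrow> real" where
  "\<alpha> j = \<delta> / (2 * (real K - 1)) * (1 / (real j + 1) - 1 / (real j + 2))"

lemma \<alpha>_sums: "\<alpha> sums (\<delta> / (2 * (real K - 1)))"
proof -
  have "(\<lambda>j. 1 / (real j + 1)) \<longlonglongrightarrow> 0"
    using LIMSEQ_inverse_real_of_nat by (simp add: inverse_eq_divide add_ac)
  from telescope_sums'[OF this] have "(\<lambda>j. 1 / (real j + 1) - 1 / (real j + 2)) sums 1"
    by (simp add: add_ac)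
  from sums_mult[OF this, of "\<delta> / (2 * (real K - 1))"] show ?thesis by (simp add: \<alpha>_def[abs_def])
qed

lemma \<alpha>_pos: "0 < \<alpha> j"
proof -
  have "1 / (real j + 2) < 1 / (real j + 1)" by (intro divide_strict_left_mono) auto
  then show ?thesis
    unfolding \<alpha>_def using \<delta> N_pos N_less by (intro mult_pos_pos) auto
qed

text \<open>The crossing round is not known in advance, and with it the size of the threshold. So
  the mixture is selected by that round: \<open>j + 1\<close> is the ceiling of the logarithm
  \<open>y\<close>, and a union over \<open>j\<close> covers all rounds.\<close>

lemma threshold_log_mix:
  assumes "v a = v (a + 1)" "1 \<le> t" "\<beta> t \<le> Z_stat (H \<omega> t) a" "a \<in> {1..K - 1}"
  shows "\<exists>j. ln (1 / \<alpha> j) \<le> log_mix v (1 / (real j + 1)) {a, a + 1} (H \<omega> t)"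
proof -
  let ?T = "plays (H \<omega> t)" and ?S = "noise_sum v (H \<omega> t)"
  define A where "A = ln (2 * (real K - 1) / \<delta>)"
  define y where "y = ln (real t * gamma_const * (real K - 1) / (\<delta> / real N))"
  have K: "2 \<le> K" using N_pos N_less by simp
  \<comment> \<open>Of these 15, the part 14 is what \<open>mixture_threshold\<close> requires, and
    1 covers the \<open>ln 2\<close> in \<open>A\<close>.\<close>
  have g: "15 \<le> ln gamma_const"
    using gamma_const_ge by (metis exp_gt_zero ln_exp ln_mono)
  have A: "A = ln 2 + ln ((real K - 1) / \<delta>)"
    unfolding A_def times_divide_eq_right[symmetric] using K \<delta> by (subst ln_mult) auto
  have A0: "0 \<le> A" unfolding A_def using K \<delta> by (intro ln_ge_zero) (auto simp: field_simps)
  have y: "14 + ln (real t) + A \<le> y"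
  proof -
    have "0 \<le> ln (real N)" using N_pos by simp
    moreover have "ln 2 \<le> (1::real)" using ln_le_minus_one[of "2::real"] by simp
    ultimately show ?thesis
      using threshold_arg[of N K \<delta> t, folded y_def] N_pos K \<delta> assms(2) g A by linarith
  qed
  have lnt: "0 \<le> ln (real t)" using assms by simp
  have y14: "14 \<le> y" using y A0 lnt by linarith
  have \<beta>: "\<beta> t = y + 8 * ln y" by (simp add: threshold_def y_def)
  \<comment> \<open>An unplayed arm makes \<open>Z\<close> equal to 0, so crossing a positive
    threshold shows that both arms have been played.\<close>
  have "0 < \<beta> t" unfolding \<beta> using y14 by (intro add_pos_nonneg) auto
  then have "Z_stat (H \<omega> t) a \<noteq> 0" using assms by linarith
  then have pos: "0 < ?T a" "0 < ?T (a + 1)" by (auto simp: Z_stat_def)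
  have sum: "?T a + ?T (a + 1) \<le> t"
  proof -
    have "?T a + ?T (a + 1) = (\<Sum>i\<in>{a, a + 1}. ?T i)" by simp
    also have "\<dots> \<le> (\<Sum>i\<in>{1..K}. ?T i)" using assms by (intro sum_mono2) auto
    finally show ?thesis by (simp only: sum_plays)
  qed
  define j where "j = nat \<lceil>y\<rceil> - 1"
  have j: "real (nat \<lceil>y\<rceil>) = real j + 1" using y14 unfolding j_def by linarith
  have "A + ln ((real j + 1) * (real j + 1 + 1)) \<le>
    ((?S a)\<^sup>2 / (2 * (1 / (real j + 1) + real (?T a))) - ln ((1 / (real j + 1) + real (?T a)) / (1 / (real j + 1))) / 2) +
    ((?S (a + 1))\<^sup>2 / (2 * (1 / (real j + 1) + real (?T (a + 1)))) - ln ((1 / (real j + 1) + real (?T (a + 1))) / (1 / (real j + 1))) / 2)"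
    unfolding j[symmetric]
  proof (rule mixture_threshold[OF y A0])
    show "y + 8 * ln y \<le> (?S a)\<^sup>2 / (2 * real (?T a)) + (?S (a + 1))\<^sup>2 / (2 * real (?T (a + 1)))"
      using Z_stat_le[OF assms(1) pos] assms(3) \<beta> by linarith
  qed (use pos sum assms in auto)
  moreover have "ln (1 / \<alpha> j) = A + ln ((real j + 1) * (real j + 1 + 1))"
  proof -
    have "1 / \<alpha> j = 2 * (real K - 1) / \<delta> * ((real j + 1) * (real j + 1 + 1))"
      using K \<delta> by (simp add: \<alpha>_def divide_simps)
    then show ?thesis unfolding A_def using K \<delta> by (simp only:) (subst ln_mult, auto)
  qed
  ultimately have "ln (1 / \<alpha> j) \<le> log_mix v (1 / (real j + 1)) {a, a + 1} (H \<omega> t)"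
    by (simp add: log_mix_def)
  then show ?thesis ..
qed

definition wrong :: "(nat \<Rightarrow> real) set" where
  "wrong = (\<Union>a\<in>{1..K - 1} - change_points K v. \<Union>j. {\<omega>. \<exists>t. ln (1 / \<alpha> j) \<le> log_mix v (1 / (real j + 1)) {a, a + 1} (H \<omega> t)})"

lemma sets_log_mix: "{\<omega>. \<exists>t. c \<le> log_mix v \<rho> I (H \<omega> t)} \<in> sets noise"
  by (rule sets_noiseI) measurable

lemma sets_wrong: "wrong \<in> sets noise"
  unfolding wrong_def by (intro sets.finite_UN sets.countable_UN) (auto intro!: sets_log_mix)

lemma prob_wrong: "measure noise wrong \<le> \<delta> / 2"
proof -
  let ?E = "\<lambda>a j. {\<omega>. \<exists>t. ln (1 / \<alpha> j) \<le> log_mix v (1 / (real j + 1)) {a, a + 1} (H \<omega> t)}"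
  have one: "measure noise (\<Union>j. ?E a j) \<le> \<delta> / (2 * (real K - 1))" for a
  proof -
    have le: "measure noise (?E a j) \<le> \<alpha> j" for j
      by (rule prob_log_mix) (auto simp: \<alpha>_pos)
    have sm: "summable (\<lambda>j. measure noise (?E a j))"
      using le by (intro summable_comparison_test[OF _ sums_summable[OF \<alpha>_sums]]) auto
    have "measure noise (\<Union>j. ?E a j) \<le> (\<Sum>j. measure noise (?E a j))"
      using sm by (intro noise.finite_measure_subadditive_countably) (auto intro!: sets_log_mix)
    also have "\<dots> \<le> suminf \<alpha>"
      using le sm sums_summable[OF \<alpha>_sums] by (intro suminf_le) auto
    also have "\<dots> = \<delta> / (2 * (real K - 1))" using sums_unique[OF \<alpha>_sums] by simp
    finally show ?thesis .
  qed
  let ?A = "{1..K - 1} - change_points K v"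
  have "measure noise wrong \<le> (\<Sum>a\<in>?A. measure noise (\<Union>j. ?E a j))"
    unfolding wrong_def
    by (intro noise.finite_measure_subadditive_finite) (auto intro!: sets.countable_UN sets_log_mix)
  also have "\<dots> \<le> (\<Sum>a\<in>?A. \<delta> / (2 * (real K - 1)))" by (intro sum_mono one)
  also have "\<dots> \<le> (\<Sum>a\<in>{1..K - 1}. \<delta> / (2 * (real K - 1)))"
    using \<delta> N_pos N_less by (intro sum_mono2) auto
  also have "\<dots> = \<delta> / 2"
  proof -
    have "real (K - 1) = real K - 1" "real K - 1 \<noteq> 0" using N_pos N_less by auto
    then show ?thesis by (simp add: field_simps)
  qed
  finally show ?thesis .
qed

lemma found_subset:
  assumes "\<omega> \<notin> wrong" "state (H \<omega> t) = (k, F, x)"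
  shows "F \<subseteq> change_points K v"
proof
  fix a assume a: "a \<in> F"
  from found_threshold[OF assms(2) a] obtain s where s: "1 \<le> s" "\<beta> s \<le> Z_stat (H \<omega> s) a" by auto
  have aK: "a \<in> {1..K - 1}" using state_inv[OF assms(2)] a by auto
  show "a \<in> change_points K v"
  proof (rule ccontr)
    assume n: "a \<notin> change_points K v"
    then have "v a = v (a + 1)" using aK by (auto simp: change_points_def)
    from threshold_log_mix[OF this s aK] n aK assms(1) show False by (auto simp: wrong_def)
  qed
qed

lemma card_estimate:
  assumes "stop_time (mcpi K N \<delta>) v \<omega> < \<infinity>"
  shows "card (estimate (mcpi K N \<delta>) v \<omega>) = N" "estimate (mcpi K N \<delta>) v \<omega> \<subseteq> {1..K - 1}"
proof -
  obtain n where n: "stop_time (mcpi K N \<delta>) v \<omega> = enat n"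
    using assms by (cases "stop_time (mcpi K N \<delta>) v \<omega>") auto
  then have "stopping (mcpi K N \<delta>) (H \<omega> n)" by (simp add: stop_time_eq_enat)
  moreover obtain k F x where eq: "state (H \<omega> n) = (k, F, x)" by (cases "state (H \<omega> n)")
  ultimately have "k = 0" by (simp add: stopping_iff)
  then show "card (estimate (mcpi K N \<delta>) v \<omega>) = N" "estimate (mcpi K N \<delta>) v \<omega> \<subseteq> {1..K - 1}"
    using state_inv[OF eq] n by (auto simp: estimate_def recommendation_eq eq)
qed

lemma prob_correct:
  assumes "measure noise {\<omega>. stop_time (mcpi K N \<delta>) v \<omega> < \<infinity>} = 1"
  shows "1 - \<delta> < measure noise {\<omega>. stop_time (mcpi K N \<delta>) v \<omega> < \<infinity> \<and> estimate (mcpi K N \<delta>) v \<omega> \<subseteq> change_points K v}"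
    (is "_ < measure noise ?good")
proof -
  have good: "?good \<in> sets noise" by (rule sets_noiseI[OF measurable_estimate])
  have fin: "{\<omega>. stop_time (mcpi K N \<delta>) v \<omega> < \<infinity>} \<in> sets noise" by (rule sets_noiseI[OF measurable_stop_finite])
  have "{\<omega>. stop_time (mcpi K N \<delta>) v \<omega> < \<infinity>} \<subseteq> ?good \<union> wrong"
  proof
    fix \<omega> assume *: "\<omega> \<in> {\<omega>. stop_time (mcpi K N \<delta>) v \<omega> < \<infinity>}"
    then obtain n where n: "stop_time (mcpi K N \<delta>) v \<omega> = enat n"
      by (cases "stop_time (mcpi K N \<delta>) v \<omega>") auto
    obtain k F x where eq: "state (H \<omega> n) = (k, F, x)" by (cases "state (H \<omega> n)")
    then have "estimate (mcpi K N \<delta>) v \<omega> = F" using n by (simp add: estimate_def recommendation_eq)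
    then show "\<omega> \<in> ?good \<union> wrong" using * found_subset[OF _ eq] by auto
  qed
  then have "1 \<le> measure noise (?good \<union> wrong)"
    using good sets_wrong by (subst assms[symmetric]) (intro noise.finite_measure_mono, auto)
  also have "\<dots> \<le> measure noise ?good + measure noise wrong"
    using good sets_wrong by (intro measure_Un_le)
  finally show ?thesis using prob_wrong \<delta> by linarith
qed

end

section \<open>The course of a run\<close>

text \<open>Indexed by position, unlike \<open>magnitude\<close>, and equal to 0 where there is no
  change.\<close>

definition chg :: "env \<Rightarrow> nat \<Rightarrow> real" where
  "chg v x = \<bar>v x - v (x + 1)\<bar>"

context mcpi_env
begin

abbreviation act :: "(nat \<Rightarrow> real) \<Rightarrow> nat \<Rightarrow> nat" where
  "act \<omega> s \<equiv> sampling (mcpi K N \<delta>) (H \<omega> s)"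

abbreviation T :: "(nat \<Rightarrow> real) \<Rightarrow> nat \<Rightarrow> nat \<Rightarrow> nat" where
  "T \<omega> s \<equiv> plays (H \<omega> s)"

definition est :: "(nat \<Rightarrow> real) \<Rightarrow> nat \<Rightarrow> nat" where
  "est \<omega> s = snd (snd (state (H \<omega> s)))"

definition found :: "(nat \<Rightarrow> real) \<Rightarrow> nat \<Rightarrow> nat set" where
  "found \<omega> s = fst (snd (state (H \<omega> s)))"

definition left :: "(nat \<Rightarrow> real) \<Rightarrow> nat \<Rightarrow> nat" where
  "left \<omega> s = fst (state (H \<omega> s))"

lemma state_H: "state (H \<omega> s) = (left \<omega> s, found \<omega> s, est \<omega> s)"
  by (simp add: left_def found_def est_def)

lemma T_Suc: "T \<omega> (Suc s) a = T \<omega> s a + (if act \<omega> s = a then 1 else 0)"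
  by (simp add: hist_Suc plays_Cons)

lemma T_mono: "s \<le> s' \<Longrightarrow> T \<omega> s a \<le> T \<omega> s' a"
  by (induction s' rule: dec_induct) (auto simp: T_Suc)

lemma T_le: "T \<omega> s a \<le> s"
  by (induction s) (auto simp: T_Suc)

lemma found_mono: "s \<le> s' \<Longrightarrow> found \<omega> s \<subseteq> found \<omega> s'"
proof (induction s' rule: dec_induct)
  case (step s')
  have "state ((act \<omega> s', v (act \<omega> s') + \<omega> s') # H \<omega> s') = (left \<omega> (Suc s'), found \<omega> (Suc s'), est \<omega> (Suc s'))"
    using state_H[of \<omega> "Suc s'"] by (simp only: hist_Suc)
  from state_Cons[OF state_H this] step show ?case by auto
qed simp

lemma gap_Suc:
  assumes "act \<omega> s \<notin> {x, x + 1}"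
  shows "gap (H \<omega> (Suc s)) x = gap (H \<omega> s) x"
proof -
  have "emp_mean (H \<omega> (Suc s)) a = emp_mean (H \<omega> s) a" if "act \<omega> s \<noteq> a" for a
    using that by (simp add: hist_Suc emp_mean_def plays_Cons)
  then show ?thesis using assms by (simp add: gap_def)
qed

lemma sampling_mcpi: "sampling (mcpi K N \<delta>) h = mcpi_sampling K N \<delta> h"
  by (simp add: mcpi_def)

lemma act_cases:
  assumes "K \<le> s"
  obtains (forced) "real (T \<omega> s (act \<omega> s)) < sqrt (real s)" "\<And>a. a \<in> {1..K} \<Longrightarrow> T \<omega> s (act \<omega> s) \<le> T \<omega> s a"
  | (tracking) "act \<omega> s \<in> {est \<omega> s, est \<omega> s + 1}"
      "\<And>a. a \<in> {est \<omega> s, est \<omega> s + 1} \<Longrightarrow> T \<omega> s (act \<omega> s) \<le> T \<omega> s a"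
      "\<And>a. a \<in> {1..K} \<Longrightarrow> sqrt (real s) \<le> T \<omega> s a"
proof (cases "real (MIN i\<in>{1..K}. T \<omega> s i) < sqrt (real s)")
  case True
  have ne: "{1..K} \<noteq> {}" using N_less by auto
  have act: "act \<omega> s = arg_min_on (T \<omega> s) {1..K}"
    using True assms by (simp add: sampling_mcpi mcpi_sampling_def)
  have min: "T \<omega> s (act \<omega> s) \<le> T \<omega> s a" if "a \<in> {1..K}" for a
    unfolding act using ne that by (intro arg_min_on_mem) auto
  have "T \<omega> s (act \<omega> s) \<le> (MIN i\<in>{1..K}. T \<omega> s i)"
    using ne min by (subst Min_ge_iff) auto
  then show thesis using min True by (intro forced) auto
next
  case False
  have act: "act \<omega> s = arg_min_on (T \<omega> s) {est \<omega> s, est \<omega> s + 1}"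
    using False assms by (simp add: sampling_mcpi mcpi_sampling_def state_H)
  show thesis
  proof (rule tracking)
    show "act \<omega> s \<in> {est \<omega> s, est \<omega> s + 1}"
      unfolding act by (intro arg_min_on_mem) auto
    show "T \<omega> s (act \<omega> s) \<le> T \<omega> s a" if "a \<in> {est \<omega> s, est \<omega> s + 1}" for a
      unfolding act using that by (intro arg_min_on_mem) auto
    show "sqrt (real s) \<le> T \<omega> s a" if "a \<in> {1..K}" for a
    proof -
      have "(MIN i\<in>{1..K}. T \<omega> s i) \<le> T \<omega> s a" using that by (intro Min_le) auto
      then show ?thesis using False by simp
    qed
  qed
qed

text \<open>While some arm has at most \<open>c\<close> plays, every round after \<open>c\<^sup>2\<close> is forced and increases
  the sum on the right.\<close>

lemma forced_exploration_aux:
  "min (K * (c + 1)) (s - (c\<^sup>2 + 1 + K)) \<le> (\<Sum>a\<in>{1..K}. min (T \<omega> s a) (c + 1))"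
proof (induction s)
  case (Suc s)
  let ?P = "\<lambda>s. \<Sum>a\<in>{1..K}. min (T \<omega> s a) (c + 1)"
  have mono: "?P s \<le> ?P (Suc s)"
    by (intro sum_mono) (auto simp: T_Suc)
  show ?case
  proof (cases "c\<^sup>2 + 1 + K \<le> s \<and> (\<exists>a\<in>{1..K}. T \<omega> s a \<le> c)")
    case False
    then consider "Suc s \<le> c\<^sup>2 + 1 + K" | "\<forall>a\<in>{1..K}. c + 1 \<le> T \<omega> s a"
      by (auto simp: not_le Suc_le_eq)
    then show ?thesis
    proof cases
      case 2
      then have "?P s = (\<Sum>a\<in>{1..K}. c + 1)" by (intro sum.cong) auto
      then show ?thesis using mono by simp
    qed simp
  next
    case True
    then obtain a where a: "a \<in> {1..K}" "T \<omega> s a \<le> c" and s: "c\<^sup>2 + 1 + K \<le> s" by blast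
    have "real c < sqrt (real s)"
    proof -
      have "real (c\<^sup>2) < real s" using s by (simp only: of_nat_less_iff)
      then show ?thesis by (simp add: real_less_rsqrt)
    qed
    then have "T \<omega> s (act \<omega> s) \<le> c"
    proof -
      have "K \<le> s" using s by simp
      then show ?thesis
      proof (cases rule: act_cases[of s \<omega>])
        case forced
        then show ?thesis using a by (meson order_trans)
      next
        case tracking
        have "sqrt (real s) \<le> c" using tracking(3)[OF a(1)] a(2) by linarith
        then show ?thesis using \<open>real c < sqrt (real s)\<close> by simp
      qed
    qed
    moreover have "act \<omega> s \<in> {1..K}" by (rule sampling_range)
    ultimately have "?P s < ?P (Suc s)"
      by (intro sum_strict_mono_ex1) (auto simp: T_Suc intro!: bexI[of _ "act \<omega> s"])
    then show ?thesis using Suc by simp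
  qed
qed simp

text \<open>With a deficient arm the capped sum stays below its maximum \<open>K * (c + 1)\<close>,
  which by the auxiliary bound is reached after that many rounds beyond
  \<open>c\<^sup>2 + 1 + K\<close>.\<close>

lemma forced_exploration:
  assumes "c\<^sup>2 + 1 + K + K * (c + 1) \<le> s" "a \<in> {1..K}"
  shows "c < T \<omega> s a"
proof (rule ccontr)
  assume "\<not> c < T \<omega> s a"
  then have "(\<Sum>a\<in>{1..K}. min (T \<omega> s a) (c + 1)) < (\<Sum>a\<in>{1..K}. c + 1)"
    using assms by (intro sum_strict_mono_ex1) (auto intro!: bexI[of _ a])
  then show False using forced_exploration_aux[of c s \<omega>] assms by simp
qed

text \<open>Gives access to the round of the last play: what holds there bounds the final count up
  to the one play itself.\<close>

lemma last_play:
  assumes "s0 \<le> s" "T \<omega> s0 a < T \<omega> s a"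
  shows "\<exists>u\<in>{s0..<s}. act \<omega> u = a \<and> T \<omega> s a = T \<omega> u a + 1"
  using assms
proof (induction s rule: dec_induct)
  case (step s)
  show ?case
  proof (cases "act \<omega> s = a")
    case True
    then show ?thesis using step by (intro bexI[of _ s]) (auto simp: T_Suc)
  next
    case False
    then show ?thesis using step by (auto simp: T_Suc intro!: bexI)
  qed
qed simp

lemma threshold_mono:
  assumes "1 \<le> s" "s \<le> t"
  shows "\<beta> s \<le> \<beta> t"
proof -
  have K: "1 < K" using N_pos N_less by simp
  have g: "15 \<le> ln gamma_const"
    using gamma_const_ge by (metis exp_gt_zero ln_exp ln_mono)
  define c where "c = ln gamma_const + ln (real N) + ln ((real K - 1) / \<delta>)"
  have "0 \<le> ln (real N)" "0 \<le> ln ((real K - 1) / \<delta>)"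
    using N_pos K \<delta> by (auto intro!: ln_ge_zero simp: field_simps)
  then have c: "15 \<le> c" using g unfolding c_def by linarith
  have eq: "\<beta> u = (ln (real u) + c) + 8 * ln (ln (real u) + c)" if "1 \<le> u" for u
    unfolding threshold_def using threshold_arg[OF N_pos K \<delta>(1) that] by (simp add: c_def add_ac)
  have "0 \<le> ln (real s)" "ln (real s) \<le> ln (real t)" using assms by auto
  then have "ln (real s) + c \<le> ln (real t) + c" "ln (ln (real s) + c) \<le> ln (ln (real t) + c)"
    using c by (auto intro!: ln_mono)
  moreover have "1 \<le> t" using assms by simp
  ultimately show ?thesis unfolding eq[OF assms(1)] eq[OF \<open>1 \<le> t\<close>] by linarith
qed

end

text \<open>Here \<open>D\<close> plays the role of the \<open>N\<close>-th largest magnitude and \<open>d\<close> of a lower bound on the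
  distance from \<open>D\<close> to the other magnitudes (and to \<open>0\<close>).\<close>

locale good_run = mcpi_env +
  fixes \<omega> :: "nat \<Rightarrow> real" and t0 t b :: nat and \<eta> D d :: real
  assumes t0: "K \<le> t0" "t0 \<le> b" "sqrt (real t) \<le> real b" "t0 \<le> t"
    and running: "\<And>s. s \<le> t \<Longrightarrow> left \<omega> s \<noteq> 0"
    and accurate: "\<And>s a. s \<in> {t0..t} \<Longrightarrow> a \<in> {1..K} \<Longrightarrow> \<bar>emp_mean (H \<omega> s) a - v a\<bar> \<le> \<eta>"
    and d: "4 * \<eta> < d" "d \<le> D"
    and card_top: "N \<le> card {x \<in> {1..K - 1}. D \<le> chg v x}"
    and gap_below: "\<And>x. x \<in> {1..K - 1} \<Longrightarrow> chg v x < D \<Longrightarrow> chg v x \<le> D - d"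
    and gap_above: "\<And>x. x \<in> {1..K - 1} \<Longrightarrow> D < chg v x \<Longrightarrow> D + d \<le> chg v x"
    and separated: "\<And>x. x \<in> change_points K v \<Longrightarrow> x + 1 \<notin> change_points K v"
    and small_radius: "\<And>s. s \<in> {t0..t} \<Longrightarrow> radius K s < ereal (D - 4 * \<eta>)"
begin

definition top :: "nat set" where
  "top = {x \<in> {1..K - 1}. D \<le> chg v x}"

definition strict_top :: "nat set" where
  "strict_top = {x \<in> {1..K - 1}. D < chg v x}"

lemma D_pos: "0 \<le> \<eta>" "0 < d" "0 < D" "0 < D - 4 * \<eta>"
proof -
  have "1 \<in> {1..K}" using N_less by auto
  then show "0 \<le> \<eta>" using accurate[of t0 1] t0 by (auto intro: order_trans[OF abs_ge_zero])
  then show "0 < d" using d by linarith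
  then show "0 < D" using d by linarith
  show "0 < D - 4 * \<eta>" using d by linarith
qed

lemma top_change: "top \<subseteq> change_points K v"
  using D_pos by (auto simp: top_def change_points_def chg_def)

lemma gap_accurate:
  assumes "s \<in> {t0..t}" "x \<in> {1..K - 1}"
  shows "\<bar>gap (H \<omega> s) x - chg v x\<bar> \<le> 2 * \<eta>"
proof -
  have "\<bar>emp_mean (H \<omega> s) x - v x\<bar> \<le> \<eta>" "\<bar>emp_mean (H \<omega> s) (x + 1) - v (x + 1)\<bar> \<le> \<eta>"
    using assms by (auto intro!: accurate)
  then show ?thesis unfolding gap_def chg_def by linarith
qed

text \<open>The radius test succeeds at every round from \<open>t0\<close> on: a position of
  magnitude at least \<open>D\<close> and one without a change have empirical gaps at least
  \<open>D - 4 * \<eta>\<close> apart, which exceeds the radius. So the estimate is freshly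
  maximised over the candidates.\<close>

lemma est_props:
  assumes "s \<in> {t0..t}"
  shows est_mem: "est \<omega> s \<in> {1..K - 1} - found \<omega> s"
    and est_max: "\<And>y. y \<in> {1..K - 1} - found \<omega> s \<Longrightarrow> gap (H \<omega> s) y \<le> gap (H \<omega> s) (est \<omega> s)"
    and est_Z: "Z_stat (H \<omega> s) (est \<omega> s) < \<beta> s"
    and card_found: "card (found \<omega> s) < N" "found \<omega> s \<subseteq> {1..K - 1}"
proof -
  have k: "0 < left \<omega> s" using running[of s] assms by auto
  have len: "K \<le> length (H \<omega> s)" using assms t0 by simp
  note inv = state_inv[OF state_H, of \<omega> s]
  from inv k len obtain y0 where y0: "est \<omega> s = new_estimate K (H \<omega> s) (found \<omega> s) y0" by auto
  show mem: "est \<omega> s \<in> {1..K - 1} - found \<omega> s" and "Z_stat (H \<omega> s) (est \<omega> s) < \<beta> s"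
    and "card (found \<omega> s) < N" "found \<omega> s \<subseteq> {1..K - 1}"
    using inv k len by auto
  show "gap (H \<omega> s) y \<le> gap (H \<omega> s) (est \<omega> s)" if y: "y \<in> {1..K - 1} - found \<omega> s" for y
  \<comment> \<open>With two arms there is a single position and nothing to compare. Otherwise
    positions 1 and 2 exist, and by separation one of them carries no change.\<close>
  proof (cases "K = 2")
    case True
    then show ?thesis using y mem by auto
  next
    case False
    obtain i where i: "i \<in> {1..K - 1}" "D \<le> chg v i"
    proof -
      have "{x \<in> {1..K - 1}. D \<le> chg v x} \<noteq> {}" using card_top N_pos by (metis card.empty not_one_le_zero order_trans)
      then show ?thesis using that by auto
    qed
    have "\<exists>j\<in>{1..K - 1}. chg v j = 0"
    proof -
      have "{1, 2} \<subseteq> {1..K - 1}" using False N_pos N_less by auto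
      then have "1 \<notin> change_points K v \<or> 2 \<notin> change_points K v"
        using separated[of 1] by (auto simp: numeral_2_eq_2)
      then obtain j where "j \<in> {1..K - 1}" "j \<notin> change_points K v"
        using \<open>{1, 2} \<subseteq> {1..K - 1}\<close> by blast
      then show ?thesis by (intro bexI[of _ j]) (auto simp: change_points_def chg_def)
    qed
    then obtain j where j: "j \<in> {1..K - 1}" "chg v j = 0" by blast
    have "gap (H \<omega> s) j + (D - 4 * \<eta>) \<le> gap (H \<omega> s) i"
      using gap_accurate[OF assms i(1)] gap_accurate[OF assms j(1)] i(2) j(2) by linarith
    then have le: "ereal (gap (H \<omega> s) j) + ereal (D - 4 * \<eta>) \<le> ereal (gap (H \<omega> s) i)" by simp
    have "ereal (gap (H \<omega> s) j) + radius K s < ereal (gap (H \<omega> s) j) + ereal (D - 4 * \<eta>)"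
      using small_radius[OF assms] by (cases "radius K s") auto
    from less_le_trans[OF this le]
    have "ereal (gap (H \<omega> s) j) + radius K (length (H \<omega> s)) < ereal (gap (H \<omega> s) i)"
      by (simp only: length_hist)
    then have "est \<omega> s = arg_max_on (gap (H \<omega> s)) ({1..K - 1} - found \<omega> s)"
      unfolding y0 new_estimate_def Let_def using i(1) j(1) by (metis (no_types, lifting))
    then show ?thesis using y by (simp only:) (intro arg_max_on_mem, auto)
  qed
qed

lemma threshold_nonneg: "0 \<le> \<beta> t"
proof -
  have "0 \<le> Z_stat (H \<omega> t) (est \<omega> t)" by (auto simp: Z_stat_def)
  then show ?thesis using est_Z[of t] t0 by (auto intro: order_trans[OF _ less_imp_le])
qed

text \<open>Fewer than \<open>N\<close> positions are found, so one of at least \<open>N\<close>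
  large changes is still a candidate. Its gap is matched by the maximiser up to
  \<open>4 * \<eta> < d\<close>, which excludes every magnitude below \<open>D\<close>.\<close>

lemma est_top:
  assumes "s \<in> {t0..t}"
  shows "est \<omega> s \<in> top"
proof -
  have "\<not> top \<subseteq> found \<omega> s"
  proof
    assume "top \<subseteq> found \<omega> s"
    then have "card top \<le> card (found \<omega> s)"
      using card_found(2)[OF assms] by (intro card_mono) (auto intro: finite_subset)
    then show False using card_found(1)[OF assms] card_top by (simp add: top_def)
  qed
  then obtain z where z: "z \<in> top" "z \<notin> found \<omega> s" by blast
  let ?x = "est \<omega> s"
  have x: "?x \<in> {1..K - 1}" using est_mem[OF assms] by simp
  have zK: "z \<in> {1..K - 1}" "D \<le> chg v z" using z by (auto simp: top_def)
  have "gap (H \<omega> s) z \<le> gap (H \<omega> s) ?x" using z zK by (intro est_max assms) auto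
  then have "D - 4 * \<eta> \<le> chg v ?x"
    using gap_accurate[OF assms zK(1)] gap_accurate[OF assms x] zK(2) by linarith
  then have "D \<le> chg v ?x" using gap_below[OF x] d by linarith
  then show ?thesis using x by (simp add: top_def)
qed

text \<open>A candidate strictly above \<open>D\<close> would exceed a tied one by at least
  \<open>d > 4 * \<eta>\<close> and be preferred to it.\<close>

lemma strict_top_found:
  assumes "s \<in> {t0..t}" "chg v (est \<omega> s) = D"
  shows "strict_top \<subseteq> found \<omega> s"
proof (rule ccontr)
  assume "\<not> strict_top \<subseteq> found \<omega> s"
  then obtain z where z: "z \<in> strict_top" "z \<notin> found \<omega> s" by blast
  let ?x = "est \<omega> s"
  have x: "?x \<in> {1..K - 1}" using est_mem[OF assms(1)] by simp
  have zK: "z \<in> {1..K - 1}" "D + d \<le> chg v z" using z gap_above by (auto simp: strict_top_def)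
  have "gap (H \<omega> s) z \<le> gap (H \<omega> s) ?x" using z zK by (intro est_max assms) auto
  then show False
    using gap_accurate[OF assms(1) zK(1)] gap_accurate[OF assms(1) x] zK(2) assms(2) d by linarith
qed

lemma top_disjoint:
  assumes "x \<in> top" "y \<in> top" "a \<in> {x, x + 1}" "a \<in> {y, y + 1}"
  shows "x = y"
  using assms top_change separated[of x] separated[of y] by auto

text \<open>Forced exploration only plays arms with fewer than \<open>sqrt t \<le> b\<close>
  plays.\<close>

lemma tracked:
  assumes "u \<in> {t0..<t}" "b \<le> T \<omega> u (act \<omega> u)"
  shows "act \<omega> u \<in> {est \<omega> u, est \<omega> u + 1}"
    "\<And>a. a \<in> {est \<omega> u, est \<omega> u + 1} \<Longrightarrow> T \<omega> u (act \<omega> u) \<le> T \<omega> u a"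
proof -
  have "K \<le> u" using assms t0 by auto
  then have "act \<omega> u \<in> {est \<omega> u, est \<omega> u + 1} \<and> (\<forall>a\<in>{est \<omega> u, est \<omega> u + 1}. T \<omega> u (act \<omega> u) \<le> T \<omega> u a)"
  proof (cases rule: act_cases[of u \<omega>])
    case forced
    have "real (T \<omega> u (act \<omega> u)) < sqrt (real t)"
      using forced(1) assms by (smt (verit) atLeastLessThan_iff of_nat_less_iff real_sqrt_less_iff)
    then show ?thesis using t0(3) assms(2) by linarith
  qed auto
  then show "act \<omega> u \<in> {est \<omega> u, est \<omega> u + 1}"
    "\<And>a. a \<in> {est \<omega> u, est \<omega> u + 1} \<Longrightarrow> T \<omega> u (act \<omega> u) \<le> T \<omega> u a" by auto
qed

text \<open>At round \<open>t0\<close> the arm has at most \<open>t0 \<le> b\<close> plays, so its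
  last play comes later, and by then it is no longer forced.\<close>

lemma many_plays:
  assumes "s \<le> t" "b < T \<omega> s a"
  obtains u where "u \<in> {t0..<s}" "act \<omega> u = a" "T \<omega> s a = T \<omega> u a + 1" "est \<omega> u \<in> top"
    "a \<in> {est \<omega> u, est \<omega> u + 1}" "T \<omega> u a \<le> T \<omega> u (est \<omega> u)" "T \<omega> u a \<le> T \<omega> u (est \<omega> u + 1)"
proof -
  have "t0 < s" using T_le[of \<omega> s a] assms t0 by linarith
  moreover have "T \<omega> t0 a < T \<omega> s a" using T_le[of \<omega> t0 a] assms t0 by linarith
  ultimately obtain u where u: "u \<in> {t0..<s}" "act \<omega> u = a" "T \<omega> s a = T \<omega> u a + 1"
    using last_play[of t0 s \<omega> a] by auto
  have "u \<in> {t0..<t}" "b \<le> T \<omega> u (act \<omega> u)" using u assms by auto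
  note * = tracked[OF this]
  have "est \<omega> u \<in> top" using u assms by (intro est_top) auto
  then show thesis using u * by (intro that[of u]) auto
qed

text \<open>A tracked pair has \<open>Z\<close> below the threshold, and with at least
  \<open>n\<close> plays on both arms the squared gap has weight at least \<open>n / 4\<close> in
  \<open>Z\<close>.\<close>

lemma plays_bound:
  assumes "u \<in> {t0..t}" "n \<le> T \<omega> u (est \<omega> u)" "n \<le> T \<omega> u (est \<omega> u + 1)"
  shows "real n \<le> 4 * \<beta> t / (chg v (est \<omega> u) - 2 * \<eta>)\<^sup>2"
proof -
  let ?x = "est \<omega> u"
  define p q where "p = real (T \<omega> u ?x)" and "q = real (T \<omega> u (?x + 1))"
  define g where "g = chg v ?x - 2 * \<eta>"
  have x: "?x \<in> {1..K - 1}" "D \<le> chg v ?x" using est_top[OF assms(1)] by (auto simp: top_def)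
  have g: "0 < g" using x d D_pos unfolding g_def by linarith
  have "1 \<le> u" using assms t0 N_less by auto
  then have Z: "Z_stat (H \<omega> u) ?x < \<beta> t"
    using est_Z[OF assms(1)] threshold_mono[of u t] assms(1) by auto
  have "real n / 4 * g\<^sup>2 \<le> Z_stat (H \<omega> u) ?x"
  proof (cases "n = 0")
    case True
    then show ?thesis by (simp add: Z_stat_def)
  next
    case False
    then have pq: "real n \<le> p" "real n \<le> q" "0 < p" "0 < q"
      using assms by (auto simp: p_def q_def)
    have "real n / 4 \<le> p * q / (2 * (p + q))"
    proof -
      have "real n * p \<le> q * p" "real n * q \<le> p * q" using pq by (auto intro!: mult_right_mono)
      then have "real n / 4 * (2 * (p + q)) \<le> p * q" by (simp add: algebra_simps)
      moreover have "0 < 2 * (p + q)" using pq by simp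
      ultimately show ?thesis by (subst pos_le_divide_eq)
    qed
    moreover have "g\<^sup>2 \<le> (gap (H \<omega> u) ?x)\<^sup>2"
      using gap_accurate[OF assms(1) x(1)] g by (intro power_mono) (auto simp: g_def)
    ultimately have "real n / 4 * g\<^sup>2 \<le> p * q / (2 * (p + q)) * (gap (H \<omega> u) ?x)\<^sup>2"
      using pq by (intro mult_mono) auto
    then show ?thesis by (simp add: Z_stat_def p_def q_def)
  qed
  then have "real n * g\<^sup>2 \<le> 4 * \<beta> t" using Z by simp
  then show ?thesis unfolding g_def[symmetric] using g by (simp add: pos_le_divide_eq)
qed

definition heavy :: "nat \<Rightarrow> nat set" where
  "heavy M = {x \<in> top. M < T \<omega> t x \<or> M < T \<omega> t (x + 1)}"

lemma finite_heavy: "finite (heavy M)"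
  by (auto simp: heavy_def top_def)

text \<open>Adds up the plays of all arms. An arm with more than \<open>M\<close> plays was last
  played while a heavy pair was tracked and its partner had at least as many plays, so
  \<open>plays_bound\<close> applies; the \<open>+ 1\<close> is that play and the factor 2 counts
  the arms of a pair.\<close>

lemma total_bound:
  assumes "b \<le> M"
  shows "real t \<le> real K * real M + (\<Sum>x\<in>heavy M. 2 * (4 * \<beta> t / (chg v x - 2 * \<eta>)\<^sup>2 + 1))"
proof -
  define n where "n x = 4 * \<beta> t / (chg v x - 2 * \<eta>)\<^sup>2 + 1" for x
  have n0: "0 \<le> n x" for x using threshold_nonneg by (simp add: n_def)
  have arm: "real (T \<omega> t a) \<le> real M + (\<Sum>x\<in>heavy M. if a \<in> {x, x + 1} then n x else 0)" for a
  proof (cases "T \<omega> t a \<le> M")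
    case True
    moreover have "0 \<le> (\<Sum>x\<in>heavy M. if a \<in> {x, x + 1} then n x else 0)"
      using n0 by (intro sum_nonneg) auto
    ultimately show ?thesis by linarith
  next
    case False
    with assms have "b < T \<omega> t a" by simp
    then obtain u where u: "u \<in> {t0..<t}" "act \<omega> u = a" "T \<omega> t a = T \<omega> u a + 1" "est \<omega> u \<in> top"
      "a \<in> {est \<omega> u, est \<omega> u + 1}" "T \<omega> u a \<le> T \<omega> u (est \<omega> u)" "T \<omega> u a \<le> T \<omega> u (est \<omega> u + 1)"
      by (rule many_plays[OF order_refl])
    have "est \<omega> u \<in> heavy M" using u False by (auto simp: heavy_def)
    have "real (T \<omega> u a) \<le> 4 * \<beta> t / (chg v (est \<omega> u) - 2 * \<eta>)\<^sup>2"
      using u by (intro plays_bound) auto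
    then have "real (T \<omega> t a) \<le> n (est \<omega> u)" using u by (simp add: n_def)
    also have "\<dots> = (if a \<in> {est \<omega> u, est \<omega> u + 1} then n (est \<omega> u) else 0)" using u by simp
    also have "\<dots> \<le> (\<Sum>x\<in>heavy M. if a \<in> {x, x + 1} then n x else 0)"
      using \<open>est \<omega> u \<in> heavy M\<close> n0 finite_heavy by (intro member_le_sum) auto
    finally show ?thesis by simp
  qed
  have "real t = (\<Sum>a\<in>{1..K}. real (T \<omega> t a))"
    using sum_plays[of \<omega> t] by (simp flip: of_nat_sum)
  also have "\<dots> \<le> (\<Sum>a\<in>{1..K}. real M + (\<Sum>x\<in>heavy M. if a \<in> {x, x + 1} then n x else 0))"
    by (intro sum_mono arm)
  also have "\<dots> = real K * real M + (\<Sum>x\<in>heavy M. \<Sum>a\<in>{1..K}. if a \<in> {x, x + 1} then n x else 0)"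
    unfolding sum.distrib by (subst sum.swap) simp
  also have "(\<Sum>x\<in>heavy M. \<Sum>a\<in>{1..K}. if a \<in> {x, x + 1} then n x else 0) \<le> (\<Sum>x\<in>heavy M. 2 * n x)"
  proof (intro sum_mono)
    fix x
    have "(\<Sum>a\<in>{1..K}. if a \<in> {x, x + 1} then n x else 0) = (\<Sum>a\<in>{1..K} \<inter> {x, x + 1}. n x)"
      by (subst sum.inter_restrict) auto
    also have "\<dots> \<le> (\<Sum>a\<in>{x, x + 1}. n x)"
      using n0 by (intro sum_mono2) auto
    finally show "(\<Sum>a\<in>{1..K}. if a \<in> {x, x + 1} then n x else 0) \<le> 2 * n x" by simp
  qed
  finally show ?thesis by (simp add: n_def)
qed

end

section \<open>Ties between change points\<close>

text \<open>Oriented along the true jump: for a balanced pair positive values widen the empirical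
  gap and negative ones narrow it.\<close>

definition signed_walk :: "env \<Rightarrow> nat \<Rightarrow> history \<Rightarrow> real" where
  "signed_walk v x h = sgn (v x - v (x + 1)) * (noise_sum v h x - noise_sum v h (x + 1))"

definition pair_clock :: "nat \<Rightarrow> history \<Rightarrow> nat" where
  "pair_clock x h = plays h x + plays h (x + 1)"

context bandit
begin

text \<open>Refers to the pair's own clock, so the interleaving of its plays with others does not
  enter. At the even clock values \<open>2 * n k\<close> a tracked pair has \<open>n k\<close> plays
  on each arm.\<close>

definition race_event :: "real \<Rightarrow> (nat \<Rightarrow> nat) \<Rightarrow> nat \<Rightarrow> nat \<Rightarrow> (nat \<Rightarrow> real) set" where
  "race_event C n J x = {\<omega>. \<exists>s. 2 * n J \<le> pair_clock x (H \<omega> s) \<and>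
     (\<forall>u\<le>s. \<forall>k\<le>J. pair_clock x (H \<omega> u) = 2 * n k \<longrightarrow> - C * sqrt (n k) \<le> signed_walk v x (H \<omega> u))}"

end

context good_run
begin

definition pair_min :: "nat \<Rightarrow> nat \<Rightarrow> nat" where
  "pair_min s x = min (T \<omega> s x) (T \<omega> s (x + 1))"

lemma pair_min_mono: "s \<le> s' \<Longrightarrow> pair_min s x \<le> pair_min s' x"
  unfolding pair_min_def by (intro min.mono T_mono)

text \<open>At the last play of the heavy arm its partner in the tracked pair had at least as many
  plays. Disjointness of the pairs identifies the tracked pair as \<open>x\<close>.\<close>

lemma heavy_pair_min:
  assumes "x \<in> heavy M" "b \<le> M"
  shows "M \<le> pair_min t x"
    and "\<exists>u\<in>{t0..<t}. est \<omega> u = x"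
proof -
  from assms obtain a where a: "a \<in> {x, x + 1}" "M < T \<omega> t a" and x: "x \<in> top"
    by (auto simp: heavy_def)
  then have "b < T \<omega> t a" using assms by simp
  then obtain u where u: "u \<in> {t0..<t}" "act \<omega> u = a" "T \<omega> t a = T \<omega> u a + 1" "est \<omega> u \<in> top"
      "a \<in> {est \<omega> u, est \<omega> u + 1}" "T \<omega> u a \<le> T \<omega> u (est \<omega> u)" "T \<omega> u a \<le> T \<omega> u (est \<omega> u + 1)"
    by (rule many_plays[OF order_refl])
  have eq: "est \<omega> u = x" using top_disjoint[OF u(4) x u(5) a(1)] .
  then show "\<exists>u\<in>{t0..<t}. est \<omega> u = x" using u by auto
  have "M \<le> pair_min u x" using u a eq by (simp add: pair_min_def)
  also have "\<dots> \<le> pair_min t x" using u by (intro pair_min_mono) auto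
  finally show "M \<le> pair_min t x" .
qed

lemma pair_played:
  assumes "x \<in> top" "u \<in> {t0..<t}" "act \<omega> u \<in> {x, x + 1}" "b \<le> pair_min u x"
  shows "est \<omega> u = x"
proof -
  have "b \<le> T \<omega> u (act \<omega> u)" using assms by (auto simp: pair_min_def)
  from tracked(1)[OF assms(2) this] show ?thesis
    using top_disjoint[OF _ assms(1) _ assms(3), of "est \<omega> u"] est_top[of u] assms(2) by auto
qed

text \<open>The pair \<open>j\<close> can only pass the count at which its gap is smallest while the gap of \<open>i\<close> is
  even smaller. From then on \<open>i\<close> is never played again, so its gap stays below \<open>l\<close>.\<close>

lemma race_aux:
  assumes ij: "i \<in> top" "j \<in> top" "i \<noteq> j" "i \<notin> found \<omega> t" "j \<notin> found \<omega> t"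
    and M: "M \<le> pair_min t i" "M \<le> pair_min t j" "b \<le> M"
    and late: "\<And>s x. s \<in> {t0..t} \<Longrightarrow> x \<in> {i, j} \<Longrightarrow> M \<le> pair_min s x \<Longrightarrow> l \<le> gap (H \<omega> s) x"
    and first: "\<And>s. s \<in> {t0..t} \<Longrightarrow> b \<le> pair_min s j \<Longrightarrow> b \<le> pair_min s i"
    and s1: "s1 \<in> {t0..t}" "b \<le> pair_min s1 j"
  shows "l \<le> gap (H \<omega> s1) j"
proof (rule ccontr)
  assume less: "\<not> l \<le> gap (H \<omega> s1) j"
  let ?g = "\<lambda>s x. gap (H \<omega> s) x"
  have unfound: "i \<notin> found \<omega> s" "j \<notin> found \<omega> s" if "s \<le> t" for s
    using found_mono[OF that, of \<omega>] ij by auto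
  have ijK: "i \<in> {1..K - 1}" "j \<in> {1..K - 1}" using ij by (auto simp: top_def)
  define Q where "Q = {s \<in> {t0..t}. b \<le> pair_min s j}"
  have Q: "finite Q" "s1 \<in> Q" using s1 by (auto simp: Q_def)
  define y where "y = Min ((\<lambda>s. ?g s j) ` Q)"
  have y_le: "y \<le> ?g s j" if "s \<in> Q" for s unfolding y_def using Q that by auto
  have y_l: "y < l" using y_le[OF Q(2)] less by simp
  have "y \<in> (\<lambda>s. ?g s j) ` Q" unfolding y_def using Q by (intro Min_in) auto
  then have ne: "{s \<in> Q. ?g s j = y} \<noteq> {}" by auto
  define s2 where "s2 = Max {s \<in> Q. ?g s j = y}"
  have "s2 \<in> {s \<in> Q. ?g s j = y}" unfolding s2_def using Q ne by (intro Max_in) auto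
  then have s2: "s2 \<in> {t0..t}" "b \<le> pair_min s2 j" "?g s2 j = y" by (auto simp: Q_def)
  have later: "y < ?g s j" if "s2 < s" "s \<le> t" for s
  proof -
    have s: "s \<in> Q" using that s2 pair_min_mono[of s2 s j] by (auto simp: Q_def)
    have "?g s j \<noteq> y"
    proof
      assume "?g s j = y"
      then have "s \<le> s2" unfolding s2_def using s Q by (intro Max_ge) auto
      then show False using that by simp
    qed
    then show ?thesis using y_le[OF s] by simp
  qed
  \<comment> \<open>At \<open>t\<close> the pair \<open>j\<close> has \<open>M\<close> plays and a
    gap of at least \<open>l > y\<close>. The gap moves right after \<open>s2\<close>, so an arm of
    \<open>j\<close> is played there; hence \<open>j\<close> is the estimate and the unfound
    \<open>i\<close> has no larger gap.\<close>
  have "s2 \<noteq> t" using late[of t j] M s2 y_l t0 by auto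
  then have s2t: "s2 \<in> {t0..<t}" using s2 by auto
  have "?g (Suc s2) j \<noteq> ?g s2 j" using later[of "Suc s2"] s2t s2(3) by auto
  then have act2: "act \<omega> s2 \<in> {j, j + 1}" using gap_Suc by blast
  then have "est \<omega> s2 = j" using s2t s2 ij by (intro pair_played) auto
  then have i2: "?g s2 i \<le> y"
    using est_max[OF s2(1), of i] ijK unfound[of s2] s2 by auto
  have const: "?g s i = ?g s2 i" if "s2 \<le> s" "s \<le> t" for s
    using that
  proof (induction s rule: dec_induct)
    case (step s)
    have IH: "?g s i = ?g s2 i" using step by simp
    have st: "s \<in> {t0..<t}" using step s2t by auto
    \<comment> \<open>A play of \<open>i\<close> after \<open>s2\<close> would need its gap, frozen
      at a value of at most \<open>y\<close>, to match that of \<open>j\<close>, which stays above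
      \<open>y\<close> from then on.\<close>
    have "act \<omega> s \<notin> {i, i + 1}"
    proof
      assume a: "act \<omega> s \<in> {i, i + 1}"
      show False
      proof (cases "s = s2")
        case True
        then show False using top_disjoint[OF ij(1,2) a] act2 ij by auto
      next
        case False
        have "b \<le> pair_min s2 i" using first[OF s2(1,2)] .
        then have "b \<le> pair_min s i" using pair_min_mono[of s2 s i] step by simp
        then have "est \<omega> s = i" using a st ij by (intro pair_played) auto
        then have "?g s j \<le> ?g s i"
          using est_max[of s j] st ijK unfound[of s] by auto
        then show False using later[of s] False step i2 IH by auto
      qed
    qed
    then show ?case using gap_Suc[of \<omega> s i] IH by simp
  qed simp
  have "?g t i = ?g s2 i" by (rule const) (use s2 in auto)
  then show False using late[of t i] M t0 i2 y_l by auto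
qed

text \<open>\<open>race_aux\<close> needs \<open>i\<close> to have \<open>b\<close> plays whenever
  \<open>j\<close> does. The counts are monotone in time, so one of the two labellings
  qualifies.\<close>

lemma race:
  assumes ij: "i \<in> top" "j \<in> top" "i \<noteq> j" "i \<notin> found \<omega> t" "j \<notin> found \<omega> t"
    and M: "M \<le> pair_min t i" "M \<le> pair_min t j" "b \<le> M"
    and late: "\<And>s x. s \<in> {t0..t} \<Longrightarrow> x \<in> {i, j} \<Longrightarrow> M \<le> pair_min s x \<Longrightarrow> l \<le> gap (H \<omega> s) x"
  shows "\<exists>x\<in>{i, j}. \<forall>s\<in>{t0..t}. b \<le> pair_min s x \<longrightarrow> l \<le> gap (H \<omega> s) x"
proof (cases "\<forall>s\<in>{t0..t}. b \<le> pair_min s j \<longrightarrow> b \<le> pair_min s i")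
  case True
  then have "\<forall>s\<in>{t0..t}. b \<le> pair_min s j \<longrightarrow> l \<le> gap (H \<omega> s) j"
    using race_aux[OF ij M late] by blast
  then show ?thesis by blast
next
  case False
  then obtain s0 where s0: "b \<le> pair_min s0 j" "pair_min s0 i < b" by (auto simp: not_le)
  have "b \<le> pair_min s j" if "b \<le> pair_min s i" for s
  proof -
    have "s0 \<le> s"
      using that s0 pair_min_mono[of s s0 i] by (cases "s0 \<le> s") auto
    then show ?thesis using s0 pair_min_mono[of s0 s j] by simp
  qed
  then have "\<forall>s\<in>{t0..t}. b \<le> pair_min s i \<longrightarrow> l \<le> gap (H \<omega> s) i"
    using race_aux[OF ij(2,1) ij(3)[symmetric] ij(5,4) M(2,1,3), of l] late by blast
  then show ?thesis by blast
qed

text \<open>Beyond \<open>b\<close> plays an arm is only played when its partner has at least as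
  many, so the two counts differ by at most one; an even clock leaves equality.\<close>

lemma balanced:
  assumes "s \<le> t" "x \<in> top" "pair_clock x (H \<omega> s) = 2 * n" "b < n"
  shows "T \<omega> s x = n" "T \<omega> s (x + 1) = n"
proof -
  have near: "T \<omega> s a \<le> T \<omega> s a' + 1" if a: "a \<in> {x, x + 1}" "a' \<in> {x, x + 1}" "b < T \<omega> s a" for a a'
  proof -
    obtain u where u: "u \<in> {t0..<s}" "act \<omega> u = a" "T \<omega> s a = T \<omega> u a + 1" "est \<omega> u \<in> top"
        "a \<in> {est \<omega> u, est \<omega> u + 1}" "T \<omega> u a \<le> T \<omega> u (est \<omega> u)" "T \<omega> u a \<le> T \<omega> u (est \<omega> u + 1)"
      using many_plays[OF assms(1) a(3)] by blast
    have "est \<omega> u = x" using top_disjoint[OF u(4) assms(2) u(5) a(1)] .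
    then have "T \<omega> u a \<le> T \<omega> u a'" using u a by auto
    also have "\<dots> \<le> T \<omega> s a'" using u by (intro T_mono) auto
    finally show ?thesis using u by simp
  qed
  have "T \<omega> s x + T \<omega> s (x + 1) = 2 * n" using assms by (simp add: pair_clock_def)
  moreover have "T \<omega> s x \<le> T \<omega> s (x + 1) + 1" if "b < T \<omega> s x" using near that by blast
  moreover have "T \<omega> s (x + 1) \<le> T \<omega> s x + 1" if "b < T \<omega> s (x + 1)" using near that by blast
  ultimately show "T \<omega> s x = n" "T \<omega> s (x + 1) = n" using assms(4) by linarith+
qed

text \<open>The noise of both arms is smaller than the jump, so the difference of the empirical
  means keeps its sign and the absolute value opens.\<close>

lemma gap_signed_walk:
  assumes "s \<in> {t0..t}" "x \<in> top" "T \<omega> s x = n" "T \<omega> s (x + 1) = n" "0 < n"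
  shows "gap (H \<omega> s) x = chg v x + signed_walk v x (H \<omega> s) / n"
proof -
  have x: "x \<in> {1..K - 1}" "D \<le> chg v x" using assms by (auto simp: top_def)
  define p where "p = noise_sum v (H \<omega> s) x / real n"
  define q where "q = noise_sum v (H \<omega> s) (x + 1) / real n"
  have m: "emp_mean (H \<omega> s) x = v x + p" "emp_mean (H \<omega> s) (x + 1) = v (x + 1) + q"
    using assms emp_mean_eq[of "H \<omega> s" x v] emp_mean_eq[of "H \<omega> s" "x + 1" v] by (auto simp: p_def q_def)
  have "\<bar>p\<bar> \<le> \<eta>" "\<bar>q\<bar> \<le> \<eta>"
    using accurate[OF assms(1), of x] accurate[OF assms(1), of "x + 1"] x m by auto
  then have small: "\<bar>p - q\<bar> < chg v x" using x d D_pos by linarith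
  have w: "signed_walk v x (H \<omega> s) / n = sgn (v x - v (x + 1)) * (p - q)"
    by (simp add: signed_walk_def p_def q_def diff_divide_distrib right_diff_distrib)
  have g: "gap (H \<omega> s) x = \<bar>(v x - v (x + 1)) + (p - q)\<bar>"
    unfolding gap_def m by (simp add: algebra_simps)
  show ?thesis
    unfolding g w using small unfolding chg_def by (auto simp: sgn_if abs_if split: if_splits)
qed

text \<open>From \<open>M\<close> plays on each mean is accurate to \<open>C / (2 * sqrt M)\<close>,
  so late gaps are at least \<open>l\<close>. The race extends this down to \<open>b\<close> plays
  for one of two tied pairs, and \<open>n k \<le> M\<close> turns it into a bound of
  \<open>- C * sqrt (n k)\<close> on the walk: a race event.\<close>

lemma unfound_ties:
  fixes C :: real
  assumes C: "0 \<le> C" and M: "b \<le> M" "0 < M"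
    and n: "\<And>k. k \<le> J \<Longrightarrow> b < n k \<and> n k \<le> M"
    and late: "\<And>s a. s \<le> t \<Longrightarrow> a \<in> {1..K} \<Longrightarrow> M \<le> T \<omega> s a \<Longrightarrow>
      \<bar>noise_sum v (H \<omega> s) a\<bar> \<le> C / (2 * sqrt M) * T \<omega> s a"
    and norace: "\<And>x. x \<in> change_points K v \<Longrightarrow> \<omega> \<notin> race_event C n J x"
  shows "card {x \<in> heavy M. chg v x = D \<and> x \<notin> found \<omega> t} \<le> 1"
proof (rule ccontr)
  let ?Y = "{x \<in> heavy M. chg v x = D \<and> x \<notin> found \<omega> t}"
  define l where "l = D - C / sqrt M"
  assume "\<not> card ?Y \<le> 1"
  moreover have "finite ?Y" using finite_heavy by simp
  ultimately obtain i j where ij: "i \<in> ?Y" "j \<in> ?Y" "i \<noteq> j"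
    using card_le_Suc0_iff_eq[of ?Y] unfolding One_nat_def by blast
  then have top: "i \<in> top" "j \<in> top" by (auto simp: heavy_def)
  have "\<exists>x\<in>{i, j}. \<forall>s\<in>{t0..t}. b \<le> pair_min s x \<longrightarrow> l \<le> gap (H \<omega> s) x"
  proof (rule race)
    show "M \<le> pair_min t i" "M \<le> pair_min t j" using ij M by (auto intro: heavy_pair_min)
    show "l \<le> gap (H \<omega> s) x" if s: "s \<in> {t0..t}" and x: "x \<in> {i, j}" and Mx: "M \<le> pair_min s x" for s x
    proof -
      have dev: "\<bar>emp_mean (H \<omega> s) a - v a\<bar> \<le> C / (2 * sqrt M)" if a: "a \<in> {x, x + 1}" for a
      proof -
        have "M \<le> T \<omega> s a" using Mx a by (auto simp: pair_min_def)
        then have pos: "0 < T \<omega> s a" using M by simp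
        have "a \<in> {1..K}" using a x top by (auto simp: top_def)
        then have "\<bar>noise_sum v (H \<omega> s) a\<bar> \<le> C / (2 * sqrt M) * T \<omega> s a"
          using late \<open>M \<le> T \<omega> s a\<close> s by auto
        then have "\<bar>noise_sum v (H \<omega> s) a\<bar> / T \<omega> s a \<le> C / (2 * sqrt M)"
          using pos by (simp only: pos_divide_le_eq of_nat_0_less_iff)
        then show ?thesis using emp_mean_eq[OF pos, of v] by simp
      qed
      have "chg v x = D" using x ij by auto
      moreover have "C / (2 * sqrt M) + C / (2 * sqrt M) = C / sqrt M" by simp
      moreover have "\<bar>emp_mean (H \<omega> s) x - v x\<bar> \<le> C / (2 * sqrt M)"
        "\<bar>emp_mean (H \<omega> s) (x + 1) - v (x + 1)\<bar> \<le> C / (2 * sqrt M)" by (auto intro: dev)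
      ultimately show ?thesis unfolding l_def gap_def chg_def by linarith
    qed
  qed (use ij top M in auto)
  then obtain x where x: "x \<in> {i, j}" and gx: "\<And>s. s \<in> {t0..t} \<Longrightarrow> b \<le> pair_min s x \<Longrightarrow> l \<le> gap (H \<omega> s) x"
    by blast
  have xt: "x \<in> top" "chg v x = D" "x \<in> heavy M" using x ij top by auto
  have "\<omega> \<in> race_event C n J x"
    unfolding race_event_def
  proof (intro CollectI exI[of _ t] conjI allI impI)
    have "M \<le> pair_min t x" using xt M by (intro heavy_pair_min)
    then show "2 * n J \<le> pair_clock x (H \<omega> t)"
      using n[of J] by (simp add: pair_min_def pair_clock_def)
  next
    fix u k assume u: "u \<le> t" and k: "k \<le> J" and clock: "pair_clock x (H \<omega> u) = 2 * n k"
    have T: "T \<omega> u x = n k" "T \<omega> u (x + 1) = n k"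
      using balanced[OF u xt(1) clock] n[OF k] by auto
    have nk: "b < n k" "n k \<le> M" "0 < n k" using n[OF k] by auto
    have "t0 \<le> u" using T_le[of \<omega> u x] T nk t0 by linarith
    then have ut: "u \<in> {t0..t}" using u by auto
    have "l \<le> gap (H \<omega> u) x" using T nk by (intro gx ut) (auto simp: pair_min_def)
    then have "- C / sqrt M \<le> signed_walk v x (H \<omega> u) / n k"
      using gap_signed_walk[OF ut xt(1) T nk(3)] xt(2) by (simp add: l_def)
    then have "- C / sqrt M * n k \<le> signed_walk v x (H \<omega> u)"
      using nk by (simp add: pos_le_divide_eq)
    moreover have "C * (n k / sqrt M) \<le> C * sqrt (n k)"
    proof (rule mult_left_mono[OF _ C])
      have "real (n k) = sqrt (n k) * sqrt (n k)" by simp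
      also have "\<dots> \<le> sqrt (n k) * sqrt M" using nk by (intro mult_left_mono) auto
      finally show "n k / sqrt M \<le> sqrt (n k)" using M by (simp add: pos_divide_le_eq)
    qed
    ultimately show "- C * sqrt (n k) \<le> signed_walk v x (H \<omega> u)" by simp
  qed
  then show False using norace[of x] xt top_change by auto
qed

text \<open>Once a tied pair is the estimate, all of \<open>strict_top\<close> is found, within
  fewer than \<open>N\<close> positions. So at most \<open>N - 1 - card strict_top\<close> tied
  pairs are found, and one more may be heavy without being found.\<close>

lemma card_heavy_ties:
  assumes "card {x \<in> heavy M. chg v x = D \<and> x \<notin> found \<omega> t} \<le> 1" "b \<le> M"
  shows "card {x \<in> heavy M. chg v x = D} \<le> N - card strict_top"
proof (cases "{x \<in> heavy M. chg v x = D} = {}")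
  case False
  let ?Y = "{x \<in> heavy M. chg v x = D}"
  obtain x where "x \<in> heavy M" "chg v x = D" using False by auto
  then obtain u where u: "u \<in> {t0..<t}" "est \<omega> u = x" using heavy_pair_min(2) assms by blast
  then have "strict_top \<subseteq> found \<omega> u" using \<open>chg v x = D\<close> by (intro strict_top_found) auto
  also have "\<dots> \<subseteq> found \<omega> t" using u by (intro found_mono) auto
  finally have sub: "strict_top \<subseteq> found \<omega> t" .
  have tt: "t \<in> {t0..t}" using t0 by auto
  have fin: "finite (found \<omega> t)" "finite strict_top" "finite ?Y"
    using card_found(2)[OF tt] finite_heavy by (auto intro: finite_subset simp: strict_top_def)
  have "card (?Y \<inter> found \<omega> t) + card strict_top = card ((?Y \<inter> found \<omega> t) \<union> strict_top)"
    using fin by (intro card_Un_disjoint[symmetric]) (auto simp: strict_top_def)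
  also have "\<dots> \<le> card (found \<omega> t)" using fin sub by (intro card_mono) auto
  finally have "card (?Y \<inter> found \<omega> t) + card strict_top < N" using card_found(1)[OF tt] by simp
  moreover have "card ?Y = card (?Y \<inter> found \<omega> t) + card (?Y - found \<omega> t)"
    using fin(3) by (rule card_Int_Diff)
  moreover have "?Y - found \<omega> t = {x \<in> heavy M. chg v x = D \<and> x \<notin> found \<omega> t}" by auto
  ultimately show ?thesis using assms(1) by simp
next
  case True
  show ?thesis unfolding True by simp
qed

lemma total_bound_ties:
  fixes f :: "real \<Rightarrow> real"
  defines "f \<equiv> \<lambda>y. 2 * (4 * \<beta> t / (y - 2 * \<eta>)\<^sup>2 + 1)"
  assumes "card {x \<in> heavy M. chg v x = D \<and> x \<notin> found \<omega> t} \<le> 1" "b \<le> M"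
  shows "real t \<le> real K * real M + ((\<Sum>x\<in>strict_top. f (chg v x)) + real (N - card strict_top) * f D)"
proof -
  have f0: "0 \<le> f y" for y using threshold_nonneg by (simp add: f_def)
  let ?Y = "{x \<in> heavy M. chg v x = D}"
  have fin: "finite strict_top" "finite ?Y"
    using finite_heavy by (auto simp: strict_top_def)
  have "(\<Sum>x\<in>heavy M. f (chg v x)) \<le> (\<Sum>x\<in>strict_top \<union> ?Y. f (chg v x))"
    using fin f0 by (intro sum_mono2) (auto simp: heavy_def top_def strict_top_def)
  also have "\<dots> = (\<Sum>x\<in>strict_top. f (chg v x)) + (\<Sum>x\<in>?Y. f (chg v x))"
    using fin by (intro sum.union_disjoint) (auto simp: strict_top_def)
  also have "(\<Sum>x\<in>?Y. f (chg v x)) = real (card ?Y) * f D" by simp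
  also have "\<dots> \<le> real (N - card strict_top) * f D"
    using card_heavy_ties[OF assms(2,3)] f0 by (intro mult_right_mono) auto
  finally show ?thesis using total_bound[OF assms(3)] by (simp add: f_def)
qed

end

section \<open>Random walks above a square-root boundary\<close>

lemma has_bochner_integral_std_normal_exp:
  "has_bochner_integral std_normal (\<lambda>z. exp (\<theta> * z)) (exp (\<theta>\<^sup>2 / 2))"
  by (rule has_bochner_integral_nn_integral) (auto simp: nn_integral_std_normal_exp)

text \<open>With \<open>Y = exp (- l (w - c))\<close>, \<open>drop_bound A l c w 0\<close> is \<open>1 - 4 (Y - 1) (A - Y) / (A - 1)\<^sup>2\<close>,
  which is nonnegative everywhere and at least 1 for \<open>w \<ge> c\<close>; the argument \<open>r\<close> is the remaining
  time of the heat flow. It bounds the probability that a Gaussian walk ends above \<open>c\<close>.\<close>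

definition drop_bound :: "real \<Rightarrow> real \<Rightarrow> real \<Rightarrow> real \<Rightarrow> real \<Rightarrow> real" where
  "drop_bound A l c w r = 1 - 4 / (A - 1)\<^sup>2 *
     ((A + 1) * exp (- l * (w - c) + l\<^sup>2 * r / 2) - A - exp (- 2 * l * (w - c) + 2 * l\<^sup>2 * r))"

lemma measurable_drop_bound [measurable]: "(\<lambda>w. drop_bound A l c w r) \<in> borel_measurable borel"
  unfolding drop_bound_def by (intro borel_measurable_continuous_onI continuous_intros)

text \<open>With \<open>Y\<close> the first exponential, the second is at least
  \<open>Y\<^sup>2\<close>, so the bracket is at most a quadratic in \<open>Y\<close> whose maximum
  is \<open>(A - 1)\<^sup>2 / 4\<close>.\<close>

lemma drop_bound_nonneg:
  assumes "1 < A" "0 \<le> r"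
  shows "0 \<le> drop_bound A l c w r"
proof -
  define Y where "Y = exp (- l * (w - c) + l\<^sup>2 * r / 2)"
  have "Y\<^sup>2 = exp (- 2 * l * (w - c) + l\<^sup>2 * r)"
    unfolding Y_def by (simp add: power2_eq_square algebra_simps flip: exp_add)
  also have "\<dots> \<le> exp (- 2 * l * (w - c) + 2 * l\<^sup>2 * r)"
    using assms by simp
  finally have "(A + 1) * Y - A - exp (- 2 * l * (w - c) + 2 * l\<^sup>2 * r) \<le> (A + 1) * Y - A - Y\<^sup>2" by simp
  also have "\<dots> = (A - 1)\<^sup>2 / 4 - (Y - (A + 1) / 2)\<^sup>2"
    by (simp add: power2_eq_square field_simps)
  also have "\<dots> \<le> (A - 1)\<^sup>2 / 4" by simp
  finally have "4 / (A - 1)\<^sup>2 * ((A + 1) * Y - A - exp (- 2 * l * (w - c) + 2 * l\<^sup>2 * r)) \<le> 4 / (A - 1)\<^sup>2 * ((A - 1)\<^sup>2 / 4)"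
    by (intro mult_left_mono) auto
  also have "\<dots> = 1" using assms by simp
  finally show ?thesis by (simp add: drop_bound_def Y_def)
qed

lemma drop_bound_end:
  assumes "1 < A" "0 \<le> l" "c \<le> w"
  shows "1 \<le> drop_bound A l c w 0"
proof -
  define Y where "Y = exp (- l * (w - c))"
  have Y: "0 < Y" "Y \<le> 1" using assms by (auto simp: Y_def)
  have e: "exp (- l * (w - c) + l\<^sup>2 * 0 / 2) = Y" "exp (- 2 * l * (w - c) + 2 * l\<^sup>2 * 0) = Y * Y"
    by (simp_all add: Y_def flip: exp_add)
  have "drop_bound A l c w 0 = 1 + 4 / (A - 1)\<^sup>2 * ((1 - Y) * (A - Y))"
  proof -
    have "(A + 1) * Y - A - Y * Y = - ((1 - Y) * (A - Y))" by (simp add: algebra_simps)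
    then show ?thesis unfolding drop_bound_def e by simp
  qed
  moreover have "0 \<le> 4 / (A - 1)\<^sup>2 * ((1 - Y) * (A - Y))" using Y assms by (intro mult_nonneg_nonneg) auto
  ultimately show ?thesis by linarith
qed

text \<open>Each exponential carries the factor in \<open>r\<close> that a Gaussian step produces,
  so averaging over a step is the same as one more unit of \<open>r\<close>. The sign
  \<open>s\<close> accounts for which arm of the pair is played.\<close>

lemma nn_integral_drop_bound:
  assumes "1 < A" "0 \<le> r" "\<bar>s\<bar> = 1"
  shows "(\<integral>\<^sup>+z. ennreal (drop_bound A l c (w + s * z) r) \<partial>std_normal) = ennreal (drop_bound A l c w (r + 1))"
proof -
  have s: "s\<^sup>2 = 1" using assms by (metis abs_power2 power2_abs power_one)
  define a where "a = 4 / (A - 1)\<^sup>2"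
  define B1 where "B1 = a * (A + 1) * exp (- l * (w - c) + l\<^sup>2 * r / 2)"
  define B2 where "B2 = a * exp (- 2 * l * (w - c) + 2 * l\<^sup>2 * r)"
  have eq: "drop_bound A l c (w + s * z) r = (1 + a * A) - B1 * exp ((- l * s) * z) + B2 * exp ((- 2 * l * s) * z)" for z
    unfolding drop_bound_def B1_def B2_def a_def[symmetric] mult.assoc exp_add[symmetric]
    by (simp add: algebra_simps flip: exp_add)
  have hc: "has_bochner_integral std_normal (\<lambda>z. 1 + a * A) (1 + a * A)"
    using std_normal.prob_space by (simp add: has_bochner_integral_iff)
  have hb: "has_bochner_integral std_normal (\<lambda>z. drop_bound A l c (w + s * z) r)
      ((1 + a * A) - B1 * exp ((- l * s)\<^sup>2 / 2) + B2 * exp ((- 2 * l * s)\<^sup>2 / 2))"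
    unfolding eq
    by (intro has_bochner_integral_add has_bochner_integral_diff hc
        has_bochner_integral_mult_right has_bochner_integral_std_normal_exp)
  have "(\<integral>z. drop_bound A l c (w + s * z) r \<partial>std_normal) =
      (1 + a * A) - B1 * exp ((- l * s)\<^sup>2 / 2) + B2 * exp ((- 2 * l * s)\<^sup>2 / 2)"
    using hb by (rule has_bochner_integral_integral_eq)
  also have "\<dots> = drop_bound A l c w (r + 1)"
    unfolding drop_bound_def B1_def B2_def a_def[symmetric] using s
    by (simp add: power_mult_distrib algebra_simps add_divide_distrib flip: exp_add)
  finally show ?thesis
    using hb drop_bound_nonneg[OF assms(1,2)]
    by (subst nn_integral_eq_integral) (auto simp: has_bochner_integral_iff)
qed

text \<open>The exponent is the bound \<open>16 + 32\<close> times \<open>(C + 1)\<^sup>2\<close> on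
  \<open>E + l\<^sup>2 * r\<close> in \<open>drop_bound_start\<close>, which controls the ratio of
  the second exponential to the first; \<open>A\<close> is twice the resulting bound on that
  ratio.\<close>

definition drop_const :: "real \<Rightarrow> real" where
  "drop_const C = 2 * exp (48 * (C + 1)\<^sup>2)"

lemma drop_const_ge:
  assumes "0 \<le> C"
  shows "3 \<le> drop_const C"
proof -
  have "1 \<le> (C + 1)\<^sup>2" using assms by (intro one_le_power) auto
  moreover have "1 + 48 * (C + 1)\<^sup>2 \<le> exp (48 * (C + 1)\<^sup>2)" by (rule exp_ge_add_one_self)
  ultimately show ?thesis unfolding drop_const_def by linarith
qed

text \<open>The slope \<open>l\<close> makes the heat term \<open>l\<^sup>2 * r / 2\<close>, at
  least \<open>8 * (C + 1)\<^sup>2\<close>, beat the initial height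
  \<open>l * (w + C * sqrt n')\<close>, at most \<open>4 * (C + 1)\<^sup>2\<close>. Hence the first
  exponential is at least 5 and the bracket at least 1: a definite chance to drop from any start
  within \<open>sqrt n'\<close>.\<close>

lemma drop_bound_start:
  fixes C n' r w :: real
  defines "A \<equiv> drop_const C"
  assumes C: "1 \<le> C" and n': "0 < n'" and w: "\<bar>w\<bar> \<le> sqrt n'" and r: "n' \<le> r" "r \<le> 2 * n'"
  shows "drop_bound A (4 * (C + 1) / sqrt n') (- C * sqrt n') w r \<le> 1 - 4 / (A - 1)\<^sup>2"
proof -
  define k where "k = (C + 1)\<^sup>2"
  define B where "B = exp (48 * k)"
  define l where "l = 4 * (C + 1) / sqrt n'"
  define E where "E = - l * (w + C * sqrt n') + l\<^sup>2 * r / 2"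
  have A: "A = 2 * B" by (simp add: A_def drop_const_def B_def k_def)
  have k: "1 \<le> k" unfolding k_def using C by (intro one_le_power) auto
  have B: "1 \<le> B" unfolding B_def using k by simp
  have wn: "\<bar>w / sqrt n'\<bar> \<le> 1" using w n' by (simp add: abs_divide)
  have l2: "l\<^sup>2 * r = 16 * k * (r / n')"
  proof -
    have "l\<^sup>2 = 16 * k / n'"
      unfolding l_def k_def power_divide power_mult_distrib using n' by simp
    then show ?thesis by simp
  qed
  have rn: "1 \<le> r / n'" "r / n' \<le> 2" using r n' by (auto simp: field_simps)
  have l2b: "16 * k \<le> l\<^sup>2 * r" "l\<^sup>2 * r \<le> 32 * k"
    unfolding l2 using rn k by (auto intro: mult_left_mono[of 1 "r / n'" "16 * k", simplified] mult_left_mono[of "r / n'" 2 "16 * k", simplified])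
  have lw: "l * (w + C * sqrt n') = 4 * (C + 1) * (w / sqrt n' + C)"
    using n' by (simp add: l_def field_simps)
  have wC: "0 \<le> w / sqrt n' + C" "w / sqrt n' + C \<le> C + 1" "0 \<le> 4 * (C + 1)"
    using abs_le_D1[OF wn] abs_le_D2[OF wn] C by (linarith | simp)+
  have lw1: "0 \<le> l * (w + C * sqrt n')" unfolding lw by (intro mult_nonneg_nonneg wC)
  have lw2: "l * (w + C * sqrt n') \<le> 4 * k"
    unfolding lw using mult_left_mono[OF wC(2,3)] by (simp add: k_def power2_eq_square algebra_simps)
  have E: "4 * k \<le> E" "E \<le> 16 * k" using l2b lw1 lw2 unfolding E_def by linarith+
  have Y: "5 \<le> exp E" using exp_ge_add_one_self[of E] E k by linarith
  have e2: "exp (- 2 * l * (w + C * sqrt n') + 2 * l\<^sup>2 * r) \<le> exp E * B"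
  proof -
    have "- 2 * l * (w + C * sqrt n') + 2 * l\<^sup>2 * r = E + (E + l\<^sup>2 * r)" by (simp add: E_def)
    also have "\<dots> \<le> E + 48 * k" using E l2b by simp
    finally show ?thesis by (simp add: B_def flip: exp_add)
  qed
  have "1 \<le> (A + 1) * exp E - A - exp E * B"
  proof -
    have "5 * (B + 1) \<le> exp E * (B + 1)" using Y B by (intro mult_right_mono) auto
    then show ?thesis using B unfolding A by (simp add: algebra_simps)
  qed
  then have "1 \<le> (A + 1) * exp E - A - exp (- 2 * l * (w + C * sqrt n') + 2 * l\<^sup>2 * r)" using e2 by linarith
  then have "4 / (A - 1)\<^sup>2 * 1 \<le> 4 / (A - 1)\<^sup>2 * ((A + 1) * exp E - A - exp (- 2 * l * (w + C * sqrt n') + 2 * l\<^sup>2 * r))"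
    by (intro mult_left_mono) auto
  then show ?thesis unfolding drop_bound_def l_def[symmetric] by (simp add: E_def)
qed

text \<open>The growth conditions separate the scales: at checkpoint \<open>k\<close> the band lies
  within \<open>sqrt (n (Suc k))\<close> of 0, and at least half of the clock time up to
  \<open>2 * n (Suc k)\<close> remains.\<close>

locale race_bound = bandit +
  fixes x :: nat and C U :: real and n :: "nat \<Rightarrow> nat" and J :: nat
  assumes change: "v x \<noteq> v (x + 1)" and C: "1 \<le> C" and U: "0 < U" and n0: "0 < n 0"
    and growth: "\<And>k. C\<^sup>2 * n k \<le> n (Suc k)" "\<And>k. 4 * U\<^sup>2 * n k \<le> n (Suc k)" "\<And>k. 2 * n k \<le> n (Suc k)"
begin

definition A :: real where "A = drop_const C"

definition q :: real where "q = 1 - 4 / (A - 1)\<^sup>2"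

lemma A_gt: "1 < A" using drop_const_ge[of C] C by (simp add: A_def)

lemma q_nonneg: "0 \<le> q"
proof -
  have "2\<^sup>2 \<le> (A - 1)\<^sup>2" using drop_const_ge[of C] C by (intro power_mono) (auto simp: A_def)
  then show ?thesis using A_gt by (simp add: q_def)
qed

text \<open>The lower edge is the race condition. The upper edge is added because a walk that is
  very high at one checkpoint need not drop by the next; leaving there is charged to a mixture
  bound.\<close>

definition in_band :: "nat \<Rightarrow> real \<Rightarrow> bool" where
  "in_band c w \<longleftrightarrow> (\<forall>k\<le>J. c = 2 * n k \<longrightarrow> - C * sqrt (n k) \<le> w \<and> w \<le> 2 * U * sqrt (n k))"

definition stage :: "nat \<Rightarrow> nat" where
  "stage c = Max {k. k < J \<and> 2 * n k \<le> c}"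

definition stage_bound :: "nat \<Rightarrow> real \<Rightarrow> real \<Rightarrow> real" where
  "stage_bound k = drop_bound A (4 * (C + 1) / sqrt (n (Suc k))) (- C * sqrt (n (Suc k)))"

text \<open>Bound on the chance to stay in the band at all later checkpoints: a factor
  \<open>q\<close> for each stage not yet begun and \<open>drop_bound\<close> for the running
  one.\<close>

definition g :: "nat \<Rightarrow> real \<Rightarrow> real" where
  "g c w = (if c < 2 * n 0 then q ^ J else if 2 * n J \<le> c then 1 else
     q ^ (J - Suc (stage c)) * stage_bound (stage c) w (2 * real (n (Suc (stage c))) - real c))"

lemma n_double: "2 * n k \<le> n (Suc k)"
  using growth(3)[of k] by (simp flip: of_nat_le_iff[where ?'a = real])

lemma n_mono: "k \<le> k' \<Longrightarrow> n k \<le> n k'"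
  by (rule lift_Suc_mono_le[of n]) (use n_double in \<open>auto intro: add_leD1 simp: mult_2\<close>)

lemma n_pos: "0 < n k"
  using n_mono[of 0 k] n0 by simp

lemma stage_eq:
  assumes "k < J" "2 * n k \<le> c" "c < 2 * n (Suc k)"
  shows "stage c = k"
  unfolding stage_def
proof (rule Max_eqI)
  fix y assume "y \<in> {k. k < J \<and> 2 * n k \<le> c}"
  then show "y \<le> k" using assms n_mono[of "Suc k" y] by (cases "y \<le> k") auto
qed (use assms in auto)

lemma stage_exists:
  assumes "2 * n 0 \<le> c" "c < 2 * n J"
  obtains k where "k < J" "2 * n k \<le> c" "c < 2 * n (Suc k)"
proof -
  define m where "m = (LEAST m. c < 2 * n m)"
  have m: "c < 2 * n m" unfolding m_def using assms(2) by (rule LeastI)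
  have "m \<noteq> 0" using m assms(1) by (cases m) auto
  then obtain k where k: "m = Suc k" by (cases m) auto
  have "\<not> c < 2 * n k" unfolding m_def by (rule not_less_Least) (use k m_def in simp)
  moreover have "m \<le> J" unfolding m_def using assms(2) by (rule Least_le)
  ultimately show thesis using m k by (intro that[of k]) auto
qed

lemma g_start:
  assumes "k \<le> J" "in_band (2 * n k) w"
  shows "g (2 * n k) w \<le> q ^ (J - k)"
proof (cases "k = J")
  case True
  then show ?thesis using n_mono[of 0 J] by (simp add: g_def)
next
  case False
  then have k: "k < J" using assms by simp
  let ?m = "n (Suc k)"
  have lt: "n k < ?m" using n_double[of k] n_pos[of k] by simp
  have st: "stage (2 * n k) = k" using k lt by (intro stage_eq) auto
  have "g (2 * n k) w = q ^ (J - Suc k) * stage_bound k w (2 * real ?m - real (2 * n k))"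
    using n_mono[of 0 k] n_mono[of "Suc k" J] lt k by (simp add: g_def st)
  also have "\<dots> \<le> q ^ (J - Suc k) * q"
  proof (rule mult_left_mono)
    have band: "- C * sqrt (n k) \<le> w" "w \<le> 2 * U * sqrt (n k)"
      using assms by (auto simp: in_band_def)
    have "C * sqrt (n k) = sqrt (C\<^sup>2 * n k)" using C by (simp add: real_sqrt_mult)
    also have "\<dots> \<le> sqrt ?m" using growth(1)[of k] by simp
    finally have 1: "C * sqrt (n k) \<le> sqrt ?m" .
    have "2 * U * sqrt (n k) = sqrt (4 * U\<^sup>2 * n k)" using U by (simp add: real_sqrt_mult)
    also have "\<dots> \<le> sqrt ?m" using growth(2)[of k] by simp
    finally have 2: "2 * U * sqrt (n k) \<le> sqrt ?m" .
    show "stage_bound k w (2 * real ?m - real (2 * n k)) \<le> q"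
      unfolding stage_bound_def q_def A_def
      using band 1 2 C n_pos[of "Suc k"] growth(3)[of k] by (intro drop_bound_start) auto
  qed (use q_nonneg in auto)
  also have "\<dots> = q ^ (J - k)"
  proof -
    have "J - k = Suc (J - Suc k)" using k by simp
    then show ?thesis by simp
  qed
  finally show ?thesis .
qed

lemma g_step:
  assumes s: "\<bar>s\<bar> = 1"
  shows "(\<integral>\<^sup>+z. (if in_band (Suc c) (w + s * z) then ennreal (g (Suc c) (w + s * z)) else 0) \<partial>std_normal) \<le> ennreal (g c w)"
    (is "(\<integral>\<^sup>+z. ?f z \<partial>std_normal) \<le> _")
proof -
  consider "Suc c \<le> 2 * n 0" | "2 * n J \<le> c" | "2 * n 0 \<le> c" "c < 2 * n J" by linarith
  then show ?thesis
  proof cases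
    case 1
    have "?f z \<le> ennreal (q ^ J)" for z
    proof (cases "Suc c = 2 * n 0")
      case True
      then show ?thesis using g_start[of 0 "w + s * z"] by (auto intro: ennreal_leI)
    next
      case False
      then show ?thesis using 1 by (auto simp: g_def)
    qed
    then have "(\<integral>\<^sup>+z. ?f z \<partial>std_normal) \<le> (\<integral>\<^sup>+z. ennreal (q ^ J) \<partial>std_normal)"
      by (intro nn_integral_mono)
    also have "\<dots> = ennreal (g c w)" using 1 std_normal.emeasure_space_1 by (simp add: g_def)
    finally show ?thesis .
  next
    case 2
    then have "\<not> c < 2 * n 0" "\<not> Suc c < 2 * n 0" "2 * n J \<le> Suc c" using n_mono[of 0 J] by auto
    then have g: "g c w = 1" "g (Suc c) w' = 1" for w' using 2 by (auto simp: g_def)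
    have "(\<integral>\<^sup>+z. ?f z \<partial>std_normal) \<le> (\<integral>\<^sup>+z. 1 \<partial>std_normal)"
      by (intro nn_integral_mono) (auto simp: g)
    then show ?thesis using std_normal.emeasure_space_1 by (simp add: g)
  next
    case 3
    then obtain k where k: "k < J" "2 * n k \<le> c" "c < 2 * n (Suc k)" by (rule stage_exists)
    let ?m = "n (Suc k)"
    define r where "r = 2 * real ?m - real (Suc c)"
    have r: "0 \<le> r" "r + 1 = 2 * real ?m - real c" using k unfolding r_def by linarith+
    have "?f z \<le> ennreal (q ^ (J - Suc k)) * ennreal (stage_bound k (w + s * z) r)" for z
    proof (cases "in_band (Suc c) (w + s * z)")
      case True
      have sb: "0 \<le> stage_bound k (w + s * z) r"
        unfolding stage_bound_def using A_gt r by (intro drop_bound_nonneg)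
      have "g (Suc c) (w + s * z) \<le> q ^ (J - Suc k) * stage_bound k (w + s * z) r"
      proof (cases "Suc c < 2 * ?m")
        case True
        then have "stage (Suc c) = k" using k by (intro stage_eq) auto
        moreover have "Suc c < 2 * n J" using True n_mono[of "Suc k" J] k by simp
        ultimately show ?thesis using 3 by (simp add: g_def r_def)
      next
        case False
        \<comment> \<open>At the checkpoint the running stage has expired, and inside the band its
          bound is at least 1, so switching to the next stage does not increase the
          potential.\<close>
        then have c: "Suc c = 2 * ?m" using k by simp
        then have r0: "r = 0" by (simp add: r_def)
        have "g (Suc c) (w + s * z) \<le> q ^ (J - Suc k) * 1"
          using g_start[of "Suc k" "w + s * z"] True k unfolding c by simp
        also have "\<dots> \<le> q ^ (J - Suc k) * stage_bound k (w + s * z) r"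
        proof (rule mult_left_mono)
          have "- C * sqrt ?m \<le> w + s * z"
            using True k unfolding c in_band_def by auto
          then show "1 \<le> stage_bound k (w + s * z) r"
            unfolding stage_bound_def r0 using A_gt C by (intro drop_bound_end) auto
        qed (use q_nonneg in auto)
        finally show ?thesis .
      qed
      then show ?thesis
        using True sb q_nonneg by (simp add: ennreal_leI flip: ennreal_mult)
    qed simp
    then have "(\<integral>\<^sup>+z. ?f z \<partial>std_normal) \<le>
        (\<integral>\<^sup>+z. ennreal (q ^ (J - Suc k)) * ennreal (stage_bound k (w + s * z) r) \<partial>std_normal)"
      by (intro nn_integral_mono)
    also have "\<dots> = ennreal (q ^ (J - Suc k)) * ennreal (stage_bound k w (r + 1))"
    proof -
      have "(\<lambda>z. stage_bound k (w + s * z) r) \<in> borel_measurable borel"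
        unfolding stage_bound_def by (rule measurable_compose[OF _ measurable_drop_bound]) simp
      then have "(\<lambda>z. ennreal (stage_bound k (w + s * z) r)) \<in> borel_measurable std_normal"
        by simp
      then show ?thesis
        using nn_integral_drop_bound[OF A_gt r(1) s] by (simp add: nn_integral_cmult stage_bound_def)
    qed
    also have "\<dots> = ennreal (g c w)"
    proof -
      have "0 \<le> stage_bound k w (r + 1)"
        unfolding stage_bound_def using A_gt r by (intro drop_bound_nonneg) auto
      then show ?thesis
        using q_nonneg 3 stage_eq[OF k] by (simp add: g_def r(2) flip: ennreal_mult)
    qed
    finally show ?thesis .
  qed
qed

primrec in_bands :: "history \<Rightarrow> bool" where
  "in_bands [] = True"
| "in_bands (p # h) \<longleftrightarrow> in_bands h \<and> in_band (pair_clock x (p # h)) (signed_walk v x (p # h))"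

text \<open>The process killed on leaving the band, written as a function of the history so that
  \<open>ville\<close> applies.\<close>

definition potential :: "history \<Rightarrow> ennreal" where
  "potential h = (if in_bands h then ennreal (g (pair_clock x h) (signed_walk v x h)) else 0)"

lemma measurable_pair_clock [measurable]: "(\<lambda>\<omega>. pair_clock x (H \<omega> t)) \<in> noise \<rightarrow>\<^sub>M count_space UNIV"
  unfolding pair_clock_def by measurable

lemma measurable_signed_walk [measurable]: "(\<lambda>\<omega>. signed_walk v x (H \<omega> t)) \<in> borel_measurable noise"
  unfolding signed_walk_def by measurable

lemma measurable_in_bands [measurable]: "Measurable.pred noise (\<lambda>\<omega>. in_bands (H \<omega> t))"
proof (induction t)
  case (Suc t)
  have "in_bands (H \<omega> (Suc t)) \<longleftrightarrow> in_bands (H \<omega> t) \<and>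
      in_band (pair_clock x (H \<omega> (Suc t))) (signed_walk v x (H \<omega> (Suc t)))" for \<omega>
    by (simp add: hist_Suc)
  moreover have "Measurable.pred noise (\<lambda>\<omega>. in_band (pair_clock x (H \<omega> (Suc t))) (signed_walk v x (H \<omega> (Suc t))))"
    unfolding in_band_def by measurable
  ultimately show ?case using Suc by simp
qed simp

lemma measurable_potential: "(\<lambda>\<omega>. potential (H \<omega> t)) \<in> borel_measurable noise"
proof -
  have "(\<lambda>\<omega>. g c (signed_walk v x (H \<omega> t))) \<in> borel_measurable noise" for c
    unfolding g_def stage_bound_def by measurable
  then have [measurable]: "(\<lambda>\<omega>. g (pair_clock x (H \<omega> t)) (signed_walk v x (H \<omega> t))) \<in> borel_measurable noise"
    by (rule measurable_compose_countable) measurable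
  show ?thesis unfolding potential_def by measurable
qed

lemma potential_step: "(\<integral>\<^sup>+z. potential ((a, v a + z) # h) \<partial>std_normal) \<le> potential h"
proof (cases "in_bands h")
  case False
  then show ?thesis by (simp add: potential_def)
next
  case True
  show ?thesis
  proof (cases "a \<in> {x, x + 1}")
    case False
    then have "pair_clock x ((a, v a + z) # h) = pair_clock x h"
      "signed_walk v x ((a, v a + z) # h) = signed_walk v x h" for z
      by (auto simp: pair_clock_def signed_walk_def plays_Cons noise_sum_Cons)
    then have "potential ((a, v a + z) # h) \<le> potential h" for z
      by (simp add: potential_def)
    then have "(\<integral>\<^sup>+z. potential ((a, v a + z) # h) \<partial>std_normal) \<le> (\<integral>\<^sup>+z. potential h \<partial>std_normal)"
      by (intro nn_integral_mono)
    then show ?thesis using std_normal.emeasure_space_1 by simp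
  next
    case a: True
    define s where "s = sgn (v x - v (x + 1)) * (if a = x then 1 else - 1)"
    have s: "\<bar>s\<bar> = 1" using change by (auto simp: s_def sgn_if)
    have step: "pair_clock x ((a, v a + z) # h) = Suc (pair_clock x h)"
      "signed_walk v x ((a, v a + z) # h) = signed_walk v x h + s * z" for z
      using a by (auto simp: pair_clock_def signed_walk_def plays_Cons noise_sum_Cons s_def algebra_simps)
    show ?thesis
      using g_step[OF s, of "pair_clock x h" "signed_walk v x h"] True
      unfolding potential_def in_bands.simps step by simp
  qed
qed

lemma prob_in_bands:
  "measure noise {\<omega>. \<exists>s. 2 * n J \<le> pair_clock x (H \<omega> s) \<and> in_bands (H \<omega> s)} \<le> q ^ J"
proof -
  have "emeasure noise {\<omega>. \<exists>s. 2 * n J \<le> pair_clock x (H \<omega> s) \<and> in_bands (H \<omega> s)} \<le>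
      emeasure noise {\<omega>. \<exists>s. 1 \<le> potential (H \<omega> s)}"
  proof (rule emeasure_mono)
    have "g c w = 1" if "2 * n J \<le> c" for c w
      using that n_mono[of 0 J] by (simp add: g_def)
    then have "1 \<le> potential h" if "2 * n J \<le> pair_clock x h" "in_bands h" for h
      using that by (simp add: potential_def)
    then show "{\<omega>. \<exists>s. 2 * n J \<le> pair_clock x (H \<omega> s) \<and> in_bands (H \<omega> s)} \<subseteq> {\<omega>. \<exists>s. 1 \<le> potential (H \<omega> s)}"
      by blast
    note [measurable] = measurable_potential
    show "{\<omega>. \<exists>s. 1 \<le> potential (H \<omega> s)} \<in> sets noise" by (rule sets_noiseI) measurable
  qed
  also have "\<dots> \<le> potential []"
    by (rule ville[OF measurable_potential]) (rule potential_step)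
  also have "\<dots> = ennreal (q ^ J)" using n0 by (simp add: potential_def g_def pair_clock_def)
  finally show ?thesis using q_nonneg by (simp add: noise.emeasure_eq_measure)
qed

text \<open>With \<open>\<rho>\<close> equal to \<open>m\<close> the two denominators
  \<open>a\<close> and \<open>b\<close> sum to \<open>4 * m\<close>, and convexity bounds the
  squared difference by the two self-normalised squares. The logarithmic correction is at most
  \<open>ln 2\<close> by the arithmetic-geometric mean inequality.\<close>

lemma log_mix_pair:
  assumes "pair_clock x h = 2 * m" "0 < m" "2 * U * sqrt m < signed_walk v x h"
  shows "U\<^sup>2 / 2 - ln 2 \<le> log_mix v (real m) {x, x + 1} h"
proof -
  define S1 S2 where "S1 = noise_sum v h x" and "S2 = noise_sum v h (x + 1)"
  define T1 T2 where "T1 = real (plays h x)" and "T2 = real (plays h (x + 1))"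
  have T: "T1 + T2 = 2 * real m" "0 \<le> T1" "0 \<le> T2"
    using assms(1) unfolding pair_clock_def T1_def T2_def by linarith+
  have m: "0 < real m" using assms by simp
  have "signed_walk v x h \<le> \<bar>S1 - S2\<bar>"
    by (auto simp: signed_walk_def S1_def S2_def sgn_if)
  then have "2 * U * sqrt m < \<bar>S1 - S2\<bar>" using assms by simp
  then have "(2 * U * sqrt m)\<^sup>2 \<le> \<bar>S1 - S2\<bar>\<^sup>2" using U by (intro power_mono) auto
  then have S: "4 * U\<^sup>2 * m \<le> (S1 - S2)\<^sup>2" by (simp add: power_mult_distrib)
  define a b where "a = real m + T1" and "b = real m + T2"
  have ab: "0 < a" "0 < b" "a + b = 4 * real m" using T m unfolding a_def b_def by linarith+
  have "U\<^sup>2 / 2 \<le> (S1 - S2)\<^sup>2 / (2 * (a + b))" using S m ab by (simp add: field_simps)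
  also have "\<dots> \<le> S1\<^sup>2 / (2 * a) + S2\<^sup>2 / (2 * b)"
  proof -
    have "S1\<^sup>2 / (2 * a) + S2\<^sup>2 / (2 * b) - (S1 - S2)\<^sup>2 / (2 * (a + b)) = (S1 * b + S2 * a)\<^sup>2 / (2 * a * b * (a + b))"
    proof -
      have "a \<noteq> 0" "b \<noteq> 0" "a + b \<noteq> 0" using ab m by auto
      then show ?thesis by (simp add: power2_eq_square divide_simps) algebra
    qed
    moreover have "0 \<le> (S1 * b + S2 * a)\<^sup>2 / (2 * a * b * (a + b))" using ab by simp
    ultimately show ?thesis by linarith
  qed
  finally have 1: "U\<^sup>2 / 2 \<le> S1\<^sup>2 / (2 * a) + S2\<^sup>2 / (2 * b)" .
  have "ln (a / m) + ln (b / m) = ln (a / m * (b / m))" using ab m by (subst ln_mult) auto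
  also have "\<dots> \<le> ln (2 * 2)"
  proof -
    have "(a + b)\<^sup>2 - 4 * (a * b) = (a - b)\<^sup>2" by (simp add: power2_eq_square algebra_simps)
    then have "4 * (a * b) \<le> (4 * real m)\<^sup>2" using ab by (smt (verit) zero_le_power2)
    then have "a / m * (b / m) \<le> 2 * 2" using m by (simp add: power2_eq_square field_simps)
    then show ?thesis using ab m by (intro ln_mono) auto
  qed
  also have "\<dots> = 2 * ln (2::real)" by (subst ln_mult) auto
  finally have "ln (a / m) / 2 + ln (b / m) / 2 \<le> ln 2" by simp
  moreover have "log_mix v (real m) {x, x + 1} h =
      (S1\<^sup>2 / (2 * a) - ln (a / m) / 2) + (S2\<^sup>2 / (2 * b) - ln (b / m) / 2)"
    by (simp add: log_mix_def S1_def S2_def a_def b_def T1_def T2_def)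
  ultimately show ?thesis using 1 by linarith
qed

lemma prob_race_event:
  "measure noise (race_event C n J x) \<le> q ^ J + (J + 1) * (2 * exp (- U\<^sup>2 / 2))"
proof -
  define \<alpha> where "\<alpha> = 2 * exp (- U\<^sup>2 / 2)"
  have \<alpha>: "0 < \<alpha>" "ln (1 / \<alpha>) = U\<^sup>2 / 2 - ln 2"
    unfolding \<alpha>_def by (auto simp: ln_div ln_mult)
  let ?E = "\<lambda>k. {\<omega>. \<exists>t. ln (1 / \<alpha>) \<le> log_mix v (real (n k)) {x, x + 1} (H \<omega> t)}"
  let ?B = "{\<omega>. \<exists>s. 2 * n J \<le> pair_clock x (H \<omega> s) \<and> in_bands (H \<omega> s)}"
  have sets: "?E k \<in> sets noise" "?B \<in> sets noise" for k
    by (rule sets_noiseI, measurable)+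
  have "race_event C n J x \<subseteq> ?B \<union> (\<Union>k\<in>{..J}. ?E k)"
  proof
    fix \<omega> assume "\<omega> \<in> race_event C n J x"
    then obtain s where s: "2 * n J \<le> pair_clock x (H \<omega> s)"
      and low: "\<And>u k. u \<le> s \<Longrightarrow> k \<le> J \<Longrightarrow> pair_clock x (H \<omega> u) = 2 * n k \<Longrightarrow>
        - C * sqrt (n k) \<le> signed_walk v x (H \<omega> u)"
      unfolding race_event_def by auto
    show "\<omega> \<in> ?B \<union> (\<Union>k\<in>{..J}. ?E k)"
    proof (cases "\<exists>u k. k \<le> J \<and> pair_clock x (H \<omega> u) = 2 * n k \<and> 2 * U * sqrt (n k) < signed_walk v x (H \<omega> u)")
      case True
      then obtain u k where k: "k \<le> J" "pair_clock x (H \<omega> u) = 2 * n k" "2 * U * sqrt (n k) < signed_walk v x (H \<omega> u)"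
        by blast
      from log_mix_pair[OF k(2) n_pos k(3)] k(1) show ?thesis unfolding \<alpha>(2) by auto
    next
      case False
      have "in_bands (H \<omega> u)" if "u \<le> s" for u
        using that
      proof (induction u)
        case (Suc u)
        have "in_band (pair_clock x (H \<omega> (Suc u))) (signed_walk v x (H \<omega> (Suc u)))"
          unfolding in_band_def using low[OF Suc.prems] False by (metis not_le)
        then show ?case using Suc by (simp add: hist_Suc)
      qed simp
      then show ?thesis using s by auto
    qed
  qed
  then have "measure noise (race_event C n J x) \<le> measure noise (?B \<union> (\<Union>k\<in>{..J}. ?E k))"
    using sets by (intro noise.finite_measure_mono sets.Un sets.finite_UN) auto
  also have "\<dots> \<le> measure noise ?B + measure noise (\<Union>k\<in>{..J}. ?E k)"
    using sets by (intro measure_Un_le sets.finite_UN) auto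
  also have "measure noise (\<Union>k\<in>{..J}. ?E k) \<le> (\<Sum>k\<in>{..J}. measure noise (?E k))"
    using sets by (intro noise.finite_measure_subadditive_finite) auto
  also have "\<dots> \<le> (\<Sum>k\<in>{..J}. \<alpha>)"
    using \<alpha> n_pos by (intro sum_mono prob_log_mix) auto
  finally show ?thesis using prob_in_bands by (simp add: \<alpha>_def)
qed

end

text \<open>The order of choices: \<open>J\<close> checkpoints to make \<open>q ^ J\<close> small,
  then \<open>U\<close> for the union over them, then the ratio \<open>R\<close>. All are
  independent of policy, environment and \<open>b\<close>, so they can be fixed before
  \<open>\<delta>\<close> and \<open>t\<close>.\<close>

lemma race_parameters:
  fixes C e :: real
  assumes C: "1 \<le> C" and e: "0 < e"
  shows "\<exists>J R :: nat. 1 \<le> R \<and> (\<forall>K \<pi> v x b. is_policy K \<pi> \<longrightarrow> v x \<noteq> v (x + 1) \<longrightarrow> 0 < b \<longrightarrow>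
    measure noise (bandit.race_event \<pi> v C (\<lambda>k. R ^ k * b) J x) \<le> e)"
proof -
  define q where "q = 1 - 4 / (drop_const C - 1)\<^sup>2"
  have dc: "3 \<le> drop_const C" using C by (intro drop_const_ge) auto
  have "2\<^sup>2 \<le> (drop_const C - 1)\<^sup>2" using dc by (intro power_mono) auto
  then have q: "0 \<le> q" "q < 1" using dc by (auto simp: q_def)
  have "(\<lambda>J. q ^ J) \<longlonglongrightarrow> 0" using q by (intro LIMSEQ_power_zero) auto
  then have "\<forall>\<^sub>F J in sequentially. q ^ J < e / 2" using e by (intro order_tendstoD) auto
  then obtain J where J_bound: "q ^ J < e / 2" by (auto simp: eventually_sequentially)
  have "((\<lambda>U. real (J + 1) * (2 * exp (- U\<^sup>2 / 2))) \<longlongrightarrow> 0) at_top" by real_asymp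
  then have "\<forall>\<^sub>F U in at_top. real (J + 1) * (2 * exp (- U\<^sup>2 / 2)) < e / 2"
    using e by (intro order_tendstoD) auto
  then have "\<forall>\<^sub>F U in at_top. real (J + 1) * (2 * exp (- U\<^sup>2 / 2)) < e / 2 \<and> 0 < U"
    by (intro eventually_conj eventually_gt_at_top)
  then obtain U where U_bound: "real (J + 1) * (2 * exp (- U\<^sup>2 / 2)) < e / 2" "0 < U"
    by (auto dest: eventually_happens)
  define R where "R = nat \<lceil>max (max (C\<^sup>2) (4 * U\<^sup>2)) 2\<rceil>"
  have "max (max (C\<^sup>2) (4 * U\<^sup>2)) 2 \<le> real R" unfolding R_def by (rule real_nat_ceiling_ge)
  then have R: "C\<^sup>2 \<le> real R" "4 * U\<^sup>2 \<le> real R" "2 \<le> real R" by auto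
  show ?thesis
  proof (rule exI[of _ J], rule exI[of _ R], intro conjI allI impI)
    show "1 \<le> R" using R(3) by simp
    fix K \<pi> and v :: env and x b :: nat
    assume "is_policy K \<pi>" "v x \<noteq> v (x + 1)" "0 < b"
    then interpret race_bound K \<pi> v x C U "\<lambda>k. R ^ k * b" J
      using C U_bound R by unfold_locales (auto intro!: mult_right_mono simp: mult.assoc[symmetric])
    have "measure noise (race_event C (\<lambda>k. R ^ k * b) J x) \<le> local.q ^ J + (J + 1) * (2 * exp (- U\<^sup>2 / 2))"
      by (rule prob_race_event)
    also have "local.q = 1 - 4 / (drop_const C - 1)\<^sup>2" by (simp add: q_def A_def)
    finally show "measure noise (race_event C (\<lambda>k. R ^ k * b) J x) \<le> e"
      using J_bound U_bound(1) unfolding \<open>q = 1 - 4 / (drop_const C - 1)\<^sup>2\<close> by linarith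
  qed
qed

section \<open>Uniform deviations of the empirical means\<close>

context bandit
begin

definition deviation :: "real \<Rightarrow> nat \<Rightarrow> (nat \<Rightarrow> real) set" where
  "deviation \<eta> n = {\<omega>. \<exists>s. \<exists>a\<in>{1..K}. n \<le> plays (H \<omega> s) a \<and> \<eta> * plays (H \<omega> s) a < \<bar>noise_sum v (H \<omega> s) a\<bar>}"

lemma sets_deviation: "deviation \<eta> n \<in> sets noise"
proof -
  have "Measurable.pred noise (\<lambda>\<omega>. \<exists>s. \<exists>a\<in>{1..K}. n \<le> plays (H \<omega> s) a \<and> \<eta> * plays (H \<omega> s) a < \<bar>noise_sum v (H \<omega> s) a\<bar>)"
    by measurable
  then show ?thesis unfolding deviation_def by (rule sets_noiseI)
qed

lemma sets_race_event: "race_event C n J x \<in> sets noise"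
proof -
  have [measurable]: "(\<lambda>\<omega>. pair_clock x (H \<omega> t)) \<in> noise \<rightarrow>\<^sub>M count_space UNIV" for t
    unfolding pair_clock_def by measurable
  have [measurable]: "(\<lambda>\<omega>. signed_walk v x (H \<omega> t)) \<in> borel_measurable noise" for t
    unfolding signed_walk_def by measurable
  show ?thesis unfolding race_event_def by (rule sets_noiseI) measurable
qed

lemma prob_deviation_aux:
  fixes \<rho> \<alpha> \<eta> :: real
  assumes \<rho>: "0 < \<rho>" and \<alpha>: "0 < \<alpha>" and \<eta>: "0 \<le> \<eta>"
    and bound: "\<And>T. n \<le> T \<Longrightarrow> ln (1 / \<alpha>) \<le> (\<eta> * real T)\<^sup>2 / (2 * (\<rho> + real T)) - ln ((\<rho> + real T) / \<rho>) / 2"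
  shows "measure noise (deviation \<eta> n) \<le> K * \<alpha>"
proof -
  let ?E = "\<lambda>a. {\<omega>. \<exists>t. ln (1 / \<alpha>) \<le> log_mix v \<rho> {a} (H \<omega> t)}"
  have sets: "?E a \<in> sets noise" for a by (rule sets_noiseI) measurable
  have "deviation \<eta> n \<subseteq> (\<Union>a\<in>{1..K}. ?E a)"
  proof
    fix \<omega> assume "\<omega> \<in> deviation \<eta> n"
    then obtain s a where a: "a \<in> {1..K}" "n \<le> plays (H \<omega> s) a" "\<eta> * plays (H \<omega> s) a < \<bar>noise_sum v (H \<omega> s) a\<bar>"
      by (auto simp: deviation_def)
    have "(\<eta> * plays (H \<omega> s) a)\<^sup>2 \<le> \<bar>noise_sum v (H \<omega> s) a\<bar>\<^sup>2"
      using a \<eta> by (intro power_mono) auto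
    then have "(\<eta> * plays (H \<omega> s) a)\<^sup>2 / (2 * (\<rho> + plays (H \<omega> s) a)) \<le> (noise_sum v (H \<omega> s) a)\<^sup>2 / (2 * (\<rho> + plays (H \<omega> s) a))"
      using \<rho> by (intro divide_right_mono) auto
    then have "ln (1 / \<alpha>) \<le> log_mix v \<rho> {a} (H \<omega> s)"
      using bound[OF a(2)] by (simp add: log_mix_def)
    then show "\<omega> \<in> (\<Union>a\<in>{1..K}. ?E a)" using a(1) by auto
  qed
  then have "measure noise (deviation \<eta> n) \<le> measure noise (\<Union>a\<in>{1..K}. ?E a)"
    using sets by (intro noise.finite_measure_mono sets.finite_UN) auto
  also have "\<dots> \<le> (\<Sum>a\<in>{1..K}. measure noise (?E a))"
    using sets by (intro noise.finite_measure_subadditive_finite) auto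
  also have "\<dots> \<le> (\<Sum>a\<in>{1..K}. \<alpha>)"
    using \<alpha> \<rho> by (intro sum_mono prob_log_mix) auto
  finally show ?thesis by simp
qed

text \<open>Mixture with \<open>\<rho> = 1\<close> at level
  \<open>exp (- \<eta>\<^sup>2 * n / 8)\<close>. The lower bound on \<open>n\<close> is what makes
  the logarithmic correction, at most \<open>sqrt T\<close>, no larger than
  \<open>\<eta>\<^sup>2 * T / 8\<close>.\<close>

lemma prob_deviation:
  assumes \<eta>: "0 < \<eta>" and n: "64 / \<eta> ^ 4 \<le> n"
  shows "measure noise (deviation \<eta> n) \<le> K * exp (- \<eta>\<^sup>2 * n / 8)"
proof (rule prob_deviation_aux[of 1])
  fix T assume T: "n \<le> T"
  have npos: "0 < real n" using n \<eta> by (smt (verit) divide_pos_pos zero_less_power)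
  then have T1: "1 \<le> real T" using T by simp
  define s where "s = sqrt T"
  have s: "s\<^sup>2 = T" "1 \<le> s" using T1 by (auto simp: s_def)
  have "8 / \<eta>\<^sup>2 \<le> s"
  proof (rule power2_le_imp_le)
    have "(8 / \<eta>\<^sup>2)\<^sup>2 = 64 / \<eta> ^ 4" by (simp add: power_divide flip: power_mult)
    then show "(8 / \<eta>\<^sup>2)\<^sup>2 \<le> s\<^sup>2" using n T s by simp
  qed (use s in auto)
  then have s8: "s \<le> \<eta>\<^sup>2 * T / 8"
    using \<eta> s mult_right_mono[of "8 / \<eta>\<^sup>2" s s] by (simp add: field_simps power2_eq_square)
  have "ln (1 + real T) \<le> ln ((1 + s)\<^sup>2)"
    using s by (intro ln_mono) (auto simp: power2_eq_square algebra_simps)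
  also have "\<dots> = 2 * ln (1 + s)" using s by (simp add: ln_realpow)
  also have "\<dots> \<le> 2 * s" using ln_add_one_self_le_self[of s] s by simp
  finally have l: "ln (1 + real T) / 2 \<le> s" by simp
  have "\<eta>\<^sup>2 * T / 4 \<le> (\<eta> * real T)\<^sup>2 / (2 * (1 + real T))"
  proof -
    have "\<eta>\<^sup>2 * T * (1 + T) \<le> \<eta>\<^sup>2 * T * (2 * T)" using T1 by (intro mult_left_mono) auto
    then show ?thesis using T1 by (simp add: field_simps power2_eq_square)
  qed
  moreover have "\<eta>\<^sup>2 * n \<le> \<eta>\<^sup>2 * T" using T by (intro mult_left_mono) auto
  moreover have "ln (1 / exp (- \<eta>\<^sup>2 * n / 8)) = \<eta>\<^sup>2 * n / 8" by (simp add: ln_div)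
  ultimately show "ln (1 / exp (- \<eta>\<^sup>2 * n / 8)) \<le> (\<eta> * real T)\<^sup>2 / (2 * (1 + real T)) - ln ((1 + real T) / 1) / 2"
    using s8 l unfolding div_by_1 by linarith
qed (use \<eta> in auto)

text \<open>Taking \<open>\<rho> = M\<close> makes the estimate depend on \<open>T / M\<close>
  alone, so the probability is small for large \<open>C\<close> uniformly in
  \<open>M\<close>.\<close>

lemma prob_deviation_scaled:
  assumes C: "8 \<le> C\<^sup>2" "0 \<le> C" and M: "0 < M"
  shows "measure noise (deviation (C / (2 * sqrt M)) M) \<le> K * exp (1 / 2 - C\<^sup>2 / 16)"
proof (rule prob_deviation_aux[of "real M"])
  fix T assume T: "M \<le> T"
  define u where "u = real T / real M"
  have u: "1 \<le> u" using T M by (simp add: u_def)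
  have Tu: "real T = u * M" using M by (simp add: u_def)
  have "(C / (2 * sqrt M) * real T)\<^sup>2 / (2 * (real M + real T)) = C\<^sup>2 / 8 * (u\<^sup>2 / (1 + u))"
  proof -
    have "(C / (2 * sqrt M) * real T)\<^sup>2 = C\<^sup>2 / 4 * u\<^sup>2 * M"
      unfolding Tu using M by (simp add: power_mult_distrib power_divide) (simp add: power2_eq_square)
    moreover have "2 * (real M + real T) = 2 * (1 + u) * M" unfolding Tu by (simp add: algebra_simps)
    ultimately have "(C / (2 * sqrt M) * real T)\<^sup>2 / (2 * (real M + real T)) = (C\<^sup>2 / 4 * u\<^sup>2 * M) / (2 * (1 + u) * M)"
      by (simp only:)
    also have "\<dots> = C\<^sup>2 / 4 * u\<^sup>2 / (2 * (1 + u))" using M by simp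
    finally show ?thesis by simp
  qed
  also have "C\<^sup>2 / 8 * (u / 2) \<le> \<dots>"
  proof (rule mult_left_mono)
    have "u * 1 \<le> u * u" using u by (intro mult_left_mono) auto
    then show "u / 2 \<le> u\<^sup>2 / (1 + u)" using u by (simp add: field_simps power2_eq_square)
  qed auto
  finally have 1: "C\<^sup>2 / 16 * u \<le> (C / (2 * sqrt M) * real T)\<^sup>2 / (2 * (real M + real T))" by simp
  have "(real M + real T) / real M = 1 + u" using M by (simp add: u_def field_simps)
  then have 2: "ln ((real M + real T) / real M) \<le> u" using ln_add_one_self_le_self[of u] u by simp
  have "(C\<^sup>2 / 16 - 1 / 2) * 1 \<le> (C\<^sup>2 / 16 - 1 / 2) * u" using C u by (intro mult_left_mono) auto
  then have "C\<^sup>2 / 16 - 1 / 2 \<le> C\<^sup>2 / 16 * u - u / 2" by (simp add: algebra_simps)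
  moreover have "ln (1 / exp (1 / 2 - C\<^sup>2 / 16)) = C\<^sup>2 / 16 - 1 / 2" by (simp add: ln_div)
  ultimately show "ln (1 / exp (1 / 2 - C\<^sup>2 / 16)) \<le> (C / (2 * sqrt M) * real T)\<^sup>2 / (2 * (real M + real T))
      - ln ((real M + real T) / real M) / 2"
    using 1 2 by linarith
qed (use C M in auto)

end

section \<open>Asymptotics\<close>

text \<open>\<open>ln t\<close> and the iterated logarithm are absorbed into arbitrarily small
  linear terms; the constant \<open>c\<close> depends on neither \<open>\<delta>\<close> nor
  \<open>t\<close>.\<close>

lemma threshold_upper:
  fixes K N :: nat and e :: real
  assumes "1 \<le> N" "N < K" "0 < e"
  obtains c where "0 \<le> c" "\<And>\<delta> t. 0 < \<delta> \<Longrightarrow> \<delta> < 1 \<Longrightarrow> 1 \<le> t \<Longrightarrow>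
    threshold K t (\<delta> / real N) \<le> (1 + e) * ln (1 / \<delta>) + e * real t + c"
proof -
  define c1 where "c1 = ln gamma_const + ln (real N) + ln (real K - 1)"
  have K: "1 < K" using assms by simp
  have "15 \<le> ln gamma_const"
    using gamma_const_ge by (metis exp_gt_zero ln_exp ln_mono)
  moreover have "0 \<le> ln (real N)" "0 \<le> ln (real K - 1)" using assms by auto
  ultimately have c1: "15 \<le> c1" unfolding c1_def by linarith
  have ln_lin: "ln y \<le> a * y + (- ln a)" if "0 < a" "0 < y" for a y :: real
  proof -
    have "ln (a * y) \<le> a * y - 1" using that by (intro ln_le_minus_one) auto
    then show ?thesis using that by (simp add: ln_mult)
  qed
  define a where "a = e / (1 + e)"
  have a: "0 < a" using assms by (simp add: a_def)
  define c2 where "c2 = 8 * (- ln (e / 8))"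
  define c where "c = \<bar>c2 + (1 + e) * (c1 + (- ln a))\<bar>"
  show thesis
  proof (rule that)
    show "0 \<le> c" by (simp add: c_def)
    fix \<delta> :: real and t :: nat
    assume \<delta>: "0 < \<delta>" "\<delta> < 1" and t: "1 \<le> t"
    define y where "y = ln (real t) + c1 + ln (1 / \<delta>)"
    have "0 \<le> ln (1 / \<delta>)" "0 \<le> ln (real t)" using \<delta> t by auto
    then have y: "0 < y" using c1 unfolding y_def by linarith
    have "ln ((real K - 1) / \<delta>) = ln (real K - 1) + ln (1 / \<delta>)"
      using K \<delta> by (simp add: ln_div)
    then have "threshold K t (\<delta> / real N) = y + 8 * ln y"
      unfolding threshold_def threshold_arg[OF assms(1) K \<delta>(1) t] by (simp add: y_def c1_def add_ac)
    also have "\<dots> \<le> y + (e * y + c2)"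
      using ln_lin[of "e / 8" y] y assms by (simp add: c2_def)
    also have "\<dots> = (1 + e) * ln (1 / \<delta>) + (1 + e) * ln (real t) + (1 + e) * c1 + c2"
      by (simp add: y_def algebra_simps)
    also have "(1 + e) * ln (real t) \<le> (1 + e) * (a * real t + (- ln a))"
      using ln_lin[of a "real t"] a t assms by (intro mult_left_mono) auto
    also have "\<dots> = e * real t + (1 + e) * (- ln a)"
    proof -
      have "(1 + e) * a = e" using assms by (simp add: a_def)
      then show ?thesis by (simp only: distrib_left mult.assoc[symmetric])
    qed
    finally show "threshold K t (\<delta> / real N) \<le> (1 + e) * ln (1 / \<delta>) + e * real t + c"
      unfolding c_def by (simp add: algebra_simps)
  qed
qed

lemma radius_small:
  assumes "0 < r"
  shows "\<forall>\<^sub>F s in sequentially. radius K s < ereal r"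
proof -
  have "((\<lambda>s. sqrt ((4 * ln (real s) + 2 * ln (2 * ln (real s)) + 1 / 2) / (root 4 (real s) - real K))) \<longlongrightarrow> 0) sequentially"
    by real_asymp
  then have "\<forall>\<^sub>F s in sequentially. sqrt ((4 * ln (real s) + 2 * ln (2 * ln (real s)) + 1 / 2) / (root 4 (real s) - real K)) < r"
    using assms by (intro order_tendstoD) auto
  moreover have "\<forall>\<^sub>F s in sequentially. real K < root 4 (real s)"
    by real_asymp
  ultimately show ?thesis
    by eventually_elim (simp add: radius_def Let_def max_def)
qed

text \<open>The deviation event is used with about \<open>t\<^sup>1\<^sup>/\<^sup>4\<close> plays of each arm, which forced
  exploration guarantees from round \<open>start K t\<close> on.\<close>

definition quota :: "nat \<Rightarrow> nat" where
  "quota t = nat \<lfloor>root 4 (real t)\<rfloor>"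

definition start :: "nat \<Rightarrow> nat \<Rightarrow> nat" where
  "start K t = (quota t)\<^sup>2 + 1 + K + K * (quota t + 1)"

text \<open>The value of \<open>b\<close> in \<open>good_run\<close>: at least
  \<open>start K t\<close> and \<open>sqrt t\<close>, and still of order
  \<open>sqrt t\<close>.\<close>

definition base :: "nat \<Rightarrow> nat \<Rightarrow> nat" where
  "base K t = start K t + nat \<lceil>sqrt (real t)\<rceil>"

lemma quota_gt: "root 4 (real t) < real (quota t + 1)"
  unfolding quota_def by (simp add: add.commute) linarith

lemma quota_le: "real (quota t) \<le> root 4 (real t)"
  unfolding quota_def by simp

lemma base_le: "real (base K t) \<le> 2 * sqrt (real t) + 2 + 2 * real K + real K * root 4 (real t)"
proof -
  have "(real (quota t))\<^sup>2 \<le> (root 4 (real t))\<^sup>2" using quota_le by (intro power_mono) auto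
  also have "\<dots> = sqrt (real t)"
  proof -
    have "((root 4 (real t))\<^sup>2)\<^sup>2 = real t" by (simp flip: power_mult)
    then show ?thesis by (intro real_sqrt_unique[symmetric]) auto
  qed
  finally have "(real (quota t))\<^sup>2 \<le> sqrt (real t)" .
  moreover have "real K * real (quota t) \<le> real K * root 4 (real t)" using quota_le by (intro mult_left_mono) auto
  moreover have "real (nat \<lceil>sqrt (real t)\<rceil>) \<le> sqrt (real t) + 1" by simp
  ultimately show ?thesis unfolding base_def start_def by (simp add: algebra_simps)
qed

lemma base_small:
  fixes e a :: real
  assumes "0 < e"
  shows "\<forall>\<^sub>F t in sequentially. a * (real (base K t) + 1) \<le> e * real t"
proof -
  have "((\<lambda>t. \<bar>a\<bar> * (2 * sqrt (real t) + 3 + 2 * real K + real K * root 4 (real t)) / real t) \<longlongrightarrow> 0) sequentially"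
    by real_asymp
  then have "\<forall>\<^sub>F t in sequentially. \<bar>a\<bar> * (2 * sqrt (real t) + 3 + 2 * real K + real K * root 4 (real t)) / real t < e"
    using assms by (intro order_tendstoD) auto
  moreover have "\<forall>\<^sub>F t in sequentially. 0 < t" by (rule eventually_gt_at_top)
  ultimately show ?thesis
  proof eventually_elim
    case (elim t)
    have "a * (real (base K t) + 1) \<le> \<bar>a\<bar> * (real (base K t) + 1)" by (intro mult_right_mono) auto
    also have "\<dots> \<le> \<bar>a\<bar> * (2 * sqrt (real t) + 3 + 2 * real K + real K * root 4 (real t))"
      using base_le[of K t] by (intro mult_left_mono) auto
    also have "\<dots> \<le> e * real t" using elim by (simp add: pos_divide_less_eq)
    finally show ?case .
  qed
qed

lemma start_at_top: "filterlim (start K) at_top sequentially"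
proof -
  have "filterlim (\<lambda>t. root 4 (real t)) at_top sequentially" by real_asymp
  moreover have "\<forall>\<^sub>F t in sequentially. root 4 (real t) \<le> real (start K t)"
  proof (rule always_eventually, rule allI)
    fix t
    have "real (quota t) \<le> (real (quota t))\<^sup>2" by (cases "quota t") (auto simp: power2_eq_square)
    moreover have "real (start K t) = (real (quota t))\<^sup>2 + 1 + real K + real K * real (quota t + 1)"
      by (simp add: start_def algebra_simps)
    moreover have "0 \<le> real K * real (quota t + 1)" by simp
    moreover have "real (quota t + 1) = real (quota t) + 1" by simp
    ultimately show "root 4 (real t) \<le> real (start K t)" using quota_gt[of t] by linarith
  qed
  ultimately have "filterlim (\<lambda>t. real (start K t)) at_top sequentially"
    by (rule filterlim_at_top_mono)
  then show ?thesis by (simp add: filterlim_sequentially_iff_filterlim_real)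
qed

text \<open>A stretched exponential in \<open>t\<close> to the power \<open>1 / 4\<close>, which
  decays faster than \<open>1 / t\<^sup>2\<close>.\<close>

lemma summable_deviation:
  fixes \<eta> :: real
  assumes "0 < \<eta>"
  shows "summable (\<lambda>t. real K * exp (- \<eta>\<^sup>2 * real (quota t + 1) / 8))"
proof (rule summable_comparison_test)
  define k where "k = \<eta>\<^sup>2 / 8"
  have k: "0 < k" using assms by (simp add: k_def)
  have "(\<lambda>t. real K * exp (- k * root 4 (real t))) \<in> O(\<lambda>t. 1 / real t ^ 2)"
    using k by real_asymp
  then show "summable (\<lambda>t. real K * exp (- k * root 4 (real t)))"
    by (rule summable_comparison_test_bigo[rotated]) (use inverse_power_summable[of 2, where ?'a = real] in \<open>simp add: field_simps\<close>)
  show "\<exists>N. \<forall>t\<ge>N. norm (real K * exp (- \<eta>\<^sup>2 * real (quota t + 1) / 8)) \<le> real K * exp (- k * root 4 (real t))"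
  proof (intro exI allI impI)
    fix t
    have "k * root 4 (real t) \<le> k * real (quota t + 1)"
      using quota_gt[of t] k by (intro mult_left_mono) auto
    then show "norm (real K * exp (- \<eta>\<^sup>2 * real (quota t + 1) / 8)) \<le> real K * exp (- k * root 4 (real t))"
      by (auto simp: k_def intro!: mult_left_mono)
  qed
qed

section \<open>Ordered magnitudes\<close>

lemma finite_change_points [simp]: "finite (change_points K v)"
  by (simp add: change_points_def)

text \<open>\<open>env_class\<close> separates neighbours in the sorted list; if
  \<open>x + 1\<close> were a change point too, the successor of \<open>x\<close> in the list would
  be at most \<open>x + 1\<close>.\<close>

lemma change_points_separated:
  assumes "v \<in> env_class K m" "x \<in> change_points K v"
  shows "x + 1 \<notin> change_points K v"
proof
  let ?l = "sorted_list_of_set (change_points K v)"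
  assume x1: "x + 1 \<in> change_points K v"
  have set: "set ?l = change_points K v" by simp
  obtain j where j: "j < length ?l" "?l ! j = x + 1" using x1 set by (metis in_set_conv_nth)
  obtain i where i: "i < length ?l" "?l ! i = x" using assms(2) set by (metis in_set_conv_nth)
  have m: "card (change_points K v) = m" using assms by (simp add: env_class_def)
  have sorted: "sorted ?l" by simp
  have "i < j"
  proof (rule ccontr)
    assume "\<not> i < j"
    then have "?l ! j \<le> ?l ! i" using i by (intro sorted_nth_mono[OF sorted]) auto
    then show False using i j by simp
  qed
  then have "?l ! (i + 1) \<le> ?l ! j" using j by (intro sorted_nth_mono[OF sorted]) auto
  moreover have "i + 1 \<in> {1..<m}" using \<open>i < j\<close> j m by auto
  then have "change_point K v (i + 1) + 1 < change_point K v (i + 1 + 1)"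
    using assms(1) unfolding env_class_def by blast
  then have "x + 1 < ?l ! (i + 1)" using i by (simp add: change_point_def)
  ultimately show False using j by simp
qed

definition magnitudes :: "nat \<Rightarrow> env \<Rightarrow> real list" where
  "magnitudes K v = rev (sort (map (magnitude K v) [1..<card (change_points K v) + 1]))"

lemma ordered_magnitude_eq: "ordered_magnitude K v i = magnitudes K v ! (i - 1)"
  by (simp add: ordered_magnitude_def magnitudes_def)

lemma length_magnitudes [simp]: "length (magnitudes K v) = card (change_points K v)"
  by (simp add: magnitudes_def del: upt_Suc)

lemma mset_magnitudes: "mset (magnitudes K v) = image_mset (chg v) (mset_set (change_points K v))"
proof -
  have "map (magnitude K v) [1..<card (change_points K v) + 1] = map (chg v) (sorted_list_of_set (change_points K v))"
    by (rule nth_equalityI) (auto simp: magnitude_def change_point_def chg_def simp del: upt_Suc)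
  moreover have "mset (sorted_list_of_set (change_points K v)) = mset_set (change_points K v)"
    using mset_set_set[of "sorted_list_of_set (change_points K v)"] by simp
  ultimately show ?thesis by (simp add: magnitudes_def del: upt_Suc)
qed

lemma sum_magnitudes:
  fixes G :: "real \<Rightarrow> real"
  shows "(\<Sum>i<card (change_points K v). G (magnitudes K v ! i)) = (\<Sum>x\<in>change_points K v. G (chg v x))"
proof -
  have "(\<Sum>i<card (change_points K v). G (magnitudes K v ! i)) = sum_list (map G (magnitudes K v))"
    by (simp add: sum_list_sum_nth atLeast0LessThan)
  also have "\<dots> = sum_mset (image_mset G (mset (magnitudes K v)))"
    by (simp flip: sum_mset_sum_list)
  also have "\<dots> = (\<Sum>x\<in>change_points K v. G (chg v x))"
    by (simp add: mset_magnitudes sum_unfold_sum_mset multiset.map_comp comp_def)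
  finally show ?thesis .
qed

lemma magnitudes_antimono:
  assumes "i \<le> j" "j < card (change_points K v)"
  shows "magnitudes K v ! j \<le> magnitudes K v ! i"
proof -
  let ?s = "sort (map (magnitude K v) [1..<card (change_points K v) + 1])"
  have "?s ! (length ?s - Suc j) \<le> ?s ! (length ?s - Suc i)"
    using assms by (intro sorted_nth_mono) auto
  then show ?thesis using assms by (simp add: magnitudes_def rev_nth del: upt_Suc)
qed

text \<open>Passes from the sorted list to positions in the presence of ties: all magnitudes above
  \<open>D\<close> are among the first \<open>N\<close>, and the remaining ones of these
  \<open>N\<close> equal \<open>D\<close>.\<close>

lemma magnitude_threshold:
  fixes f :: "real \<Rightarrow> real"
  assumes N: "1 \<le> N" "N \<le> card (change_points K v)"
  defines "D \<equiv> magnitudes K v ! (N - 1)"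
  shows "0 < D"
    and "N \<le> card {x \<in> {1..K - 1}. D \<le> chg v x}"
    and "(\<Sum>i=1..N. f (ordered_magnitude K v i)) =
      (\<Sum>x\<in>{x \<in> {1..K - 1}. D < chg v x}. f (chg v x)) + real (N - card {x \<in> {1..K - 1}. D < chg v x}) * f D"
proof -
  let ?m = "card (change_points K v)"
  let ?xs = "magnitudes K v"
  have "D \<in> set ?xs" unfolding D_def using N by (intro nth_mem) auto
  then have "D \<in> chg v ` change_points K v"
    using mset_magnitudes[of K v] by (metis finite_change_points finite_set_mset_mset_set set_image_mset set_mset_mset)
  then show D: "0 < D" by (auto simp: change_points_def chg_def)
  \<comment> \<open>Since \<open>D > 0\<close>, a magnitude of at least \<open>D\<close> already
    implies a change.\<close>
  have big: "{x \<in> {1..K - 1}. P (chg v x)} = {x \<in> change_points K v. P (chg v x)}" if "\<And>y. P y \<Longrightarrow> D \<le> y" for P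
    using that D by (force simp: change_points_def chg_def)
  have count: "(\<Sum>i<?m. G (?xs ! i) * of_bool (P (?xs ! i))) = (\<Sum>x\<in>{x \<in> {1..K - 1}. P (chg v x)}. G (chg v x))"
    if "\<And>y. P y \<Longrightarrow> D \<le> y" for P and G :: "real \<Rightarrow> real"
  proof -
    have "(\<Sum>i<?m. G (?xs ! i) * of_bool (P (?xs ! i))) = (\<Sum>x\<in>change_points K v. G (chg v x) * of_bool (P (chg v x)))"
      by (rule sum_magnitudes[of "\<lambda>y. G y * of_bool (P y)"])
    also have "\<dots> = (\<Sum>x\<in>{x \<in> change_points K v. P (chg v x)}. G (chg v x))"
      by (rule sum.mono_neutral_cong_right) auto
    finally show ?thesis using big[OF that] by simp
  qed
  have above: "D \<le> ?xs ! i" if "i < N" for i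
    unfolding D_def using that N by (intro magnitudes_antimono) auto
  have below: "?xs ! i \<le> D" if "N - 1 \<le> i" "i < ?m" for i
    unfolding D_def using that N by (intro magnitudes_antimono) auto
  have "real N = (\<Sum>i<N. 1)" by simp
  also have "\<dots> = (\<Sum>i<N. 1 * of_bool (D \<le> ?xs ! i))" using above by (intro sum.cong) auto
  also have "\<dots> \<le> (\<Sum>i<?m. 1 * of_bool (D \<le> ?xs ! i))"
    using N by (intro sum_mono2) auto
  also have "\<dots> = real (card {x \<in> {1..K - 1}. D \<le> chg v x})" by (subst count) auto
  finally show "N \<le> card {x \<in> {1..K - 1}. D \<le> chg v x}" by simp
  let ?S = "{x \<in> {1..K - 1}. D < chg v x}"
  have top: "(\<Sum>i<N. G (?xs ! i) * of_bool (D < ?xs ! i)) = (\<Sum>x\<in>?S. G (chg v x))" for G :: "real \<Rightarrow> real"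
  proof -
    have "(\<Sum>i<N. G (?xs ! i) * of_bool (D < ?xs ! i)) = (\<Sum>i<?m. G (?xs ! i) * of_bool (D < ?xs ! i))"
      using N below by (intro sum.mono_neutral_left) (auto simp: not_less)
    also have "\<dots> = (\<Sum>x\<in>?S. G (chg v x))" by (rule count) auto
    finally show ?thesis .
  qed
  have "real (card ?S) = (\<Sum>i<N. 1 * of_bool (D < ?xs ! i))" by (subst top) simp
  then have rest: "(\<Sum>i<N. 1 - of_bool (D < ?xs ! i)) = real N - real (card ?S)" by (simp add: sum_subtractf)
  have "0 \<le> (\<Sum>i<N. 1 - of_bool (D < ?xs ! i) :: real)" by (intro sum_nonneg) auto
  then have le: "card ?S \<le> N" using rest by simp
  have "(\<Sum>i=1..N. f (ordered_magnitude K v i)) = (\<Sum>i<N. f (?xs ! i))"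
    by (rule sum.reindex_bij_witness[of _ Suc "\<lambda>i. i - 1"]) (auto simp: ordered_magnitude_eq)
  also have "\<dots> = (\<Sum>i<N. f (?xs ! i) * of_bool (D < ?xs ! i) + (1 - of_bool (D < ?xs ! i)) * f D)"
    using above by (intro sum.cong) (auto simp: le_less)
  also have "\<dots> = (\<Sum>x\<in>?S. f (chg v x)) + (\<Sum>i<N. 1 - of_bool (D < ?xs ! i)) * f D"
    by (simp only: sum.distrib top sum_distrib_right)
  finally show "(\<Sum>i=1..N. f (ordered_magnitude K v i)) = (\<Sum>x\<in>?S. f (chg v x)) + real (N - card ?S) * f D"
    using rest le by (simp add: of_nat_diff)
qed

section \<open>Expected stopping time\<close>

lemma (in bandit) measurable_stop_time: "stop_time \<pi> v \<in> noise \<rightarrow>\<^sub>M count_space UNIV"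
proof (subst measurable_count_space_eq_countable)
  have "stop_time \<pi> v -` {a} \<inter> space noise \<in> sets noise" for a
  proof (cases a)
    case (enat n)
    have "{\<omega>. stopping \<pi> (H \<omega> n) \<and> (\<forall>m<n. \<not> stopping \<pi> (H \<omega> m))} \<in> sets noise"
      by (rule sets_noiseI) measurable
    also have "{\<omega>. stopping \<pi> (H \<omega> n) \<and> (\<forall>m<n. \<not> stopping \<pi> (H \<omega> m))} = stop_time \<pi> v -` {a} \<inter> space noise"
      using enat by (auto simp: vimage_def stop_time_eq_enat)
    finally show ?thesis .
  next
    case infinity
    have "{\<omega>. \<not> stop_time \<pi> v \<omega> < \<infinity>} \<in> sets noise" by (rule sets_noiseI) measurable
    also have "{\<omega>. \<not> stop_time \<pi> v \<omega> < \<infinity>} = stop_time \<pi> v -` {a} \<inter> space noise"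
      using infinity by auto
    finally show ?thesis .
  qed
  then show "stop_time \<pi> v \<in> space noise \<rightarrow> UNIV \<and>
      (\<forall>a\<in>UNIV. stop_time \<pi> v -` {a} \<inter> space noise \<in> sets noise)" by auto
qed auto

lemma (in bandit) expected_stop_time_le:
  assumes h: "\<And>t. measure noise {\<omega>. enat t < stop_time \<pi> v \<omega>} \<le> h t" and "summable h"
  shows "expected_stop_time \<pi> v \<le> ennreal (suminf h)"
proof -
  have h0: "0 \<le> h t" for t using h[of t] by (meson measure_nonneg order_trans)
  have "expected_stop_time \<pi> v = (\<Sum>t. emeasure noise {\<omega> \<in> space noise. enat t < stop_time \<pi> v \<omega>})"
    unfolding expected_stop_time_def by (rule nn_integral_enat_function[OF measurable_stop_time])
  also have "\<dots> \<le> (\<Sum>t. ennreal (h t))"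
    using h by (intro suminf_le) (auto simp: noise.emeasure_eq_measure intro!: ennreal_leI)
  also have "\<dots> = ennreal (suminf h)"
    using h0 assms(2) by (rule suminf_ennreal2)
  finally show ?thesis .
qed

lemma (in bandit) prob_stop_finite:
  assumes "expected_stop_time \<pi> v < \<infinity>"
  shows "measure noise {\<omega>. stop_time \<pi> v \<omega> < \<infinity>} = 1"
proof -
  have "AE \<omega> in noise. ennreal_of_enat (stop_time \<pi> v \<omega>) \<noteq> \<infinity>"
  proof (rule nn_integral_PInf_AE)
    show "(\<lambda>\<omega>. ennreal_of_enat (stop_time \<pi> v \<omega>)) \<in> borel_measurable noise"
      by (rule measurable_compose[OF measurable_stop_time]) simp
    show "(\<integral>\<^sup>+\<omega>. ennreal_of_enat (stop_time \<pi> v \<omega>) \<partial>noise) \<noteq> \<infinity>"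
      using assms by (simp add: expected_stop_time_def less_top)
  qed
  moreover have "ennreal_of_enat n \<noteq> \<infinity> \<longleftrightarrow> n < \<infinity>" for n
    by (cases n) auto
  ultimately have "AE \<omega> in noise. \<omega> \<in> {\<omega>. stop_time \<pi> v \<omega> < \<infinity>}" by simp
  moreover have "{\<omega>. stop_time \<pi> v \<omega> < \<infinity>} \<in> noise.events"
    by (rule sets_noiseI) measurable
  ultimately show ?thesis by (subst noise.prob_eq_1)
qed

lemma sum_of_bool_less_le:
  assumes "0 \<le> a"
  shows "summable (\<lambda>t. of_bool (real t < a) :: real)" "(\<Sum>t. of_bool (real t < a) :: real) \<le> a + 1"
proof -
  have fin: "finite {..nat \<lfloor>a\<rfloor>}" by simp
  have zero: "of_bool (real t < a) = (0::real)" if "t \<notin> {..nat \<lfloor>a\<rfloor>}" for t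
    using that assms by (auto simp: not_le) linarith
  show "summable (\<lambda>t. of_bool (real t < a) :: real)"
    by (rule summable_finite[OF fin zero])
  have "(\<Sum>t. of_bool (real t < a) :: real) = (\<Sum>t\<in>{..nat \<lfloor>a\<rfloor>}. of_bool (real t < a))"
    by (rule suminf_finite[OF fin zero])
  also have "\<dots> \<le> (\<Sum>t\<in>{..nat \<lfloor>a\<rfloor>}. 1)" by (intro sum_mono) auto
  also have "\<dots> \<le> a + 1" using assms by simp
  finally show "(\<Sum>t. of_bool (real t < a) :: real) \<le> a + 1" .
qed

section \<open>Tail bounds uniform in \<delta> and their summation\<close>

locale mcpi_target =
  fixes K N :: nat and v :: env
  assumes N_pos: "1 \<le> N" and N_less: "N < K"
    and N_card: "N \<le> card (change_points K v)"
    and separated: "\<And>x. x \<in> change_points K v \<Longrightarrow> x + 1 \<notin> change_points K v"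
begin

definition D :: real where "D = magnitudes K v ! (N - 1)"

definition strict_top :: "nat set" where "strict_top = {x \<in> {1..K - 1}. D < chg v x}"

definition cost :: real where
  "cost = 8 * (\<Sum>i=1..N. 1 / (ordered_magnitude K v i)\<^sup>2)"

text \<open>The leading constant when the means are known only up to \<open>\<eta>\<close>; it tends
  to \<open>cost\<close> as \<open>\<eta>\<close> tends to 0.\<close>

definition cost_at :: "real \<Rightarrow> real" where
  "cost_at \<eta> = (\<Sum>x\<in>strict_top. 8 / (chg v x - 2 * \<eta>)\<^sup>2) + real (N - card strict_top) * (8 / (D - 2 * \<eta>)\<^sup>2)"

abbreviation tail :: "real \<Rightarrow> nat \<Rightarrow> real" where
  "tail \<delta> t \<equiv> measure noise {\<omega>. enat t < stop_time (mcpi K N \<delta>) v \<omega>}"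

lemma D_pos: "0 < D"
  unfolding D_def using magnitude_threshold(1)[OF N_pos N_card] .

lemma cost_at_tendsto: "(cost_at \<longlongrightarrow> cost) (at_right 0)"
proof -
  have "cost = (\<Sum>x\<in>strict_top. 8 / (chg v x - 2 * 0)\<^sup>2) + real (N - card strict_top) * (8 / (D - 2 * 0)\<^sup>2)"
    unfolding cost_def magnitude_threshold(3)[OF N_pos N_card, of "\<lambda>y. 1 / y\<^sup>2", folded D_def strict_top_def]
    by (simp add: sum_distrib_left algebra_simps strict_top_def)
  moreover have "chg v x \<noteq> 0" if "x \<in> strict_top" for x using that D_pos by (auto simp: strict_top_def)
  ultimately show ?thesis
    unfolding cost_at_def[abs_def] using D_pos by (auto intro!: tendsto_eq_intros)
qed

lemma cost_nonneg: "0 \<le> cost"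
  unfolding cost_def by (auto intro!: sum_nonneg)

lemma margin:
  obtains d where "0 < d" "d \<le> D"
    "\<And>x. x \<in> {1..K - 1} \<Longrightarrow> chg v x < D \<Longrightarrow> chg v x \<le> D - d"
    "\<And>x. x \<in> {1..K - 1} \<Longrightarrow> D < chg v x \<Longrightarrow> D + d \<le> chg v x"
proof -
  \<comment> \<open>Including \<open>D\<close> gives \<open>d \<le> D\<close>, the distance to
    magnitude 0, and keeps the set nonempty.\<close>
  let ?A = "insert D ((\<lambda>x. \<bar>chg v x - D\<bar>) ` {x \<in> {1..K - 1}. chg v x \<noteq> D})"
  have fin: "finite ?A" by simp
  have le: "Min ?A \<le> \<bar>chg v x - D\<bar>" if "x \<in> {1..K - 1}" "chg v x \<noteq> D" for x
    using that by (intro Min_le fin) auto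
  show thesis
  proof (rule that[of "Min ?A"])
    show "0 < Min ?A" using D_pos fin by (subst Min_gr_iff) auto
    show "Min ?A \<le> D" by (intro Min_le fin) auto
    show "chg v x \<le> D - Min ?A" if "x \<in> {1..K - 1}" "chg v x < D" for x
      using le[OF that(1)] that(2) by linarith
    show "D + Min ?A \<le> chg v x" if "x \<in> {1..K - 1}" "D < chg v x" for x
      using le[OF that(1)] that(2) by linarith
  qed
qed

text \<open>Quantifies over \<open>\<delta>\<close> inside, so that the round from which it holds
  does not depend on \<open>\<delta>\<close>.\<close>

definition runs_well :: "real \<Rightarrow> real \<Rightarrow> nat \<Rightarrow> bool" where
  "runs_well \<eta> d t \<longleftrightarrow> (\<forall>\<delta> \<omega>. 0 < \<delta> \<longrightarrow> \<delta> < 1 \<longrightarrow> enat t < stop_time (mcpi K N \<delta>) v \<omega> \<longrightarrow>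
    \<omega> \<notin> bandit.deviation K (mcpi K N \<delta>) v \<eta> (quota t + 1) \<longrightarrow>
    good_run K N \<delta> v \<omega> (start K t) t (base K t) \<eta> D d)"

definition deviates_rarely :: "real \<Rightarrow> nat \<Rightarrow> bool" where
  "deviates_rarely \<eta> t \<longleftrightarrow> (\<forall>\<delta>. measure noise (bandit.deviation K (mcpi K N \<delta>) v \<eta> (quota t + 1))
    \<le> real K * exp (- \<eta>\<^sup>2 * real (quota t + 1) / 8))"

lemma eventually_good_run:
  assumes \<eta>: "0 < \<eta>" "4 * \<eta> < d" and d: "d \<le> D"
    "\<And>x. x \<in> {1..K - 1} \<Longrightarrow> chg v x < D \<Longrightarrow> chg v x \<le> D - d"
    "\<And>x. x \<in> {1..K - 1} \<Longrightarrow> D < chg v x \<Longrightarrow> D + d \<le> chg v x"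
  shows "\<forall>\<^sub>F t in sequentially. runs_well \<eta> d t"
proof -
  have "\<forall>\<^sub>F s in sequentially. radius K s < ereal (D - 4 * \<eta>)"
    using \<eta> d by (intro radius_small) auto
  then obtain s0 where s0: "\<And>s. s0 \<le> s \<Longrightarrow> radius K s < ereal (D - 4 * \<eta>)"
    by (auto simp: eventually_sequentially)
  have "\<forall>\<^sub>F t in sequentially. s0 \<le> start K t"
    using start_at_top by (simp add: filterlim_at_top)
  moreover have "\<forall>\<^sub>F t in sequentially. 1 * (real (base K t) + 1) \<le> 1 * real t"
    by (rule base_small) simp
  ultimately show ?thesis
  proof eventually_elim
    case (elim t)
    show ?case unfolding runs_well_def
    proof (intro allI impI)
      fix \<delta> :: real and \<omega>
      assume \<delta>: "0 < \<delta>" "\<delta> < 1" and run: "enat t < stop_time (mcpi K N \<delta>) v \<omega>"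
        and dev: "\<omega> \<notin> bandit.deviation K (mcpi K N \<delta>) v \<eta> (quota t + 1)"
      interpret mcpi_env K N \<delta> v by unfold_locales (use \<delta> N_pos N_less in auto)
      have base: "start K t \<le> base K t" by (simp add: base_def)
      have "real (base K t + 1) \<le> real t" using elim(2) by simp
      then have base': "base K t + 1 \<le> t" by (simp only: of_nat_le_iff)
      show "good_run K N \<delta> v \<omega> (start K t) t (base K t) \<eta> D d"
      proof unfold_locales
        show "K \<le> start K t" by (simp add: start_def)
        show "start K t \<le> base K t" "start K t \<le> t" using base base' by auto
        show "sqrt (real t) \<le> real (base K t)"
          using real_nat_ceiling_ge[of "sqrt (real t)"] unfolding base_def of_nat_add
          by (rule order_trans) simp
        show "left \<omega> s \<noteq> 0" if "s \<le> t" for s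
          using run that by (simp add: stop_time_greater stopping_iff left_def)
        show "\<bar>emp_mean (H \<omega> s) a - v a\<bar> \<le> \<eta>" if s: "s \<in> {start K t..t}" and a: "a \<in> {1..K}" for s a
        proof -
          have T: "quota t < plays (H \<omega> s) a"
            using s a by (intro forced_exploration) (auto simp: start_def)
          have "\<not> \<eta> * plays (H \<omega> s) a < \<bar>noise_sum v (H \<omega> s) a\<bar>"
          proof
            assume "\<eta> * plays (H \<omega> s) a < \<bar>noise_sum v (H \<omega> s) a\<bar>"
            moreover have "quota t + 1 \<le> plays (H \<omega> s) a" using T by simp
            ultimately have "\<omega> \<in> deviation \<eta> (quota t + 1)" unfolding deviation_def using a by blast
            then show False using dev by blast
          qed
          then have "\<bar>noise_sum v (H \<omega> s) a\<bar> \<le> \<eta> * plays (H \<omega> s) a" by simp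
          then have "\<bar>noise_sum v (H \<omega> s) a\<bar> / plays (H \<omega> s) a \<le> \<eta>"
            using T by (subst pos_divide_le_eq) auto
          then show ?thesis using T by (subst emp_mean_eq[of _ _ v]) auto
        qed
        show "N \<le> card {x \<in> {1..K - 1}. D \<le> chg v x}"
          unfolding D_def by (rule magnitude_threshold(2)[OF N_pos N_card])
        show "radius K s < ereal (D - 4 * \<eta>)" if "s \<in> {start K t..t}" for s
          using that elim by (intro s0) auto
      qed (use \<eta> d separated in auto)
    qed
  qed
qed

lemma eventually_prob_deviation:
  assumes "0 < \<eta>"
  shows "\<forall>\<^sub>F t in sequentially. deviates_rarely \<eta> t"
proof -
  have "filterlim (\<lambda>t. root 4 (real t)) at_top sequentially" by real_asymp
  then have "\<forall>\<^sub>F t in sequentially. 64 / \<eta> ^ 4 \<le> root 4 (real t)"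
    by (simp add: filterlim_at_top)
  then show ?thesis
  proof eventually_elim
    case (elim t)
    show ?case unfolding deviates_rarely_def
    proof
      fix \<delta>
      interpret mcpi_policy K N \<delta> by unfold_locales (use N_pos N_less in auto)
      interpret bandit K "mcpi K N \<delta>" v by unfold_locales (rule is_policy_mcpi)
      show "measure noise (deviation \<eta> (quota t + 1)) \<le> real K * exp (- \<eta>\<^sup>2 * real (quota t + 1) / 8)"
        using quota_gt[of t] elim by (intro prob_deviation assms) linarith
    qed
  qed
qed

text \<open>All positions are charged the same cost \<open>G * \<beta> t + 2\<close>, without the
  argument on ties, so the only excluded event is the deviation event, whose probability is summable
  in \<open>t\<close>.\<close>

lemma tail_rough:
  obtains B t1 :: real and q where "0 \<le> B" "0 \<le> t1" "summable q" "\<And>t. 0 \<le> q t"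
    "\<And>\<delta> t. 0 < \<delta> \<Longrightarrow> \<delta> < 1 \<Longrightarrow> B * ln (1 / \<delta>) + t1 \<le> real t \<Longrightarrow> tail \<delta> t \<le> q t"
proof -
  obtain d where d: "0 < d" "d \<le> D"
    "\<And>x. x \<in> {1..K - 1} \<Longrightarrow> chg v x < D \<Longrightarrow> chg v x \<le> D - d"
    "\<And>x. x \<in> {1..K - 1} \<Longrightarrow> D < chg v x \<Longrightarrow> D + d \<le> chg v x"
    by (rule margin) blast
  define \<eta> where "\<eta> = d / 8"
  have \<eta>: "0 < \<eta>" "4 * \<eta> < d" using d by (auto simp: \<eta>_def)
  define G where "G = 8 / (D - 2 * \<eta>)\<^sup>2"
  have "0 < D - 2 * \<eta>" using \<eta> d by linarith
  then have G: "0 < G" by (simp add: G_def)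
  \<comment> \<open>The part \<open>e * t\<close> of the threshold then contributes at most
    \<open>t / 4\<close> in total. The plays of each arm up to \<open>base K t\<close> contribute
    another \<open>t / 4\<close>, so half of \<open>t\<close> remains against the terms in
    \<open>\<delta>\<close>.\<close>
  define e where "e = 1 / (4 * K * G)"
  have K: "0 < real K" using N_less by simp
  have e: "0 < e" "K * G * e = 1 / 4" using G K by (auto simp: e_def)
  obtain c where c: "0 \<le> c" "\<And>\<delta> t. 0 < \<delta> \<Longrightarrow> \<delta> < 1 \<Longrightarrow> 1 \<le> t \<Longrightarrow>
      threshold K t (\<delta> / real N) \<le> (1 + e) * ln (1 / \<delta>) + e * real t + c"
    using threshold_upper[OF N_pos N_less e(1)] by blast
  define q where "q t = real K * exp (- \<eta>\<^sup>2 * real (quota t + 1) / 8)" for t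
  have "\<forall>\<^sub>F t in sequentially. K * (real (base K t) + 1) \<le> 1 / 4 * real t"
    by (rule base_small) simp
  moreover have "\<forall>\<^sub>F t in sequentially. runs_well \<eta> d t"
    by (rule eventually_good_run) (use \<eta> d in auto)
  moreover note eventually_prob_deviation[OF \<eta>(1)]
  ultimately have "\<forall>\<^sub>F t in sequentially. runs_well \<eta> d t \<and> deviates_rarely \<eta> t \<and>
      K * (real (base K t) + 1) \<le> 1 / 4 * real t"
    by eventually_elim blast
  then obtain s where s: "\<And>t. s \<le> t \<Longrightarrow> runs_well \<eta> d t \<and> deviates_rarely \<eta> t \<and>
      K * (real (base K t) + 1) \<le> 1 / 4 * real t"
    unfolding eventually_sequentially by blast
  define B where "B = 2 * (K * G * (1 + e))"
  define t1 where "t1 = real s + 2 * (K * G * c + 2 * K) + 1"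
  have KG: "0 \<le> K * G" "0 \<le> K * G * c" using K G c by auto
  show thesis
  proof (rule that)
    show "0 \<le> B" "0 \<le> t1" using KG e by (auto simp: B_def t1_def)
    show "summable q" unfolding q_def by (rule summable_deviation[OF \<eta>(1)])
    show "0 \<le> q t" for t by (simp add: q_def)
    fix \<delta> :: real and t :: nat
    assume \<delta>: "0 < \<delta>" "\<delta> < 1" and t: "B * ln (1 / \<delta>) + t1 \<le> real t"
    interpret mcpi_env K N \<delta> v by unfold_locales (use \<delta> N_pos N_less in auto)
    have L: "0 \<le> ln (1 / \<delta>)" using \<delta> by simp
    then have BL: "0 \<le> B * ln (1 / \<delta>)" using \<open>0 \<le> B\<close> by simp
    have "real s + 1 \<le> real t" using t BL KG by (simp add: t1_def)
    then have st: "s \<le> t" "1 \<le> t" by auto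
    have "{\<omega>. enat t < stop_time (mcpi K N \<delta>) v \<omega>} \<subseteq> deviation \<eta> (quota t + 1)"
    proof (rule ccontr)
      assume "\<not> ?thesis"
      then obtain \<omega> where \<omega>: "enat t < stop_time (mcpi K N \<delta>) v \<omega>" "\<omega> \<notin> deviation \<eta> (quota t + 1)" by blast
      then interpret run: good_run K N \<delta> v \<omega> "start K t" t "base K t" \<eta> D d
        using s[OF st(1)] \<delta> unfolding runs_well_def by blast
      note b0 = run.threshold_nonneg
      have each: "2 * (4 * \<beta> t / (chg v x - 2 * \<eta>)\<^sup>2 + 1) \<le> G * \<beta> t + 2" if "x \<in> run.heavy (base K t)" for x
      proof -
        have Dx: "D \<le> chg v x" using that by (auto simp: run.heavy_def run.top_def)
        then have "(D - 2 * \<eta>)\<^sup>2 \<le> (chg v x - 2 * \<eta>)\<^sup>2" using \<open>0 < D - 2 * \<eta>\<close> by (intro power_mono) auto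
        then have "8 * \<beta> t / (chg v x - 2 * \<eta>)\<^sup>2 \<le> 8 * \<beta> t / (D - 2 * \<eta>)\<^sup>2"
          using \<open>0 < D - 2 * \<eta>\<close> b0 Dx by (intro divide_left_mono) (auto intro!: mult_pos_pos zero_less_power simp: zero_less_power2)
        then show ?thesis by (simp add: G_def)
      qed
      have "(\<Sum>x\<in>run.heavy (base K t). 2 * (4 * \<beta> t / (chg v x - 2 * \<eta>)\<^sup>2 + 1)) \<le> (\<Sum>x\<in>run.heavy (base K t). G * \<beta> t + 2)"
        by (intro sum_mono each)
      also have "\<dots> \<le> (\<Sum>x\<in>{1..K}. G * \<beta> t + 2)"
        using b0 G by (intro sum_mono2) (auto simp: run.heavy_def run.top_def)
      also have "\<dots> = K * G * \<beta> t + 2 * K" by (simp add: algebra_simps)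
      also have "\<dots> \<le> K * G * ((1 + e) * ln (1 / \<delta>) + e * real t + c) + 2 * K"
        using c(2)[OF \<delta> st(2)] KG by (intro add_mono mult_left_mono) auto
      also have "\<dots> = B * ln (1 / \<delta>) / 2 + K * G * e * real t + (K * G * c + 2 * K)"
        by (simp add: B_def algebra_simps)
      finally have "(\<Sum>x\<in>run.heavy (base K t). 2 * (4 * \<beta> t / (chg v x - 2 * \<eta>)\<^sup>2 + 1)) \<le> B * ln (1 / \<delta>) / 2 + real t / 4 + (K * G * c + 2 * K)"
        unfolding e(2) by simp
      moreover have "K * real (base K t) \<le> real t / 4" using s[OF st(1)] by (simp add: algebra_simps)
      moreover have "y \<le> b + 2 * z" if "x \<le> b / 2 + y / 4 + z" "k \<le> y / 4" "y \<le> k + x" for x y z b k :: real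
        using that by linarith
      ultimately have "real t \<le> B * ln (1 / \<delta>) + 2 * (K * G * c + 2 * K)"
        using run.total_bound[OF order_refl] by blast
      then show False using t by (simp add: t1_def)
    qed
    then have "tail \<delta> t \<le> measure noise (deviation \<eta> (quota t + 1))"
      using sets_deviation by (intro noise.finite_measure_mono)
    also have "\<dots> \<le> q t" using s[OF st(1)] unfolding deviates_rarely_def q_def by blast
    finally show "tail \<delta> t \<le> q t" .
  qed
qed

text \<open>Excluding the scaled deviations and the races leaves at most one unfound tied pair that
  is heavy, so \<open>total_bound_ties\<close> applies with the sharp constant. These two events
  have probability at most \<open>\<epsilon>' / 2\<close> each, for every large
  \<open>t\<close>.\<close>

lemma tail_fine:
  fixes \<epsilon> \<epsilon>' :: real
  assumes \<epsilon>: "0 < \<epsilon>" and \<epsilon>': "0 < \<epsilon>'"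
  obtains t1 :: real and q where "0 \<le> t1" "summable q" "\<And>t. 0 \<le> q t"
    "\<And>\<delta> t. 0 < \<delta> \<Longrightarrow> \<delta> < 1 \<Longrightarrow> (cost + \<epsilon>) * ln (1 / \<delta>) + t1 \<le> real t \<Longrightarrow> tail \<delta> t \<le> q t + \<epsilon>'"
proof -
  have K: "0 < real K" using N_less by simp
  obtain d where d: "0 < d" "d \<le> D"
    "\<And>x. x \<in> {1..K - 1} \<Longrightarrow> chg v x < D \<Longrightarrow> chg v x \<le> D - d"
    "\<And>x. x \<in> {1..K - 1} \<Longrightarrow> D < chg v x \<Longrightarrow> D + d \<le> chg v x"
    by (rule margin) blast
  define F where "F = cost + \<epsilon> / 2"
  have F: "0 < F" using cost_nonneg \<epsilon> by (simp add: F_def)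
  have "\<forall>\<^sub>F \<eta> in at_right 0. cost_at \<eta> < F"
    using cost_at_tendsto \<epsilon> by (intro order_tendstoD) (auto simp: F_def)
  moreover have "\<forall>\<^sub>F \<eta> in at_right 0. \<eta> \<in> {0<..<d / 4}"
    using d by (intro eventually_at_right_real) auto
  ultimately have "\<forall>\<^sub>F \<eta> in at_right 0. cost_at \<eta> < F \<and> \<eta> \<in> {0<..<d / 4}"
    by (rule eventually_conj)
  then obtain \<eta> where \<eta>: "cost_at \<eta> < F" "0 < \<eta>" "4 * \<eta> < d"
    by (auto dest!: eventually_happens)
  \<comment> \<open>The final inequality reads \<open>(1 - e - F * e) * t \<le> F * (1 + e) * ln (1
    / \<delta>) + c3\<close>. Solving it for \<open>t\<close> must give a factor of at most
    \<open>cost + \<epsilon>\<close>, which \<open>F < cost + \<epsilon>\<close> permits for small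
    \<open>e\<close>.\<close>
  have "((\<lambda>e. (cost + \<epsilon>) * (1 - e - F * e) - F * (1 + e)) \<longlongrightarrow> \<epsilon> / 2) (at_right 0)"
    by (auto intro!: tendsto_eq_intros simp: F_def)
  then have "\<forall>\<^sub>F e in at_right 0. 0 < (cost + \<epsilon>) * (1 - e - F * e) - F * (1 + e)"
    by (rule order_tendstoD(1)) (use \<epsilon> in simp)
  moreover have "((\<lambda>e. 1 - e - F * e) \<longlongrightarrow> 1) (at_right 0)"
    by (auto intro!: tendsto_eq_intros)
  then have "\<forall>\<^sub>F e in at_right 0. 1 / 2 < 1 - e - F * e"
    by (intro order_tendstoD) auto
  moreover have "\<forall>\<^sub>F e in at_right (0::real). 0 < e" by (rule eventually_at_right_less)
  ultimately have "\<forall>\<^sub>F e in at_right 0. 0 < (cost + \<epsilon>) * (1 - e - F * e) - F * (1 + e) \<and>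
      1 / 2 < 1 - e - F * e \<and> 0 < e"
    by eventually_elim blast
  then obtain e where e: "0 < (cost + \<epsilon>) * (1 - e - F * e) - F * (1 + e)" "1 / 2 < 1 - e - F * e" "0 < e"
    by (auto dest!: eventually_happens)
  obtain c where c: "0 \<le> c" "\<And>\<delta> t. 0 < \<delta> \<Longrightarrow> \<delta> < 1 \<Longrightarrow> 1 \<le> t \<Longrightarrow>
      threshold K t (\<delta> / real N) \<le> (1 + e) * ln (1 / \<delta>) + e * real t + c"
    using threshold_upper[OF N_pos N_less e(3)] by blast
  have "((\<lambda>C. real K * exp (1 / 2 - C\<^sup>2 / 16)) \<longlongrightarrow> 0) at_top" by real_asymp
  then have "\<forall>\<^sub>F C in at_top. real K * exp (1 / 2 - C\<^sup>2 / 16) < \<epsilon>' / 2"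
    using \<epsilon>' by (intro order_tendstoD) auto
  then have "\<forall>\<^sub>F C in at_top. real K * exp (1 / 2 - C\<^sup>2 / 16) < \<epsilon>' / 2 \<and> 3 \<le> C"
    by (intro eventually_conj eventually_ge_at_top)
  then obtain C where C: "real K * exp (1 / 2 - C\<^sup>2 / 16) < \<epsilon>' / 2" "3 \<le> C"
    by (auto dest!: eventually_happens)
  have C8: "8 \<le> C\<^sup>2" using power_mono[OF C(2), of 2] by simp
  have pos: "1 \<le> C" "0 < \<epsilon>' / (2 * K)" using C(2) \<epsilon>' K by auto
  obtain J R :: nat where R: "1 \<le> R"
    and race: "\<forall>K' \<pi> v x b. is_policy K' \<pi> \<longrightarrow> v x \<noteq> v (x + 1) \<longrightarrow> 0 < b \<longrightarrow>
      measure noise (bandit.race_event \<pi> v C (\<lambda>k. R ^ k * b) J x) \<le> \<epsilon>' / (2 * K)"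
    using race_parameters[OF pos] by blast
  \<comment> \<open>Makes the term \<open>K * M\<close> of the total bound at most
    \<open>e * t\<close>.\<close>
  define e2 where "e2 = e / K"
  have e2: "0 < e2" "K * e2 = e" using e K by (auto simp: e2_def)
  define q where "q t = real K * exp (- \<eta>\<^sup>2 * real (quota t + 1) / 8)" for t
  have "\<forall>\<^sub>F t in sequentially. real (R ^ J) * (real (base K t) + 1) \<le> e2 * real t"
    by (rule base_small[OF e2(1)])
  moreover have "\<forall>\<^sub>F t in sequentially. runs_well \<eta> d t"
    by (rule eventually_good_run) (use \<eta> d in auto)
  moreover note eventually_prob_deviation[OF \<eta>(2)]
  ultimately have "\<forall>\<^sub>F t in sequentially. runs_well \<eta> d t \<and> deviates_rarely \<eta> t \<and>
      real (R ^ J) * (real (base K t) + 1) \<le> e2 * real t"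
    by eventually_elim blast
  then obtain s where s: "\<And>t. s \<le> t \<Longrightarrow> runs_well \<eta> d t \<and> deviates_rarely \<eta> t \<and>
      real (R ^ J) * (real (base K t) + 1) \<le> e2 * real t"
    unfolding eventually_sequentially by blast
  define c3 where "c3 = F * c + 2 * (real K + real N)"
  have c3: "0 \<le> c3" using F c by (simp add: c3_def)
  define t1 where "t1 = real s + 2 * c3 + 1"
  show thesis
  proof (rule that)
    show "0 \<le> t1" using c3 by (simp add: t1_def)
    show "summable q" unfolding q_def by (rule summable_deviation[OF \<eta>(2)])
    show "0 \<le> q t" for t by (simp add: q_def)
    fix \<delta> :: real and t :: nat
    assume \<delta>: "0 < \<delta>" "\<delta> < 1" and t: "(cost + \<epsilon>) * ln (1 / \<delta>) + t1 \<le> real t"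
    interpret mcpi_env K N \<delta> v by unfold_locales (use \<delta> N_pos N_less in auto)
    have L: "0 \<le> ln (1 / \<delta>)" using \<delta> by simp
    then have CL: "0 \<le> (cost + \<epsilon>) * ln (1 / \<delta>)" using cost_nonneg \<epsilon> by (intro mult_nonneg_nonneg) auto
    have "real s + 1 \<le> real t" using t CL c3 by (simp add: t1_def)
    then have st: "s \<le> t" "1 \<le> t" by auto
    \<comment> \<open>\<open>M\<close> is linear in \<open>t\<close>, while the checkpoints start at
      order \<open>sqrt t\<close>. As \<open>R ^ J\<close> is a constant, all of them fit below
      \<open>M\<close> for large \<open>t\<close>.\<close>
    define M where "M = nat \<lfloor>e2 * real t\<rfloor>"
    define n where "n k = R ^ k * (base K t + 1)" for k
    have M_le: "real M \<le> e2 * real t" using e2 by (simp add: M_def)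
    have nJ: "n J \<le> M"
    proof -
      have "real (n J) \<le> e2 * real t" using s[OF st(1)] by (simp add: n_def algebra_simps)
      then show ?thesis unfolding M_def by (simp add: le_nat_floor)
    qed
    have nk: "base K t < n k \<and> n k \<le> M" if "k \<le> J" for k
    proof
      have "1 * (base K t + 1) \<le> n k" unfolding n_def using R by (intro mult_right_mono) auto
      then show "base K t < n k" by simp
      have "n k \<le> n J" unfolding n_def using R that by (intro mult_right_mono power_increasing) auto
      then show "n k \<le> M" using nJ by simp
    qed
    have M: "base K t \<le> M" "0 < M" using nk[of 0] by auto
    let ?races = "\<Union>x\<in>change_points K v. race_event C n J x"
    have "{\<omega>. enat t < stop_time (mcpi K N \<delta>) v \<omega>} \<subseteq>
        deviation \<eta> (quota t + 1) \<union> (deviation (C / (2 * sqrt M)) M \<union> ?races)"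
    proof (rule ccontr)
      assume "\<not> ?thesis"
      then obtain \<omega> where \<omega>: "enat t < stop_time (mcpi K N \<delta>) v \<omega>" "\<omega> \<notin> deviation \<eta> (quota t + 1)"
        "\<omega> \<notin> deviation (C / (2 * sqrt M)) M" "\<omega> \<notin> ?races" by blast
      then interpret run: good_run K N \<delta> v \<omega> "start K t" t "base K t" \<eta> D d
        using s[OF st(1)] \<delta> unfolding runs_well_def by blast
      have "card {x \<in> run.heavy M. chg v x = D \<and> x \<notin> found \<omega> t} \<le> 1"
      proof (rule run.unfound_ties)
        show "\<bar>noise_sum v (H \<omega> s) a\<bar> \<le> C / (2 * sqrt M) * real (T \<omega> s a)"
          if "a \<in> {1..K}" "M \<le> T \<omega> s a" for s a
        proof (rule ccontr)
          assume "\<not> ?thesis"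
          then have "\<omega> \<in> deviation (C / (2 * sqrt M)) M"
            unfolding deviation_def using that by (metis (mono_tags, lifting) mem_Collect_eq not_le)
          then show False using \<omega> by blast
        qed
        show "\<omega> \<notin> race_event C n J x" if "x \<in> change_points K v" for x using \<omega> that by blast
      qed (use C M nk in auto)
      note total = run.total_bound_ties[OF this M(1)]
      note b0 = run.threshold_nonneg
      have st_eq: "run.strict_top = strict_top" by (simp add: run.strict_top_def strict_top_def)
      have "(\<Sum>x\<in>strict_top. 2 * (4 * \<beta> t / (chg v x - 2 * \<eta>)\<^sup>2 + 1)) +
          real (N - card strict_top) * (2 * (4 * \<beta> t / (D - 2 * \<eta>)\<^sup>2 + 1))
        = cost_at \<eta> * \<beta> t + 2 * (real (card strict_top) + real (N - card strict_top))"
        unfolding cost_at_def by (simp add: sum.distrib sum_distrib_left sum_distrib_right algebra_simps)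
      also have "\<dots> \<le> F * \<beta> t + 2 * (real K + real N)"
      proof -
        have "card strict_top \<le> card {1..K - 1}" unfolding strict_top_def by (intro card_mono) auto
        then have "real (card strict_top) \<le> real K" by simp
        moreover have "cost_at \<eta> * \<beta> t \<le> F * \<beta> t" using \<eta> b0 by (intro mult_right_mono) auto
        ultimately show ?thesis by simp
      qed
      also have "\<dots> \<le> F * ((1 + e) * ln (1 / \<delta>) + e * real t + c) + 2 * (real K + real N)"
        using c(2)[OF \<delta> st(2)] F by (intro add_mono mult_left_mono) auto
      also have "\<dots> = F * (1 + e) * ln (1 / \<delta>) + F * e * real t + c3"
        by (simp add: c3_def algebra_simps)
      finally have sum_le: "(\<Sum>x\<in>strict_top. 2 * (4 * \<beta> t / (chg v x - 2 * \<eta>)\<^sup>2 + 1)) +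
          real (N - card strict_top) * (2 * (4 * \<beta> t / (D - 2 * \<eta>)\<^sup>2 + 1))
        \<le> F * (1 + e) * ln (1 / \<delta>) + F * e * real t + c3" .
      have KM: "real K * real M \<le> e * real t"
        using mult_left_mono[OF M_le, of "real K"] e2(2) by (simp add: mult.assoc[symmetric])
      have "real t \<le> e * real t + (F * (1 + e) * ln (1 / \<delta>) + F * e * real t + c3)"
        using total KM sum_le unfolding st_eq by linarith
      moreover have "F * (1 + e) * ln (1 / \<delta>) \<le> (cost + \<epsilon>) * (1 - e - F * e) * ln (1 / \<delta>)"
        using e(1) L by (intro mult_right_mono) auto
      ultimately have "(1 - e - F * e) * real t \<le> (1 - e - F * e) * ((cost + \<epsilon>) * ln (1 / \<delta>)) + c3"
        by (simp add: algebra_simps)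
      moreover have "c3 \<le> (1 - e - F * e) * (2 * c3)"
        using mult_right_mono[of "1 / 2" "1 - e - F * e" "2 * c3"] e(2) c3 by simp
      ultimately have "(1 - e - F * e) * real t \<le> (1 - e - F * e) * ((cost + \<epsilon>) * ln (1 / \<delta>) + 2 * c3)"
        by (simp add: distrib_left)
      then have "real t \<le> (cost + \<epsilon>) * ln (1 / \<delta>) + 2 * c3"
        using e(2) by simp
      then show False using t by (simp add: t1_def)
    qed
    then have "tail \<delta> t \<le> measure noise (deviation \<eta> (quota t + 1) \<union> (deviation (C / (2 * sqrt M)) M \<union> ?races))"
      using sets_deviation sets_race_event by (intro noise.finite_measure_mono) (auto intro!: sets.finite_UN)
    also have "\<dots> \<le> measure noise (deviation \<eta> (quota t + 1)) + (measure noise (deviation (C / (2 * sqrt M)) M) + measure noise ?races)"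
      using sets_deviation sets_race_event
      by (intro order_trans[OF measure_Un_le] add_left_mono measure_Un_le) (auto intro!: sets.finite_UN)
    also have "measure noise (deviation \<eta> (quota t + 1)) \<le> q t"
      using s[OF st(1)] unfolding deviates_rarely_def q_def by blast
    also have "measure noise (deviation (C / (2 * sqrt M)) M) \<le> \<epsilon>' / 2"
      using prob_deviation_scaled[OF C8 _ M(2)] C by linarith
    also have "measure noise ?races \<le> \<epsilon>' / 2"
    proof -
      have "measure noise ?races \<le> (\<Sum>x\<in>change_points K v. measure noise (race_event C n J x))"
        using sets_race_event by (intro noise.finite_measure_subadditive_finite) auto
      also have "\<dots> \<le> (\<Sum>x\<in>change_points K v. \<epsilon>' / (2 * K))"
        unfolding n_def
        by (intro sum_mono race[rule_format, of K] is_policy_mcpi) (auto simp: change_points_def)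
      also have "\<dots> = real (card (change_points K v)) * (\<epsilon>' / (2 * K))" by simp
      also have "\<dots> \<le> real K * (\<epsilon>' / (2 * K))"
      proof (rule mult_right_mono)
        have "card (change_points K v) \<le> card {1..K - 1}"
          unfolding change_points_def by (intro card_mono) auto
        then show "real (card (change_points K v)) \<le> real K" by simp
      qed (use \<epsilon>' in auto)
      also have "\<dots> = \<epsilon>' / 2" using K by simp
      finally show ?thesis .
    qed
    finally show "tail \<delta> t \<le> q t + \<epsilon>'" by simp
  qed
qed

lemma expected_stop_time_bound:
  assumes \<epsilon>: "0 < \<epsilon>"
  obtains c where "0 \<le> c" "\<And>\<delta>. 0 < \<delta> \<Longrightarrow> \<delta> < 1 \<Longrightarrow>
    expected_stop_time (mcpi K N \<delta>) v \<le> ennreal ((cost + \<epsilon>) * ln (1 / \<delta>) + c)"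
proof -
  obtain B t2 :: real and q2 where rough: "0 \<le> B" "0 \<le> t2" "summable q2" "\<And>t. 0 \<le> q2 t"
    "\<And>\<delta> t. 0 < \<delta> \<Longrightarrow> \<delta> < 1 \<Longrightarrow> B * ln (1 / \<delta>) + t2 \<le> real t \<Longrightarrow> tail \<delta> t \<le> q2 t"
    using tail_rough by blast
  \<comment> \<open>The constant error is incurred on about \<open>B * ln (1 / \<delta>)\<close>
    rounds and then costs about \<open>\<epsilon> / 2\<close> times
    \<open>ln (1 / \<delta>)\<close>.\<close>
  define \<epsilon>' where "\<epsilon>' = \<epsilon> / (2 * (B + 1))"
  have \<epsilon>': "0 < \<epsilon>'" "\<epsilon>' * B \<le> \<epsilon> / 2"
  proof -
    show "0 < \<epsilon>'" using \<epsilon> rough by (simp add: \<epsilon>'_def)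
    then have "\<epsilon>' * B \<le> \<epsilon>' * (B + 1)" by simp
    also have "\<dots> = \<epsilon> / 2" using rough(1) by (simp add: \<epsilon>'_def divide_simps)
    finally show "\<epsilon>' * B \<le> \<epsilon> / 2" .
  qed
  obtain t1 :: real and q1 where fine: "0 \<le> t1" "summable q1" "\<And>t. 0 \<le> q1 t"
    "\<And>\<delta> t. 0 < \<delta> \<Longrightarrow> \<delta> < 1 \<Longrightarrow> (cost + \<epsilon> / 2) * ln (1 / \<delta>) + t1 \<le> real t \<Longrightarrow> tail \<delta> t \<le> q1 t + \<epsilon>'"
    using tail_fine[of "\<epsilon> / 2" \<epsilon>'] \<epsilon> \<epsilon>' by auto
  define c where "c = (t1 + 1) + suminf q1 + \<epsilon>' * (t2 + 1) + suminf q2"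
  have c: "0 \<le> c"
    unfolding c_def using fine rough \<epsilon>' by (intro add_nonneg_nonneg mult_nonneg_nonneg suminf_nonneg) auto
  show thesis
  proof (rule that[OF c])
    fix \<delta> :: real assume \<delta>: "0 < \<delta>" "\<delta> < 1"
    interpret mcpi_env K N \<delta> v by unfold_locales (use \<delta> N_pos N_less in auto)
    define L where "L = ln (1 / \<delta>)"
    have L: "0 \<le> L" using \<delta> by (simp add: L_def)
    define a1 a2 where "a1 = (cost + \<epsilon> / 2) * L + t1" and "a2 = B * L + t2"
    have a: "0 \<le> a1" "0 \<le> a2"
      unfolding a1_def a2_def using L cost_nonneg \<epsilon> rough fine by (auto intro!: add_nonneg_nonneg mult_nonneg_nonneg)
    \<comment> \<open>Three ranges: below \<open>a1\<close> the trivial bound 1, between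
      \<open>a1\<close> and \<open>a2\<close> the fine bound, from \<open>a2\<close> on the rough
      one.\<close>
    define h where "h t = (of_bool (real t < a1) + q1 t) + (\<epsilon>' * of_bool (real t < a2) + q2 t)" for t
    have sm: "summable (\<lambda>t. of_bool (real t < a1) + q1 t)" "summable (\<lambda>t. \<epsilon>' * of_bool (real t < a2) + q2 t)"
      using sum_of_bool_less_le[OF a(1)] sum_of_bool_less_le[OF a(2)] fine rough
      by (auto intro!: summable_add summable_mult)
    have "tail \<delta> t \<le> h t" for t
    proof -
      consider "real t < a1" | "a2 \<le> real t" | "a1 \<le> real t" "real t < a2" by linarith
      then show ?thesis
      proof cases
        case 1
        then have "1 \<le> h t" using fine(3)[of t] rough(4)[of t] \<epsilon>' by (auto simp: h_def of_bool_def)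
        then show ?thesis using noise.prob_le_1 by (rule order_trans[rotated])
      next
        case 2
        then show ?thesis using rough(5)[OF \<delta>, of t] fine(3)[of t] \<epsilon>' by (auto simp: h_def of_bool_def a2_def L_def)
      next
        case 3
        then show ?thesis using fine(4)[OF \<delta>, of t] rough(4)[of t] by (auto simp: h_def of_bool_def a1_def L_def)
      qed
    qed
    moreover have "summable h" unfolding h_def by (intro summable_add sm)
    ultimately have "expected_stop_time (mcpi K N \<delta>) v \<le> ennreal (suminf h)"
      by (rule expected_stop_time_le)
    also have "suminf h \<le> (cost + \<epsilon>) * L + c"
    proof -
      have "suminf h = (suminf (\<lambda>t. of_bool (real t < a1)) + suminf q1) + (\<epsilon>' * suminf (\<lambda>t. of_bool (real t < a2)) + suminf q2)"
        unfolding h_def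
        using sum_of_bool_less_le(1)[OF a(1)] sum_of_bool_less_le(1)[OF a(2)] fine(2) rough(3) sm
        by (simp add: suminf_add[symmetric] suminf_mult[symmetric] summable_mult)
      also have "\<dots> \<le> ((a1 + 1) + suminf q1) + (\<epsilon>' * (a2 + 1) + suminf q2)"
        using sum_of_bool_less_le(2)[OF a(1)] sum_of_bool_less_le(2)[OF a(2)] \<epsilon>' by (intro add_mono mult_left_mono) auto
      also have "\<dots> = (cost + \<epsilon> / 2) * L + (\<epsilon>' * B) * L + c"
        by (simp add: a1_def a2_def c_def algebra_simps)
      also have "\<dots> \<le> (cost + \<epsilon> / 2) * L + (\<epsilon> / 2) * L + c"
        using \<epsilon>'(2) L by (intro add_mono mult_right_mono) auto
      also have "\<dots> = (cost + \<epsilon>) * L + c" by (simp add: algebra_simps)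
      finally show ?thesis .
    qed
    finally show "expected_stop_time (mcpi K N \<delta>) v \<le> ennreal ((cost + \<epsilon>) * ln (1 / \<delta>) + c)"
      by (simp add: L_def ennreal_leI)
  qed
qed

lemma prob_stop:
  assumes "0 < \<delta>" "\<delta> < 1"
  shows "measure noise {\<omega>. stop_time (mcpi K N \<delta>) v \<omega> < \<infinity>} = 1"
proof -
  interpret mcpi_env K N \<delta> v by unfold_locales (use assms N_pos N_less in auto)
  obtain c where "expected_stop_time (mcpi K N \<delta>) v \<le> ennreal ((cost + 1) * ln (1 / \<delta>) + c)"
    using expected_stop_time_bound[of 1] assms by auto
  also have "\<dots> < \<infinity>" by simp
  finally show ?thesis by (rule prob_stop_finite)
qed

lemma limsup_expected_stop_time:
  "Limsup (at_right 0) (\<lambda>\<delta>. expected_stop_time (mcpi K N \<delta>) v / ennreal (ln (1 / \<delta>))) \<le> ennreal cost"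
proof (rule ennreal_le_epsilon)
  fix \<epsilon> :: real assume \<epsilon>: "0 < \<epsilon>"
  obtain c where c: "0 \<le> c" "\<And>\<delta>. 0 < \<delta> \<Longrightarrow> \<delta> < 1 \<Longrightarrow>
      expected_stop_time (mcpi K N \<delta>) v \<le> ennreal ((cost + \<epsilon> / 2) * ln (1 / \<delta>) + c)"
    using expected_stop_time_bound[of "\<epsilon> / 2"] \<epsilon> by auto
  have "filterlim (\<lambda>\<delta>::real. ln (1 / \<delta>)) at_top (at_right 0)" by real_asymp
  \<comment> \<open>The 1 keeps the divisor positive, and the other bound absorbs \<open>c\<close>
    into the second half of \<open>\<epsilon>\<close>.\<close>
  then have "\<forall>\<^sub>F \<delta> in at_right 0. max 1 (c / (\<epsilon> / 2)) \<le> ln (1 / \<delta>)"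
    unfolding filterlim_at_top by blast
  moreover have "\<forall>\<^sub>F \<delta> in at_right (0::real). \<delta> \<in> {0<..<1}" by (rule eventually_at_right_real) simp
  ultimately have "\<forall>\<^sub>F \<delta> in at_right 0. expected_stop_time (mcpi K N \<delta>) v / ennreal (ln (1 / \<delta>)) \<le> ennreal (cost + \<epsilon>)"
  proof eventually_elim
    case (elim \<delta>)
    define L where "L = ln (1 / \<delta>)"
    have L: "1 \<le> L" "c / (\<epsilon> / 2) \<le> L" using elim by (auto simp: L_def)
    have cL: "c \<le> \<epsilon> / 2 * L" using L(2) \<epsilon> by (simp add: pos_divide_le_eq mult.commute)
    have "expected_stop_time (mcpi K N \<delta>) v / ennreal L \<le> ennreal ((cost + \<epsilon> / 2) * L + c) / ennreal L"
      using c(2)[of \<delta>] elim by (intro divide_right_mono_ennreal) (auto simp: L_def)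
    also have "\<dots> \<le> ennreal ((cost + \<epsilon>) * L) / ennreal L"
      using cL by (intro divide_right_mono_ennreal ennreal_leI) (simp add: algebra_simps)
    also have "\<dots> = ennreal (cost + \<epsilon>)"
      using L cost_nonneg \<epsilon> by (subst divide_ennreal) auto
    finally show ?case by (simp add: L_def)
  qed
  then have "Limsup (at_right 0) (\<lambda>\<delta>. expected_stop_time (mcpi K N \<delta>) v / ennreal (ln (1 / \<delta>))) \<le> ennreal (cost + \<epsilon>)"
    by (rule Limsup_bounded)
  also have "\<dots> = ennreal cost + ennreal \<epsilon>" using cost_nonneg \<epsilon> by simp
  finally show "Limsup (at_right 0) (\<lambda>\<delta>. expected_stop_time (mcpi K N \<delta>) v / ennreal (ln (1 / \<delta>))) \<le> ennreal cost + ennreal \<epsilon>" .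
qed

end

lemma mcpi_target_env_class:
  assumes "1 \<le> N" "N < K" "N \<le> m" "v \<in> env_class K m"
  shows "mcpi_target K N v"
proof
  show "N \<le> card (change_points K v)" using assms by (simp add: env_class_def)
qed (use assms change_points_separated in auto)

theorem theorem5p7:
  fixes K N :: nat
  assumes "1 \<le> N" and "N < K"
  shows "(\<forall>\<delta>\<in>{0<..<1::real}. exact_policy K N \<delta> (mcpi K N \<delta>) \<and> any_policy K N \<delta> (mcpi K N \<delta>)) \<and>
    (\<forall>m\<ge>N. \<forall>v\<in>env_class K m.
       Limsup (at_right 0) (\<lambda>\<delta>::real. expected_stop_time (mcpi K N \<delta>) v / ennreal (ln (1 / \<delta>)))
         \<le> ennreal (8 * noise_sd\<^sup>2 * (\<Sum>i=1..N. 1 / (ordered_magnitude K v i)\<^sup>2)))"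
proof (intro conjI ballI allI impI)
  fix \<delta> :: real assume "\<delta> \<in> {0<..<1}"
  then have \<delta>: "0 < \<delta>" "\<delta> < 1" by auto
  have env: "mcpi_env K N \<delta>" by unfold_locales (use assms \<delta> in auto)
  have policy: "is_policy K (mcpi K N \<delta>)"
    by (rule mcpi_policy.is_policy_mcpi) (use assms in unfold_locales)
  have size: "card (estimate (mcpi K N \<delta>) v \<omega>) = N" "estimate (mcpi K N \<delta>) v \<omega> \<subseteq> {1..K - 1}"
    if "stop_time (mcpi K N \<delta>) v \<omega> < \<infinity>" for v \<omega>
    using mcpi_env.card_estimate[OF env that] by auto
  have stop: "measure noise {\<omega>. stop_time (mcpi K N \<delta>) v \<omega> < \<infinity>} = 1"
    and correct: "1 - \<delta> < measure noise {\<omega>. stop_time (mcpi K N \<delta>) v \<omega> < \<infinity> \<and> estimate (mcpi K N \<delta>) v \<omega> \<subseteq> change_points K v}"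
    if "N \<le> m" "v \<in> env_class K m" for m v
  proof -
    show s: "measure noise {\<omega>. stop_time (mcpi K N \<delta>) v \<omega> < \<infinity>} = 1"
      by (rule mcpi_target.prob_stop[OF mcpi_target_env_class[OF assms that] \<delta>])
    show "1 - \<delta> < measure noise {\<omega>. stop_time (mcpi K N \<delta>) v \<omega> < \<infinity> \<and> estimate (mcpi K N \<delta>) v \<omega> \<subseteq> change_points K v}"
      by (rule mcpi_env.prob_correct[OF env s])
  qed
  show "any_policy K N \<delta> (mcpi K N \<delta>)"
    unfolding any_policy_def using policy size(1) stop correct by simp
  \<comment> \<open>With exactly \<open>N\<close> change points an inclusion of a set of size
    \<open>N\<close> is an equality, so correctness for the exact policy reduces to that for the any
    policy.\<close>
  have "estimate (mcpi K N \<delta>) v \<omega> = change_points K v \<longleftrightarrow> estimate (mcpi K N \<delta>) v \<omega> \<subseteq> change_points K v"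
    if "v \<in> env_class K N" "stop_time (mcpi K N \<delta>) v \<omega> < \<infinity>" for v \<omega>
    using size(1)[OF that(2)] that(1) card_subset_eq[of "change_points K v" "estimate (mcpi K N \<delta>) v \<omega>"]
    by (auto simp: env_class_def)
  then have "{\<omega>. stop_time (mcpi K N \<delta>) v \<omega> < \<infinity> \<and> estimate (mcpi K N \<delta>) v \<omega> = change_points K v} =
      {\<omega>. stop_time (mcpi K N \<delta>) v \<omega> < \<infinity> \<and> estimate (mcpi K N \<delta>) v \<omega> \<subseteq> change_points K v}"
    if "v \<in> env_class K N" for v
    using that by blast
  then show "exact_policy K N \<delta> (mcpi K N \<delta>)"
    unfolding exact_policy_def using policy stop[of N] correct[of N] by simp
next
  fix m v assume "N \<le> m" "v \<in> env_class K m"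
  then interpret mcpi_target K N v by (intro mcpi_target_env_class assms)
  show "Limsup (at_right 0) (\<lambda>\<delta>::real. expected_stop_time (mcpi K N \<delta>) v / ennreal (ln (1 / \<delta>)))
      \<le> ennreal (8 * noise_sd\<^sup>2 * (\<Sum>i=1..N. 1 / (ordered_magnitude K v i)\<^sup>2))"
    using limsup_expected_stop_time by (simp add: cost_def noise_sd_def)
qed

end
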